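(* Let $R$ be a commutative Noetherian ring, let $I \subseteq R$ be an ideal and let $u$ be a positive rational number. Set $$K = \bigcap_{\substack{\mathfrak p \in \mathrm{Ass}_R^*(I) \\ \mathrm{grade}(\mathfrak p, R/I) \ge 1}} \mathfrak p \qquad \text{ and }\qquad K_u = \bigcap_{\substack{\mathfrak p \in \mathrm{Ass}_R(\overline{I^u}) \\ \mathrm{grade}(\mathfrak p,R/I) \ge 1}} \mathfrak p.$$ Let $x \in K$ be any element that is regular on $R/I$ if $\{\mathfrak p \in \mathrm{Ass}_R^*(I) \mid \mathrm{grade}(\mathfrak p,R/I)\ge 1\}\neq \emptyset$, and let $x = 1$ otherwise. Then $$\overline{I^{(u)}} = \overline{I^{(u)}_K} = \overline{I^{(u)}_{K_u}} = \overline{I^{(u)}_{(x)}}.$$ In particular, an irredundant primary decomposition of the rational symbolic power $\overline{I^{(u)}}$ is obtained from an irredundant primary decomposition of the rational power $\overline{I^u}$ by intersecting only the components primary to ideals $\mathfrak p$ which are contained in some element of $\mathrm{Ass}_R(I)$.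
   Context: For an ideal $J$, $\mathrm{Ass}_R(J)$ (also $\mathrm{Ass}(J)$) denotes $\mathrm{Ass}_R(R/J)$, and $\overline J$ its integral closure. For $u=\frac pq$ ($p,q$ positive integers), the $u$-th rational power of $I$ is $\overline{I^u}=\{f\in R \mid f^q\in \overline{I^p}\}$ ($\overline{I^p}$ being the integral closure of $I^p$), independent of the presentation of $u$. The $u$-th rational symbolic power of $I$ is $\overline{I^{(u)}}=\bigcap_{\mathfrak p\in \mathrm{Ass}(I)}(\overline{I^u}R_{\mathfrak p}\cap R)$, where $JR_{\mathfrak p}\cap R$ is the preimage of $JR_{\mathfrak p}$ in $R$; $\overline{I^{(u)}}$ always has this meaning here, also for integer $u$. For an ideal $L$, the $u$-th saturated power of $I$ with respect to $L$ is $\overline{I^{(u)}_L}=\overline{I^u}:L^\infty=\bigcup_{m\ge 1}(\overline{I^u}:L^m)$. $\mathrm{Ass}_R^*(I)=\bigcup_{u\in\mathbb Q,\,u>0}\mathrm{Ass}_R(\overline{I^u})$ (a finite set). $\mathrm{grade}(\mathfrak p,R/I)$ is the maximal length of an $R/I$-regular sequence contained in $\mathfrak p$. An intersection over an empty set of primes is $R$. *)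

theory Defs
  imports "HOL-Algebra.Algebra" "HOL-Library.Extended_Nat"
begin

section \<open>Ideals\<close>

abbreviation ideal_power :: "('a, 'b) ring_scheme \<Rightarrow> 'a set \<Rightarrow> nat \<Rightarrow> 'a set"
  where "ideal_power R J n \<equiv> J [^]\<^bsub>ideals_set R\<^esub> n"

definition ideal_colon :: "('a, 'b) ring_scheme \<Rightarrow> 'a set \<Rightarrow> 'a set \<Rightarrow> 'a set"
  where "ideal_colon R J L = {r \<in> carrier R. \<forall>l\<in>L. r \<otimes>\<^bsub>R\<^esub> l \<in> J}"

definition saturation :: "('a, 'b) ring_scheme \<Rightarrow> 'a set \<Rightarrow> 'a set \<Rightarrow> 'a set"
  where "saturation R J L = (\<Union>m\<in>{1..}. ideal_colon R J (ideal_power R L m))"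

definition radical :: "('a, 'b) ring_scheme \<Rightarrow> 'a set \<Rightarrow> 'a set"
  where "radical R J = {r \<in> carrier R. \<exists>n\<ge>1. r [^]\<^bsub>R\<^esub> (n::nat) \<in> J}"

text \<open>The intersection of a family of ideals of \<open>R\<close>; the empty intersection is \<open>R\<close>.\<close>

definition ideal_Inter :: "('a, 'b) ring_scheme \<Rightarrow> 'a set set \<Rightarrow> 'a set"
  where "ideal_Inter R F = carrier R \<inter> \<Inter>F"

text \<open>\<open>r\<close> is integral over \<open>J\<close> if \<open>r^n + a 1 r^(n-1) + \<dots> + a n = 0\<close> for some \<open>n \<ge> 1\<close> and
  \<open>a i \<in> J^i\<close>.\<close>

definition integral_closure :: "('a, 'b) ring_scheme \<Rightarrow> 'a set \<Rightarrow> 'a set"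
  where "integral_closure R J =
    {r \<in> carrier R. \<exists>(n::nat)\<ge>1. \<exists>a. (\<forall>i\<in>{1..n}. a i \<in> ideal_power R J i) \<and>
       r [^]\<^bsub>R\<^esub> n \<oplus>\<^bsub>R\<^esub> (\<Oplus>\<^bsub>R\<^esub>i\<in>{1..n}. a i \<otimes>\<^bsub>R\<^esub> r [^]\<^bsub>R\<^esub> (n - i)) = \<zero>\<^bsub>R\<^esub>}"

section \<open>Associated primes and primary decompositions\<close>

text \<open>\<open>Ass R J\<close> is the set of associated primes of the \<open>R\<close>-module \<open>R/J\<close>: the prime ideals of \<open>R\<close> that
  are the annihilator of some \<open>x \<in> R/J\<close>.\<close>

definition Ass :: "('a, 'b) ring_scheme \<Rightarrow> 'a set \<Rightarrow> 'a set set"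
  where "Ass R J =
    {p. primeideal p R \<and>
        (\<exists>x\<in>carrier (R Quot J).
           p = {r \<in> carrier R. (J +>\<^bsub>R\<^esub> r) \<otimes>\<^bsub>R Quot J\<^esub> x = \<zero>\<^bsub>R Quot J\<^esub>})}"

definition primary_ideal :: "('a, 'b) ring_scheme \<Rightarrow> 'a set \<Rightarrow> bool"
  where "primary_ideal R q \<longleftrightarrow>
    ideal q R \<and> q \<noteq> carrier R \<and>
    (\<forall>a\<in>carrier R. \<forall>b\<in>carrier R.
       a \<otimes>\<^bsub>R\<^esub> b \<in> q \<longrightarrow> a \<in> q \<or> (\<exists>n\<ge>1. b [^]\<^bsub>R\<^esub> (n::nat) \<in> q))"

definition irredundant_primary_decomposition ::
    "('a, 'b) ring_scheme \<Rightarrow> 'a set set \<Rightarrow> 'a set \<Rightarrow> bool"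
  where "irredundant_primary_decomposition R Q J \<longleftrightarrow>
    finite Q \<and> (\<forall>q\<in>Q. primary_ideal R q) \<and> ideal_Inter R Q = J \<and>
    (\<forall>q\<in>Q. ideal_Inter R (Q - {q}) \<noteq> J) \<and> inj_on (radical R) Q"

section \<open>Localization at a prime\<close>

definition loc_rel :: "('a, 'b) ring_scheme \<Rightarrow> 'a set \<Rightarrow> (('a \<times> 'a) \<times> ('a \<times> 'a)) set"
  where "loc_rel R p =
    {((a, s), (b, t)). a \<in> carrier R \<and> s \<in> carrier R - p \<and> b \<in> carrier R \<and> t \<in> carrier R - p \<and>
       (\<exists>w\<in>carrier R - p. w \<otimes>\<^bsub>R\<^esub> (t \<otimes>\<^bsub>R\<^esub> a) = w \<otimes>\<^bsub>R\<^esub> (s \<otimes>\<^bsub>R\<^esub> b))}"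

text \<open>The fraction \<open>a/s\<close> in \<open>R\<^sub>p\<close>.\<close>

definition loc_frac :: "('a, 'b) ring_scheme \<Rightarrow> 'a set \<Rightarrow> 'a \<Rightarrow> 'a \<Rightarrow> ('a \<times> 'a) set"
  where "loc_frac R p a s = loc_rel R p `` {(a, s)}"

definition localization :: "('a, 'b) ring_scheme \<Rightarrow> 'a set \<Rightarrow> ('a \<times> 'a) set ring"
  where "localization R p =
    \<lparr>carrier = (carrier R \<times> (carrier R - p)) // loc_rel R p,
     monoid.mult = (\<lambda>A B. \<Union>(a, s)\<in>A. \<Union>(b, t)\<in>B. loc_frac R p (a \<otimes>\<^bsub>R\<^esub> b) (s \<otimes>\<^bsub>R\<^esub> t)),
     one = loc_frac R p \<one>\<^bsub>R\<^esub> \<one>\<^bsub>R\<^esub>,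
     ring.zero = loc_frac R p \<zero>\<^bsub>R\<^esub> \<one>\<^bsub>R\<^esub>,
     add = (\<lambda>A B. \<Union>(a, s)\<in>A. \<Union>(b, t)\<in>B.
              loc_frac R p (t \<otimes>\<^bsub>R\<^esub> a \<oplus>\<^bsub>R\<^esub> s \<otimes>\<^bsub>R\<^esub> b) (s \<otimes>\<^bsub>R\<^esub> t))\<rparr>"

definition loc_map :: "('a, 'b) ring_scheme \<Rightarrow> 'a set \<Rightarrow> 'a \<Rightarrow> ('a \<times> 'a) set"
  where "loc_map R p a = loc_frac R p a \<one>\<^bsub>R\<^esub>"

text \<open>\<open>J R\<^sub>p \<inter> R\<close>\<close>

definition loc_contraction :: "('a, 'b) ring_scheme \<Rightarrow> 'a set \<Rightarrow> 'a set \<Rightarrow> 'a set"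
  where "loc_contraction R p J =
    {r \<in> carrier R. loc_map R p r \<in> Idl\<^bsub>localization R p\<^esub> (loc_map R p ` J)}"

section \<open>Rational powers\<close>

text \<open>The set does not depend on the presentation of \<open>u > 0\<close> as a quotient of positive integers; the
  definition uses the reduced one.\<close>

definition rational_power :: "('a, 'b) ring_scheme \<Rightarrow> 'a set \<Rightarrow> rat \<Rightarrow> 'a set"
  where "rational_power R I u =
    (let (p, q) = quotient_of u
     in {f \<in> carrier R. f [^]\<^bsub>R\<^esub> nat q \<in> integral_closure R (ideal_power R I (nat p))})"

definition rational_symbolic_power :: "('a, 'b) ring_scheme \<Rightarrow> 'a set \<Rightarrow> rat \<Rightarrow> 'a set"
  where "rational_symbolic_power R I u =
    ideal_Inter R ((\<lambda>p. loc_contraction R p (rational_power R I u)) ` Ass R I)"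

definition saturated_power :: "('a, 'b) ring_scheme \<Rightarrow> 'a set \<Rightarrow> 'a set \<Rightarrow> rat \<Rightarrow> 'a set"
  where "saturated_power R I L u = saturation R (rational_power R I u) L"

definition Ass_star :: "('a, 'b) ring_scheme \<Rightarrow> 'a set \<Rightarrow> 'a set set"
  where "Ass_star R I = (\<Union>u\<in>{0<..}. Ass R (rational_power R I u))"

section \<open>Regular sequences and grade\<close>

definition regular_on_quot :: "('a, 'b) ring_scheme \<Rightarrow> 'a set \<Rightarrow> 'a \<Rightarrow> bool"
  where "regular_on_quot R J x \<longleftrightarrow>
    x \<in> carrier R \<and>
    (\<forall>y\<in>carrier (R Quot J). (J +>\<^bsub>R\<^esub> x) \<otimes>\<^bsub>R Quot J\<^esub> y = \<zero>\<^bsub>R Quot J\<^esub> \<longrightarrow> y = \<zero>\<^bsub>R Quot J\<^esub>)"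

text \<open>For \<open>M = R/J\<close>, the module \<open>M/(x\<^sub>1, \<dots>, x\<^sub>i)M\<close> is \<open>R/(J + (x\<^sub>1, \<dots>, x\<^sub>i))\<close>. The last condition is
  \<open>M \<noteq> (x\<^sub>1, \<dots>, x\<^sub>n)M\<close>.\<close>

definition regular_sequence_on_quot :: "('a, 'b) ring_scheme \<Rightarrow> 'a set \<Rightarrow> 'a list \<Rightarrow> bool"
  where "regular_sequence_on_quot R J xs \<longleftrightarrow>
    set xs \<subseteq> carrier R \<and>
    (\<forall>i<length xs. regular_on_quot R (J <+>\<^bsub>R\<^esub> Idl\<^bsub>R\<^esub> (set (take i xs))) (xs ! i)) \<and>
    J <+>\<^bsub>R\<^esub> Idl\<^bsub>R\<^esub> (set xs) \<noteq> carrier R"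

text \<open>\<open>grade_quot R p J\<close> is \<open>grade(p, R/J)\<close>. The value is an extended natural number, so that the
  supremum does not presuppose a bound on the lengths.\<close>

definition grade_quot :: "('a, 'b) ring_scheme \<Rightarrow> 'a set \<Rightarrow> 'a set \<Rightarrow> enat"
  where "grade_quot R p J =
    (SUP xs\<in>{xs. set xs \<subseteq> p \<and> regular_sequence_on_quot R J xs}. enat (length xs))"

end

theory Submission
  imports Defs
begin

text \<open>Let \<open>J\<close> be the \<open>u\<close>-th rational power of \<open>I\<close>, with \<open>u = p/q\<close>. Membership of \<open>r\<close> in the symbolic
  power or in a saturated power is a statement about the colon ideal \<open>(J : r)\<close>: the first says
  that \<open>(J : r)\<close> is contained in no \<open>P \<in> Ass(I)\<close>, the second that \<open>(J : r)\<close> contains a power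
  of \<open>L\<close>. In a Noetherian ring an ideal \<open>(J : r)\<close> that misses a multiplicatively closed set lies
  in an associated prime of \<open>J\<close> that misses the set too (\<open>associated_prime_avoiding\<close>). Apply
  this to the powers of an element \<open>l \<in> L\<close> no power of which lies in \<open>(J : r)\<close>: the
  resulting \<open>Q \<in> Ass(J)\<close> does not contain \<open>L\<close>. So if \<open>L\<close> lies in every \<open>Q \<in> Ass(J)\<close> that
  is not below some \<open>P \<in> Ass(I)\<close>, this \<open>Q\<close> is below such a \<open>P\<close>, and \<open>r\<close> is not in the
  symbolic power. If moreover \<open>L\<close> lies in no \<open>P \<in> Ass(I)\<close>, the converse is immediate, and
  the saturation with respect to \<open>L\<close> is the symbolic power (\<open>saturation_eq_symbolic_power\<close>). By
  prime avoidance, the members of \<open>Ass(J)\<close> that are not below some \<open>P \<in> Ass(I)\<close> are those of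
  positive grade on \<open>R/I\<close>, so the ideals \<open>K\<close>, \<open>K_u\<close> and \<open>(x)\<close> meet the first requirement. The
  second one is clear for \<open>(x)\<close>. For \<open>K\<close> and \<open>K_u\<close> it holds because a prime that contains a
  finite intersection of ideals contains one of them; this is where the set \<open>Ass*(I)\<close> has to be
  finite.

  Finiteness is the substantial part. It is deduced from two facts. First, an element \<open>f\<close> lies
  in \<open>J\<close> iff there is a constant \<open>c\<close> such that \<open>f^k \<in> I^m\<close> whenever \<open>m \<le> (p/q) k - c\<close>
  (\<open>integral_power_iff_growth\<close>). This criterion makes it evident that \<open>J\<close> is an ideal, and a
  version of it with denominators (\<open>local_growth_imp_integral\<close>) shows
  \<open>Ass(J) \<subseteq> (\<Union>n. Ass(I^n))\<close> (\<open>Ass_rational_power_subset\<close>): if \<open>P = (J : f)\<close>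
  were not associated to any \<open>I^m\<close>, the bounds on \<open>f^k P^k\<close> would yield the same bounds on \<open>f^k\<close>
  at \<open>P\<close>, and \<open>f\<close> would be in \<open>J\<close> at \<open>P\<close>. Second, the set \<open>(\<Union>n. Ass(I^n))\<close> is finite by a
  theorem of Brodmann (\<open>finite_Ass_powers\<close>).

  Both facts need that the Rees algebra of \<open>I\<close> is Noetherian. The proofs use this in the form of
  a chain condition for families \<open>M 0, M 1, \<dots>\<close> of ideals of \<open>R\<close> with \<open>M k \<subseteq> I^k\<close>
  and \<open>I (M k) \<subseteq> M (k + 1)\<close>, that is, for the graded ideals of the Rees algebra
  (\<open>graded_chain_stabilises\<close>). It is proved by adjoining the generators of \<open>I\<close> one at a time,
  with the argument of Hilbert's basis theorem on leading coefficients carried out on families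
  of ideals of \<open>R\<close>.

  As to primary decompositions, some element outside a given \<open>P \<in> Ass(I)\<close> lies in all
  components of \<open>J\<close> whose radical is not contained in \<open>P\<close>, so that exactly the other components
  are seen by the localization at \<open>P\<close>.\<close>

section \<open>Ideals and their powers\<close>

context cring
begin

lemma colon_elem_iff [simp]:
  "r \<in> ideal_colon R B {z} \<longleftrightarrow> r \<in> carrier R \<and> r \<otimes> z \<in> B"
  by (simp add: ideal_colon_def)

lemma ideal_colon_elem:
  assumes "ideal B R" "z \<in> carrier R"
  shows "ideal (ideal_colon R B {z}) R"
proof -
  have "ideal_colon R B {z} = {x \<in> carrier R. z \<otimes> x \<in> B}"
    using assms(2) by (auto simp: ideal_colon_def m_comm)
  with ideal.helper_max_prime[OF assms(1) is_cring assms(2)] show ?thesis by simp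
qed

lemma subset_colon_elem:
  assumes "ideal B R" "z \<in> carrier R"
  shows "B \<subseteq> ideal_colon R B {z}"
  using assms by (auto intro: ideal.Icarr ideal.I_r_closed)

lemma ideal_subset: "ideal B R \<Longrightarrow> B \<subseteq> carrier R"
  by (simp add: additive_subgroup.a_subset ideal.axioms(1))

lemma ideal_add: "ideal B R \<Longrightarrow> a \<in> B \<Longrightarrow> b \<in> B \<Longrightarrow> a \<oplus> b \<in> B"
  by (simp add: additive_subgroup.a_closed ideal.axioms(1))

lemma ideal_zero: "ideal B R \<Longrightarrow> \<zero> \<in> B"
  by (simp add: additive_subgroup.zero_closed ideal.axioms(1))

lemma ideal_neg: "ideal B R \<Longrightarrow> a \<in> B \<Longrightarrow> \<ominus> a \<in> B"
  by (simp add: additive_subgroup.a_inv_closed ideal.axioms(1))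

lemma ideal_add_cancel:
  assumes "ideal B R" "a \<oplus> b \<in> B" "b \<in> B" "a \<in> carrier R"
  shows "a \<in> B"
proof -
  have b: "b \<in> carrier R" using assms ideal.Icarr by fast
  have "(a \<oplus> b) \<oplus> \<ominus> b \<in> B" using assms ideal_add ideal_neg by blast
  also have "(a \<oplus> b) \<oplus> \<ominus> b = a" using assms(4) b by algebra
  finally show ?thesis .
qed

lemma ideal_finsum:
  assumes "ideal B R" "finite A" "\<And>i. i \<in> A \<Longrightarrow> f i \<in> B"
  shows "(\<Oplus>i\<in>A. f i) \<in> B"
  using assms(2,3)
proof (induction A rule: finite_induct)
  case empty
  then show ?case using assms(1) by (simp add: ideal_zero)
next
  case (insert x F)
  have "f \<in> F \<rightarrow> carrier R" "f x \<in> carrier R"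
    using insert assms(1) ideal.Icarr by fast+
  with insert show ?case using ideal_add[OF assms(1)] by simp
qed

lemma idealI_elem:
  assumes "B \<subseteq> carrier R" "\<zero> \<in> B" "\<And>a b. a \<in> B \<Longrightarrow> b \<in> B \<Longrightarrow> a \<oplus> b \<in> B"
    and "\<And>a x. a \<in> B \<Longrightarrow> x \<in> carrier R \<Longrightarrow> x \<otimes> a \<in> B"
  shows "ideal B R"
proof (rule idealI[OF ring_axioms])
  show "subgroup B (add_monoid R)"
  proof (rule add.subgroupI)
    show "B \<subseteq> carrier R" using assms(1) .
    show "B \<noteq> {}" using assms(2) by auto
    fix a assume a: "a \<in> B"
    have "\<ominus> \<one> \<otimes> a \<in> B" using assms(4)[OF a, of "\<ominus> \<one>"] by simp
    moreover have "\<ominus> \<one> \<otimes> a = \<ominus> a" using a assms(1) by (simp add: l_minus subset_iff)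
    ultimately show "\<ominus> a \<in> B" by simp
  qed (use assms(3) in auto)
  show "a \<otimes> x \<in> B" if "a \<in> B" "x \<in> carrier R" for a x
    using assms(4)[OF that] that assms(1) by (simp add: m_comm subset_iff)
qed (use assms in auto)

lemma monoid_ideals: "monoid (ideals_set R)"
  using ideals_set_is_semiring semiring.axioms(2) by blast

lemma one_ideals_set [simp]: "\<one>\<^bsub>ideals_set R\<^esub> = carrier R"
  by (simp add: ideals_set_def)

lemma mult_ideals_set [simp]: "A \<otimes>\<^bsub>ideals_set R\<^esub> B = A \<cdot> B"
  by (simp add: ideals_set_def)

lemma ideal_power_Suc: "ideal_power R J (Suc n) = ideal_power R J n \<cdot> J"
  by (simp add: nat_pow_def ideals_set_def)

lemma ideal_ideal_power:
  assumes "ideal J R" shows "ideal (ideal_power R J n) R"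
  using monoid.nat_pow_closed[OF monoid_ideals, of J n] assms by (simp add: ideals_set_def)

lemma ideal_power_1: assumes "ideal J R" shows "ideal_power R J (Suc 0) = J"
  using assms ideal_prod_commute[OF oneideal, of J] by (simp add: ideal_power_Suc ideal_prod_one)

lemma ideal_power_add:
  assumes "ideal J R"
  shows "ideal_power R J (m + n) = ideal_power R J m \<cdot> ideal_power R J n"
  using monoid.nat_pow_mult[OF monoid_ideals, of J m n] assms
  by (simp add: ideals_set_def)

lemma ideal_power_power:
  assumes "ideal J R"
  shows "ideal_power R (ideal_power R J m) n = ideal_power R J (m * n)"
  using monoid.nat_pow_pow[OF monoid_ideals, of J m n] assms
  by (simp add: ideals_set_def)

lemma ideal_power_mult_mem:
  assumes "ideal J R" "a \<in> ideal_power R J m" "b \<in> ideal_power R J n"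
  shows "a \<otimes> b \<in> ideal_power R J (m + n)"
  using assms by (simp add: ideal_power_add ideal_prod.prod)

lemma ideal_power_antimono:
  assumes "ideal J R" "m \<le> n"
  shows "ideal_power R J n \<subseteq> ideal_power R J m"
proof -
  have "n = m + (n - m)" using assms(2) by simp
  then have "ideal_power R J n = ideal_power R J m \<cdot> ideal_power R J (n - m)"
    using ideal_power_add[OF assms(1)] by metis
  then show ?thesis using ideal_prod_inter ideal_ideal_power[OF assms(1)] by blast
qed

lemma ideal_power_pow_mem:
  assumes "ideal J R" "a \<in> ideal_power R J m"
  shows "a [^] (n::nat) \<in> ideal_power R J (m * n)"
proof (induction n)
  case 0 then show ?case by simp
next
  case (Suc n)
  then show ?case
    using ideal_power_mult_mem[OF assms(1) Suc assms(2)] by (simp add: add.commute)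
qed

lemma ideal_power_pow_mem':
  assumes "ideal J R" "a \<in> J"
  shows "a [^] (n::nat) \<in> ideal_power R J n"
  using ideal_power_pow_mem[OF assms(1), of a "Suc 0" n] assms(2)
  unfolding ideal_power_1[OF assms(1)] by simp

lemma ideal_power_Suc_subset:
  assumes "ideal B R" "\<And>a b. a \<in> ideal_power R J n \<Longrightarrow> b \<in> J \<Longrightarrow> a \<otimes> b \<in> B"
  shows "ideal_power R J (Suc n) \<subseteq> B"
proof
  fix x assume "x \<in> ideal_power R J (Suc n)"
  then have "x \<in> ideal_power R J n \<cdot> J" by (simp add: ideal_power_Suc)
  then show "x \<in> B"
    by (induction rule: ideal_prod.induct) (use assms ideal_add in auto)
qed

lemma ideal_power_mono:
  assumes "ideal A R" "ideal B R" "A \<subseteq> B"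
  shows "ideal_power R A n \<subseteq> ideal_power R B n"
proof (induction n)
  case (Suc n)
  show ?case
    by (rule ideal_power_Suc_subset[OF ideal_ideal_power[OF assms(2)]])
      (use Suc assms(3) in \<open>auto simp: ideal_power_Suc intro: ideal_prod.prod\<close>)
qed simp

lemma ideal_power_principal:
  assumes "f \<in> carrier R"
  shows "ideal_power R (PIdl f) n = PIdl (f [^] n)"
proof (rule antisym)
  show "ideal_power R (PIdl f) n \<subseteq> PIdl (f [^] n)"
  proof (induction n)
    case 0 then show ?case by (auto simp: cgenideal_def) (metis r_one)
  next
    case (Suc n)
    show ?case
    proof (rule ideal_power_Suc_subset)
      show "ideal (PIdl (f [^] Suc n)) R" using assms by (intro cgenideal_ideal nat_pow_closed)
      fix a b assume "a \<in> ideal_power R (PIdl f) n" "b \<in> PIdl f"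
      then obtain x y where "x \<in> carrier R" "a = x \<otimes> f [^] n" "y \<in> carrier R" "b = y \<otimes> f"
        using Suc by (auto simp: cgenideal_def)
      then have "a \<otimes> b = (x \<otimes> y) \<otimes> f [^] Suc n" "x \<otimes> y \<in> carrier R"
        using assms nat_pow_closed[OF assms, of n] by (simp_all add: m_ac)
      then show "a \<otimes> b \<in> PIdl (f [^] Suc n)" by (auto simp: cgenideal_def)
    qed
  qed
  have "f [^] n \<in> ideal_power R (PIdl f) n"
    using assms by (intro ideal_power_pow_mem' cgenideal_ideal cgenideal_self)
  then show "PIdl (f [^] n) \<subseteq> ideal_power R (PIdl f) n"
    using assms by (intro cgenideal_minimal ideal_ideal_power cgenideal_ideal)
qed

lemma prime_ideal_power_subset:
  assumes "primeideal P R" "ideal A R" "ideal_power R A n \<subseteq> P"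
  shows "A \<subseteq> P"
proof
  fix a assume a: "a \<in> A"
  have ac: "a \<in> carrier R" using a assms(2) ideal.Icarr by fast
  have P: "ideal P R" using assms(1) primeideal.axioms(1) by blast
  have an: "a [^] n \<in> P"
    using ideal_power_pow_mem'[OF assms(2) a] assms(3) by blast
  have "\<one> \<notin> P" using ideal.one_imp_carrier[OF P] primeideal.I_notcarr[OF assms(1)] by blast
  with an show "a \<in> P"
  proof (induction n)
    case (Suc n)
    then show ?case using primeideal.I_prime[OF assms(1), of "a [^] n" a] ac by auto
  qed simp
qed

lemma prime_pow_mem:
  assumes "primeideal P R" "a \<in> carrier R" "a [^] (n::nat) \<in> P"
  shows "a \<in> P"
proof -
  have P: "ideal P R" using assms(1) primeideal.axioms(1) by blast
  have "ideal_power R (PIdl a) n \<subseteq> P"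
    using assms P by (simp add: ideal_power_principal cgenideal_minimal)
  then show ?thesis
    using prime_ideal_power_subset[OF assms(1) cgenideal_ideal] assms(2) cgenideal_self by blast
qed

text \<open>The argument of the binomial theorem: the factors of a product of elements of \<open>A + C\<close> are
  distributed one at a time to the power of \<open>A\<close> or to the power of \<open>C\<close>.\<close>

lemma ideal_power_sum_subset:
  assumes A: "ideal A R" and C: "ideal C R" and B: "ideal B R"
    and sub: "\<And>i j a c. i + j = n \<Longrightarrow> a \<in> ideal_power R A i \<Longrightarrow> c \<in> ideal_power R C j \<Longrightarrow> a \<otimes> c \<in> B"
  shows "ideal_power R (A <+>\<^bsub>R\<^esub> C) n \<subseteq> B"
proof -
  have AC: "ideal (A <+>\<^bsub>R\<^esub> C) R" using A C by (rule add_ideals)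
  note carr = ideal.Icarr[OF ideal_ideal_power[OF A]] ideal.Icarr[OF ideal_ideal_power[OF C]]
    ideal.Icarr[OF ideal_ideal_power[OF AC]] ideal.Icarr[OF A] ideal.Icarr[OF C]
  have "\<forall>z\<in>ideal_power R (A <+>\<^bsub>R\<^esub> C) k. (a \<otimes> c) \<otimes> z \<in> B"
    if "i + j + k = n" "a \<in> ideal_power R A i" "c \<in> ideal_power R C j" for i j k a c
    using that
  proof (induction k arbitrary: i j a c)
    case 0
    then show ?case using sub[of i j a c] B by (auto intro: ideal.I_r_closed)
  next
    case (Suc k)
    have ac: "a \<in> carrier R" "c \<in> carrier R" using Suc.prems carr by auto
    have "ideal_power R (A <+>\<^bsub>R\<^esub> C) (Suc k) \<subseteq> ideal_colon R B {a \<otimes> c}"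
    proof (rule ideal_power_Suc_subset)
      show "ideal (ideal_colon R B {a \<otimes> c}) R" using B ac by (intro ideal_colon_elem) auto
      fix z w assume z: "z \<in> ideal_power R (A <+>\<^bsub>R\<^esub> C) k" and "w \<in> A <+>\<^bsub>R\<^esub> C"
      then obtain a' c' where w: "a' \<in> A" "c' \<in> C" "w = a' \<oplus> c'"
        by (auto simp: set_add_def')
      have zc: "z \<in> carrier R" "a' \<in> carrier R" "c' \<in> carrier R" using z w carr by auto
      have "a \<otimes> a' \<in> ideal_power R A (Suc i)"
        using Suc.prems w by (simp add: ideal_power_Suc ideal_prod.prod)
      then have 1: "((a \<otimes> a') \<otimes> c) \<otimes> z \<in> B"
        using Suc.IH[of "Suc i" j "a \<otimes> a'" c] Suc.prems z by auto
      have "c \<otimes> c' \<in> ideal_power R C (Suc j)"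
        using Suc.prems w by (simp add: ideal_power_Suc ideal_prod.prod)
      then have 2: "(a \<otimes> (c \<otimes> c')) \<otimes> z \<in> B"
        using Suc.IH[of i "Suc j" a "c \<otimes> c'"] Suc.prems z by auto
      have "(z \<otimes> w) \<otimes> (a \<otimes> c) = ((a \<otimes> a') \<otimes> c) \<otimes> z \<oplus> (a \<otimes> (c \<otimes> c')) \<otimes> z"
        unfolding w(3) using ac zc by algebra
      then show "z \<otimes> w \<in> ideal_colon R B {a \<otimes> c}"
        using 1 2 B zc w by (simp add: ideal_add)
    qed
    then show ?case using ac carr by (auto simp: m_comm[of "a \<otimes> c"])
  qed
  from this[of 0 0 n \<one> \<one>] show ?thesis using carr by (auto)
qed

lemma zero_Quot: "\<zero>\<^bsub>R Quot J\<^esub> = J"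
  by (simp add: FactRing_def)

lemma carrier_Quot: "carrier (R Quot J) = (\<lambda>z. J +> z) ` carrier R"
  by (auto simp: FactRing_def A_RCOSETS_def')

lemma Quot_mult_eq_zero_iff:
  assumes "ideal J R" "r \<in> carrier R" "z \<in> carrier R"
  shows "(J +> r) \<otimes>\<^bsub>R Quot J\<^esub> (J +> z) = \<zero>\<^bsub>R Quot J\<^esub> \<longleftrightarrow> r \<otimes> z \<in> J"
proof -
  have "(J +> r) \<otimes>\<^bsub>R Quot J\<^esub> (J +> z) = J +> (r \<otimes> z)"
    using assms ideal.rcoset_mult_add by (fastforce simp: FactRing_def)
  then show ?thesis
    using assms ideal.rcos_const_imp_mem a_rcos_zero by (metis zero_Quot m_closed)
qed

lemma Ass_iff:
  assumes "ideal J R"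
  shows "P \<in> Ass R J \<longleftrightarrow> primeideal P R \<and> (\<exists>z\<in>carrier R. P = ideal_colon R J {z})"
  unfolding Ass_def
  using Quot_mult_eq_zero_iff[OF assms] by (auto simp: carrier_Quot ideal_colon_def)

lemma regular_on_quot_iff:
  assumes "ideal J R"
  shows "regular_on_quot R J x \<longleftrightarrow> x \<in> carrier R \<and> (\<forall>z\<in>carrier R. x \<otimes> z \<in> J \<longrightarrow> z \<in> J)"
proof (cases "x \<in> carrier R")
  case True
  have "(J +> z = \<zero>\<^bsub>R Quot J\<^esub>) = (z \<in> J)" if "z \<in> carrier R" for z
    using assms that ideal.rcos_const_imp_mem a_rcos_zero by (metis zero_Quot)
  then show ?thesis
    unfolding regular_on_quot_def
    using Quot_mult_eq_zero_iff[OF assms True] True by (auto simp: carrier_Quot)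
qed (simp add: regular_on_quot_def)

lemma Ass_prime: "P \<in> Ass R J \<Longrightarrow> primeideal P R"
  by (simp add: Ass_def)

lemma Ass_ideal: "P \<in> Ass R J \<Longrightarrow> ideal P R"
  using Ass_prime primeideal.axioms(1) by blast

end

section \<open>Noetherian rings and associated primes\<close>

locale noetherian_cring = noetherian_ring R + cring R for R (structure)
begin

lemma ideal_chain_stabilises:
  fixes C :: "nat \<Rightarrow> 'a set"
  assumes id: "\<And>n. ideal (C n) R" and le: "\<And>n. C n \<subseteq> C (Suc n)"
  shows "\<exists>n0. \<forall>n\<ge>n0. C n = C n0"
proof -
  have mono: "C m \<subseteq> C n" if "m \<le> n" for m n
    using lift_Suc_mono_le[of C, OF le that] .
  have "subset.chain {I. ideal I R} (range C)"
    unfolding subset_chain_def using id mono nat_le_linear by (auto simp del: subset_iff) blast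
  then have "\<Union>(range C) \<in> range C" by (intro ideal_chain_is_trivial) auto
  then obtain n0 where n0: "\<Union>(range C) = C n0" by blast
  then have "C n = C n0" if "n \<ge> n0" for n using mono[OF that] by blast
  then show ?thesis by blast
qed

lemma maximal_ideal_in_family:
  assumes "S \<noteq> {}" "\<And>A. A \<in> S \<Longrightarrow> ideal A R"
  shows "\<exists>M\<in>S. \<forall>A\<in>S. M \<subseteq> A \<longrightarrow> A = M"
proof (rule ccontr)
  assume "\<not> ?thesis"
  then have ex: "\<forall>M\<in>S. \<exists>A\<in>S. M \<subset> A" by blast
  then obtain g where g: "\<And>M. M \<in> S \<Longrightarrow> g M \<in> S \<and> M \<subset> g M" by metis
  obtain A0 where A0: "A0 \<in> S" using assms(1) by blast
  define C where "C n = (g ^^ n) A0" for n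
  have CS: "C n \<in> S" for n by (induction n) (auto simp: C_def A0 g)
  have C1: "C n \<subset> C (Suc n)" for n using g[OF CS[of n]] by (simp add: C_def)
  obtain n0 where n0: "\<forall>n\<ge>n0. C n = C n0"
    using ideal_chain_stabilises[of C] CS C1 assms(2) by blast
  have "C (Suc n0) = C n0" using n0 le_SucI[OF le_refl] by blast
  then show False using C1[of n0] by blast
qed

text \<open>As ideals are finitely generated, a property of ideals that passes to sums has to be checked for
  principal ideals only.\<close>

lemma ideal_sum_induct [consumes 1, case_names principal sum]:
  assumes L: "ideal L R"
    and principal: "\<And>x. x \<in> L \<Longrightarrow> Q (PIdl x)"
    and sum: "\<And>A B. ideal A R \<Longrightarrow> ideal B R \<Longrightarrow> A \<subseteq> L \<Longrightarrow> B \<subseteq> L \<Longrightarrow> Q A \<Longrightarrow> Q B \<Longrightarrow> Q (A <+>\<^bsub>R\<^esub> B)"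
  shows "Q L"
proof -
  obtain F where F: "F \<subseteq> carrier R" "finite F" "L = Idl F" using finetely_gen[OF L] by blast
  have FL: "F \<subseteq> L" using F genideal_self by blast
  have "Q (Idl F)" using F(2) FL
  proof (induction F rule: finite_induct)
    case empty
    have "Idl {} = PIdl \<zero>"
      using genideal_minimal[OF zeroideal, of "{}"] genideal_ideal[of "{}"]
        cgenideal_eq_genideal genideal_zero ideal_zero by fastforce
    then show ?case using principal ideal_zero[OF L] by simp
  next
    case (insert x F)
    have carr: "insert x F \<subseteq> carrier R" using insert ideal_subset[OF L] by blast
    have i: "ideal (Idl F) R" "ideal (PIdl x) R"
      using carr by (auto intro: genideal_ideal cgenideal_ideal)
    have le: "Idl F \<subseteq> L" "PIdl x \<subseteq> L"
      using insert.prems genideal_minimal[OF L] cgenideal_minimal[OF L] by auto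
    have "Idl (insert x F) = PIdl x <+>\<^bsub>R\<^esub> Idl F"
    proof
      have "x \<in> PIdl x" "F \<subseteq> Idl F" using carr cgenideal_self genideal_self by auto
      then have "insert x F \<subseteq> PIdl x \<union> Idl F" by blast
      then show "Idl (insert x F) \<subseteq> PIdl x <+>\<^bsub>R\<^esub> Idl F"
        using union_genideal[OF i(2,1)] subset_Idl_subset[of "PIdl x \<union> Idl F" "insert x F"]
          ideal_subset[OF i(1)] ideal_subset[OF i(2)] by simp
      have "x \<in> Idl (insert x F)" using carr genideal_self by blast
      then have "PIdl x \<union> Idl F \<subseteq> Idl (insert x F)"
        using carr subset_Idl_subset[OF carr, of F] genideal_ideal[OF carr] cgenideal_minimal by blast
      then show "PIdl x <+>\<^bsub>R\<^esub> Idl F \<subseteq> Idl (insert x F)"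
        using union_genideal[OF i(2,1)] genideal_minimal[OF genideal_ideal[OF carr]] by metis
    qed
    then show ?case using sum[OF i(2,1) le(2,1)] insert principal by auto
  qed
  then show ?thesis using F by simp
qed

lemma ideal_power_subset_of_radical:
  assumes L: "ideal L R" and B: "ideal B R"
    and rad: "\<And>l. l \<in> L \<Longrightarrow> \<exists>n. l [^] (n::nat) \<in> B"
  shows "\<exists>n. ideal_power R L n \<subseteq> B"
  using L
proof (induction rule: ideal_sum_induct)
  case (principal x)
  then obtain n where n: "x [^] (n::nat) \<in> B" using rad by blast
  have "ideal_power R (PIdl x) n \<subseteq> B"
    using ideal.Icarr[OF L principal] cgenideal_minimal[OF B n] by (simp add: ideal_power_principal)
  then show ?case by blast
next
  case (sum A C)
  then obtain m n where mn: "ideal_power R A m \<subseteq> B" "ideal_power R C n \<subseteq> B" by blast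
  have "ideal_power R (A <+>\<^bsub>R\<^esub> C) (m + n) \<subseteq> B"
  proof (rule ideal_power_sum_subset[OF sum(1,2) B])
    fix i j a c assume ij: "i + j = m + n" and ac: "a \<in> ideal_power R A i" "c \<in> ideal_power R C j"
    have "a \<in> carrier R" "c \<in> carrier R"
      using ac sum ideal_ideal_power ideal.Icarr by metis+
    moreover have "a \<in> B \<or> c \<in> B"
      using ij ac mn ideal_power_antimono[OF sum(1), of m i] ideal_power_antimono[OF sum(2), of n j]
      by (cases "m \<le> i") auto
    ultimately show "a \<otimes> c \<in> B" using B by (auto intro: ideal.I_l_closed ideal.I_r_closed)
  qed
  then show ?case by blast
qed

text \<open>Among the ideals \<open>(B : y)\<close> that contain \<open>(B : z)\<close> and miss \<open>T\<close> there is a maximal one, and it is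
  prime. Indeed, let \<open>a b\<close> be in it. Passing from \<open>y\<close> to \<open>a y\<close> gives a larger ideal, which
  either is the same one, so that \<open>b\<close> is in it, or meets \<open>T\<close> in some \<open>s\<close>; in the latter case \<open>a\<close>
  lies in \<open>(B : s y)\<close>, which still misses \<open>T\<close> and hence is the same ideal again. The lemma is
  used with \<open>T\<close> consisting of \<open>1\<close>, of the powers of an element, and of the complement of a
  prime.\<close>

lemma associated_prime_avoiding:
  assumes B: "ideal B R" and z: "z \<in> carrier R" and T: "T \<subseteq> carrier R" "\<one> \<in> T"
    "\<And>s t. s \<in> T \<Longrightarrow> t \<in> T \<Longrightarrow> s \<otimes> t \<in> T"
    and disj: "\<And>t. t \<in> T \<Longrightarrow> t \<otimes> z \<notin> B"
  shows "\<exists>Q\<in>Ass R B. ideal_colon R B {z} \<subseteq> Q \<and> Q \<inter> T = {}"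
proof -
  define S where "S = {ideal_colon R B {y} | y. y \<in> carrier R \<and>
    ideal_colon R B {z} \<subseteq> ideal_colon R B {y} \<and> ideal_colon R B {y} \<inter> T = {}}"
  have "ideal_colon R B {z} \<in> S" unfolding S_def using z disj by auto
  then have "S \<noteq> {}" by blast
  moreover have "ideal A R" if "A \<in> S" for A
    using that ideal_colon_elem[OF B] unfolding S_def by blast
  ultimately have "\<exists>M\<in>S. \<forall>A\<in>S. M \<subseteq> A \<longrightarrow> A = M"
    by (rule maximal_ideal_in_family)
  then obtain M where M: "M \<in> S" and maxM: "\<forall>A\<in>S. M \<subseteq> A \<longrightarrow> A = M" by blast
  from M obtain y where yM: "M = ideal_colon R B {y}" and y: "y \<in> carrier R"
    "ideal_colon R B {z} \<subseteq> ideal_colon R B {y}" "ideal_colon R B {y} \<inter> T = {}"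
    unfolding S_def mem_Collect_eq by metis
  have max: "A = ideal_colon R B {y}" if "A \<in> S" "ideal_colon R B {y} \<subseteq> A" for A
    using maxM that yM by simp
  have step: "ideal_colon R B {y} \<subseteq> ideal_colon R B {a \<otimes> y}" if "a \<in> carrier R" for a
  proof
    fix r assume r: "r \<in> ideal_colon R B {y}"
    then have "a \<otimes> (r \<otimes> y) \<in> B" using B that by (simp add: ideal.I_l_closed)
    moreover have "a \<otimes> (r \<otimes> y) = r \<otimes> (a \<otimes> y)" using r that y(1) m_lcomm by simp
    ultimately show "r \<in> ideal_colon R B {a \<otimes> y}" using r by simp
  qed
  have "primeideal (ideal_colon R B {y}) R"
  proof (rule primeidealI[OF ideal_colon_elem[OF B y(1)] is_cring])
    show "carrier R \<noteq> ideal_colon R B {y}" using y(3) T(2) one_closed by blast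
    fix a b assume a: "a \<in> carrier R" and b: "b \<in> carrier R" and ab: "a \<otimes> b \<in> ideal_colon R B {y}"
    have b_mem: "b \<in> ideal_colon R B {a \<otimes> y}"
      using a b ab y(1) by (simp add: m_ac)
    show "a \<in> ideal_colon R B {y} \<or> b \<in> ideal_colon R B {y}"
    proof (cases "ideal_colon R B {a \<otimes> y} \<inter> T = {}")
      case True
      then have "ideal_colon R B {a \<otimes> y} \<in> S"
        unfolding S_def using step[OF a] y a by blast
      then show ?thesis using max step[OF a] b_mem by blast
    next
      case False
      then obtain s where s: "s \<in> T" "s \<in> carrier R" "s \<otimes> (a \<otimes> y) \<in> B" by auto
      have "ideal_colon R B {s \<otimes> y} \<inter> T = {}"
      proof -
        have "t \<notin> ideal_colon R B {s \<otimes> y}" if "t \<in> T" for t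
        proof
          assume "t \<in> ideal_colon R B {s \<otimes> y}"
          then have "t \<otimes> s \<in> ideal_colon R B {y}" using s y(1) by (simp add: m_assoc)
          then show False using y(3) T(3)[OF that s(1)] by blast
        qed
        then show ?thesis by blast
      qed
      then have "ideal_colon R B {s \<otimes> y} \<in> S"
        unfolding S_def using step[OF s(2)] y s(2) by blast
      then have "ideal_colon R B {s \<otimes> y} = ideal_colon R B {y}" using max step[OF s(2)] by blast
      moreover have "a \<in> ideal_colon R B {s \<otimes> y}" using s a y(1) by (simp add: m_lcomm)
      ultimately show ?thesis by blast
    qed
  qed
  then show ?thesis using y Ass_iff[OF B] by blast
qed

end

section \<open>Chains of graded families of ideals\<close>

context cring
begin

text \<open>With \<open>V k = I^k\<close> and \<open>A\<close> a set of generators of \<open>I\<close> these are the graded ideals of the Rees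
  algebra \<open>\<Oplus>k. I^k\<close>. In the induction on the number of generators, \<open>V\<close> is a family that
  contains the powers of the ideal generated so far.\<close>

definition graded_subfamily :: "'a set \<Rightarrow> (nat \<Rightarrow> 'a set) \<Rightarrow> (nat \<Rightarrow> 'a set) \<Rightarrow> bool"
  where "graded_subfamily A V M \<longleftrightarrow>
    (\<forall>k. ideal (M k) R \<and> M k \<subseteq> V k) \<and> (\<forall>k. \<forall>a\<in>A. \<forall>x\<in>M k. a \<otimes> x \<in> M (Suc k))"

definition graded_acc :: "'a set \<Rightarrow> (nat \<Rightarrow> 'a set) \<Rightarrow> bool"
  where "graded_acc A V \<longleftrightarrow>
    (\<forall>C :: nat \<Rightarrow> nat \<Rightarrow> 'a set. (\<forall>n. graded_subfamily A V (C n)) \<longrightarrow>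
       (\<forall>n k. C n k \<subseteq> C (Suc n) k) \<longrightarrow> (\<exists>n0. \<forall>n\<ge>n0. \<forall>k. C n k = C n0 k))"

text \<open>The elements of degree \<open>k\<close> that are polynomials in \<open>b\<close> of degree less than \<open>D\<close>, the coefficient
  of \<open>b^j\<close> being in \<open>V (k - j)\<close>.\<close>

primrec poly_family :: "'a \<Rightarrow> (nat \<Rightarrow> 'a set) \<Rightarrow> nat \<Rightarrow> nat \<Rightarrow> 'a set"
  where "poly_family b V 0 k = {\<zero>}"
  | "poly_family b V (Suc D) k =
      (if D \<le> k then poly_family b V D k <+>\<^bsub>R\<^esub> (\<lambda>s. b [^] D \<otimes> s) ` V (k - D)
       else poly_family b V D k)"

lemma mult_image_ideal:
  assumes c: "c \<in> carrier R" and B: "ideal B R"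
  shows "ideal ((\<lambda>s. c \<otimes> s) ` B) R"
proof (rule idealI_elem)
  note Bc = ideal.Icarr[OF B]
  show "(\<otimes>) c ` B \<subseteq> carrier R" using c Bc by auto
  show "\<zero> \<in> (\<otimes>) c ` B" using c ideal_zero[OF B] by (auto intro!: image_eqI[of _ _ \<zero>])
  fix a assume "a \<in> (\<otimes>) c ` B"
  then obtain s where s: "s \<in> B" "a = c \<otimes> s" by blast
  { fix b assume "b \<in> (\<otimes>) c ` B"
    then obtain t where t: "t \<in> B" "b = c \<otimes> t" by blast
    have "a \<oplus> b = c \<otimes> (s \<oplus> t)" using s t c Bc by (simp add: r_distr)
    then show "a \<oplus> b \<in> (\<otimes>) c ` B" using ideal_add[OF B s(1) t(1)] by blast }
  fix x assume x: "x \<in> carrier R"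
  have "x \<otimes> a = c \<otimes> (x \<otimes> s)" using s x c Bc m_lcomm by simp
  then show "x \<otimes> a \<in> (\<otimes>) c ` B" using ideal.I_l_closed[OF B s(1) x] by blast
qed

context
  fixes b and V :: "nat \<Rightarrow> 'a set"
  assumes b: "b \<in> carrier R" and V: "\<And>k. ideal (V k) R"
begin

lemma ideal_poly_family: "ideal (poly_family b V D k) R"
proof (induction D)
  case 0 then show ?case by (simp add: zeroideal)
next
  case (Suc D)
  then show ?case using b V by (simp add: add_ideals mult_image_ideal)
qed

lemma poly_family_SucI:
  assumes "D \<le> k" "w \<in> poly_family b V D k" "s \<in> V (k - D)"
  shows "w \<oplus> b [^] D \<otimes> s \<in> poly_family b V (Suc D) k"
  using assms by (auto simp: set_add_def')

lemma poly_family_SucE: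
  assumes "D \<le> k" "z \<in> poly_family b V (Suc D) k"
  obtains w s where "w \<in> poly_family b V D k" "s \<in> V (k - D)" "z = w \<oplus> b [^] D \<otimes> s"
  using assms by (auto simp: set_add_def')

lemma poly_family_Suc_mono: "poly_family b V D k \<subseteq> poly_family b V (Suc D) k"
proof (cases "D \<le> k")
  case True
  show ?thesis
  proof
    fix z assume z: "z \<in> poly_family b V D k"
    have zc: "z \<in> carrier R" using ideal.Icarr[OF ideal_poly_family z] .
    from poly_family_SucI[OF True z ideal_zero[OF V]] show "z \<in> poly_family b V (Suc D) k"
      using b zc by simp
  qed
qed simp

lemma poly_family_mono: "D \<le> E \<Longrightarrow> poly_family b V D k \<subseteq> poly_family b V E k"
  by (rule lift_Suc_mono_le[of "\<lambda>D. poly_family b V D k"]) (use poly_family_Suc_mono in auto)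

lemma poly_family_mult_var:
  "z \<in> poly_family b V D k \<Longrightarrow> b \<otimes> z \<in> poly_family b V (Suc D) (Suc k)"
proof (induction D arbitrary: z)
  case 0
  then show ?case using b ideal_zero[OF ideal_poly_family] by (simp del: poly_family.simps(2))
next
  case (Suc D)
  show ?case
  proof (cases "D \<le> k")
    case True
    obtain w s where ws: "w \<in> poly_family b V D k" "s \<in> V (k - D)"
      "z = w \<oplus> b [^] D \<otimes> s" using poly_family_SucE[OF True Suc.prems] by blast
    have c: "w \<in> carrier R" "s \<in> carrier R"
      using ws ideal.Icarr[OF ideal_poly_family] ideal.Icarr[OF V] by auto
    have "b \<otimes> w \<oplus> b [^] Suc D \<otimes> s \<in> poly_family b V (Suc (Suc D)) (Suc k)"
      using True ws(2) Suc.IH[OF ws(1)] by (intro poly_family_SucI) auto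
    moreover have "b \<otimes> z = b \<otimes> w \<oplus> b [^] Suc D \<otimes> s"
    proof -
      have "b [^] D \<in> carrier R" using b by simp
      then show ?thesis unfolding ws(3) nat_pow_Suc using b c by algebra
    qed
    ultimately show ?thesis by simp
  next
    case False
    then have "z \<in> poly_family b V D k" using Suc.prems by simp
    then show ?thesis using Suc.IH poly_family_Suc_mono by blast
  qed
qed

lemma poly_family_mult_coeff:
  assumes a: "a \<in> carrier R" and aV: "\<And>k x. x \<in> V k \<Longrightarrow> a \<otimes> x \<in> V (Suc k)"
  shows "z \<in> poly_family b V D k \<Longrightarrow> a \<otimes> z \<in> poly_family b V D (Suc k)"
proof (induction D arbitrary: z)
  case 0
  then show ?case using a by simp
next
  case (Suc D)
  show ?case
  proof (cases "D \<le> k")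
    case True
    obtain w s where ws: "w \<in> poly_family b V D k" "s \<in> V (k - D)"
      "z = w \<oplus> b [^] D \<otimes> s" using poly_family_SucE[OF True Suc.prems] by blast
    have c: "w \<in> carrier R" "s \<in> carrier R" "b [^] D \<in> carrier R"
      using ws b ideal.Icarr[OF ideal_poly_family] ideal.Icarr[OF V] by auto
    have "a \<otimes> s \<in> V (Suc k - D)" using aV[OF ws(2)] True by (simp add: Suc_diff_le)
    then have "a \<otimes> w \<oplus> b [^] D \<otimes> (a \<otimes> s) \<in> poly_family b V (Suc D) (Suc k)"
      using True Suc.IH[OF ws(1)] by (intro poly_family_SucI) auto
    moreover have "a \<otimes> z = a \<otimes> w \<oplus> b [^] D \<otimes> (a \<otimes> s)"
      unfolding ws(3) using a c by algebra
    ultimately show ?thesis by simp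
  next
    case False
    then have "z \<in> poly_family b V D k" using Suc.prems by simp
    then show ?thesis using Suc.IH poly_family_Suc_mono by blast
  qed
qed

text \<open>The possible coefficients of \<open>b^D\<close>, of degree \<open>e\<close>, in elements of \<open>M\<close> that are polynomials in
  \<open>b\<close> of degree at most \<open>D\<close>.\<close>

definition lead_coeffs :: "(nat \<Rightarrow> 'a set) \<Rightarrow> nat \<Rightarrow> nat \<Rightarrow> 'a set"
  where "lead_coeffs M D e =
    {s \<in> V e. \<exists>w\<in>poly_family b V D (D + e). w \<oplus> b [^] D \<otimes> s \<in> M (D + e)}"

text \<open>Multiplying a polynomial by \<open>a \<in> A\<close> multiplies its leading coefficient by \<open>a\<close>; multiplying
  it by \<open>b\<close> leaves the coefficient unchanged and raises the degree in \<open>b\<close>.\<close>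

lemma graded_subfamily_lead_coeffs:
  assumes M: "graded_subfamily (insert b A) (\<lambda>k. poly_family b V (Suc k) k) M"
    and A: "A \<subseteq> carrier R" and AV: "\<And>a k x. a \<in> A \<Longrightarrow> x \<in> V k \<Longrightarrow> a \<otimes> x \<in> V (Suc k)"
  shows "graded_subfamily A V (lead_coeffs M D)"
    and "lead_coeffs M D e \<subseteq> lead_coeffs M (Suc D) e"
proof -
  have Mid: "ideal (M k) R" for k using M by (simp add: graded_subfamily_def)
  have Mst: "a \<otimes> x \<in> M (Suc k)" if "a \<in> insert b A" "x \<in> M k" for a x k
    using M that by (auto simp: graded_subfamily_def)
  note Fid = ideal_poly_family[of D]
  have bD: "b [^] D \<in> carrier R" using b by simp
  have carr: "s \<in> carrier R" if "s \<in> V e" for s e using that ideal.Icarr[OF V] by blast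
  have carrF: "w \<in> carrier R" if "w \<in> poly_family b V D k" for w k
    using that ideal.Icarr[OF Fid] by blast
  have "ideal (lead_coeffs M D e) R" for e
  proof (rule idealI_elem)
    show "lead_coeffs M D e \<subseteq> carrier R" using carr by (auto simp: lead_coeffs_def)
    show "\<zero> \<in> lead_coeffs M D e"
      using ideal_zero[OF V] ideal_zero[OF Fid] ideal_zero[OF Mid] bD
      by (auto simp: lead_coeffs_def intro!: bexI[of _ \<zero>])
    fix s assume "s \<in> lead_coeffs M D e"
    then obtain w where s: "s \<in> V e" and w: "w \<in> poly_family b V D (D + e)"
      "w \<oplus> b [^] D \<otimes> s \<in> M (D + e)" by (auto simp: lead_coeffs_def)
    { fix t assume "t \<in> lead_coeffs M D e"
      then obtain v where t: "t \<in> V e" and v: "v \<in> poly_family b V D (D + e)"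
        "v \<oplus> b [^] D \<otimes> t \<in> M (D + e)" by (auto simp: lead_coeffs_def)
      have "(w \<oplus> v) \<oplus> b [^] D \<otimes> (s \<oplus> t) = (w \<oplus> b [^] D \<otimes> s) \<oplus> (v \<oplus> b [^] D \<otimes> t)"
        using bD carr[OF s] carr[OF t] carrF[OF w(1)] carrF[OF v(1)] by algebra
      then have "(w \<oplus> v) \<oplus> b [^] D \<otimes> (s \<oplus> t) \<in> M (D + e)"
        using ideal_add[OF Mid w(2) v(2)] by simp
      then show "s \<oplus> t \<in> lead_coeffs M D e"
        using ideal_add[OF V s t] ideal_add[OF Fid w(1) v(1)] by (auto simp: lead_coeffs_def) }
    fix x assume x: "x \<in> carrier R"
    have "(x \<otimes> w) \<oplus> b [^] D \<otimes> (x \<otimes> s) = x \<otimes> (w \<oplus> b [^] D \<otimes> s)"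
      using bD carr[OF s] carrF[OF w(1)] x by algebra
    then have "(x \<otimes> w) \<oplus> b [^] D \<otimes> (x \<otimes> s) \<in> M (D + e)"
      using ideal.I_l_closed[OF Mid w(2) x] by simp
    then show "x \<otimes> s \<in> lead_coeffs M D e"
      using ideal.I_l_closed[OF V s x] ideal.I_l_closed[OF Fid w(1) x] by (auto simp: lead_coeffs_def)
  qed
  moreover have "a \<otimes> s \<in> lead_coeffs M D (Suc e)" if a: "a \<in> A" and "s \<in> lead_coeffs M D e" for a s e
  proof -
    from that obtain w where s: "s \<in> V e" and w: "w \<in> poly_family b V D (D + e)"
      "w \<oplus> b [^] D \<otimes> s \<in> M (D + e)" by (auto simp: lead_coeffs_def)
    have ac: "a \<in> carrier R" using a A by blast
    have "(a \<otimes> w) \<oplus> b [^] D \<otimes> (a \<otimes> s) = a \<otimes> (w \<oplus> b [^] D \<otimes> s)"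
      using bD carr[OF s] carrF[OF w(1)] ac by algebra
    then have "(a \<otimes> w) \<oplus> b [^] D \<otimes> (a \<otimes> s) \<in> M (D + Suc e)"
      using Mst[OF _ w(2)] a by simp
    moreover have "a \<otimes> w \<in> poly_family b V D (D + Suc e)"
      using poly_family_mult_coeff[OF ac AV[OF a] w(1)] by simp
    ultimately show ?thesis using AV[OF a s] by (auto simp: lead_coeffs_def)
  qed
  ultimately show "graded_subfamily A V (lead_coeffs M D)"
    by (auto simp: graded_subfamily_def) (auto simp: lead_coeffs_def)
  show "lead_coeffs M D e \<subseteq> lead_coeffs M (Suc D) e"
  proof
    fix s assume "s \<in> lead_coeffs M D e"
    then obtain w where s: "s \<in> V e" and w: "w \<in> poly_family b V D (D + e)"
      "w \<oplus> b [^] D \<otimes> s \<in> M (D + e)" by (auto simp: lead_coeffs_def)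
    have "(b \<otimes> w) \<oplus> b [^] Suc D \<otimes> s = b \<otimes> (w \<oplus> b [^] D \<otimes> s)"
      unfolding nat_pow_Suc using bD carr[OF s] carrF[OF w(1)] b by algebra
    then have "(b \<otimes> w) \<oplus> b [^] Suc D \<otimes> s \<in> M (Suc D + e)"
      using Mst[OF _ w(2)] by simp
    moreover have "b \<otimes> w \<in> poly_family b V (Suc D) (Suc D + e)"
      using poly_family_mult_var[OF w(1)] by simp
    ultimately show "s \<in> lead_coeffs M (Suc D) e"
      using s unfolding lead_coeffs_def by blast
  qed
qed

text \<open>If \<open>N\<close> contains \<open>M\<close> but has no further leading coefficients, the leading term of an element of
  \<open>N\<close> can be removed by subtracting an element of \<open>M\<close>; the result follows by induction on the
  degree in \<open>b\<close>.\<close>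

lemma subfamily_determined_by_lead_coeffs:
  assumes M: "\<And>k. ideal (M k) R" and N: "\<And>k. ideal (N k) R"
    and le: "\<And>k. M k \<subseteq> N k" and eq: "\<And>D e. lead_coeffs N D e \<subseteq> lead_coeffs M D e"
  shows "N k \<inter> poly_family b V D k \<subseteq> M k"
proof (induction D)
  case 0
  then show ?case using ideal_zero[OF M] by auto
next
  case (Suc D)
  show ?case
  proof (cases "D \<le> k")
    case True
    show ?thesis
    proof
      fix z assume z: "z \<in> N k \<inter> poly_family b V (Suc D) k"
      then have "z \<in> poly_family b V (Suc D) k" by blast
      with True obtain w s where ws: "w \<in> poly_family b V D k" "s \<in> V (k - D)"
        "z = w \<oplus> b [^] D \<otimes> s" by (rule poly_family_SucE)
      then have "s \<in> lead_coeffs N D (k - D)" using z True by (auto simp: lead_coeffs_def)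
      then obtain w' where w': "w' \<in> poly_family b V D k" "w' \<oplus> b [^] D \<otimes> s \<in> M k"
        using eq True by (fastforce simp: lead_coeffs_def)
      have c: "w \<in> carrier R" "w' \<in> carrier R" "s \<in> carrier R" "b [^] D \<in> carrier R"
        using ws w' b ideal.Icarr[OF ideal_poly_family] ideal.Icarr[OF V] by auto
      have diff: "w \<oplus> \<ominus> w' \<in> poly_family b V D k"
        using ws w' ideal_add[OF ideal_poly_family] ideal_neg[OF ideal_poly_family] by blast
      have "z \<oplus> \<ominus> (w' \<oplus> b [^] D \<otimes> s) \<in> N k"
        using z w'(2) le ideal_add[OF N] ideal_neg[OF N] by blast
      moreover have "z \<oplus> \<ominus> (w' \<oplus> b [^] D \<otimes> s) = w \<oplus> \<ominus> w'"
        unfolding ws(3) using c by algebra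
      ultimately have "w \<oplus> \<ominus> w' \<in> M k" using diff Suc by auto
      then have "(w \<oplus> \<ominus> w') \<oplus> (w' \<oplus> b [^] D \<otimes> s) \<in> M k" using w' ideal_add[OF M] by blast
      moreover have "(w \<oplus> \<ominus> w') \<oplus> (w' \<oplus> b [^] D \<otimes> s) = z" unfolding ws(3) using c by algebra
      ultimately show "z \<in> M k" by simp
    qed
  qed (use Suc in simp)
qed

text \<open>This is the inductive step of Hilbert's basis theorem for chains. The leading coefficients form
  a doubly indexed family, increasing in the position in the chain and in the degree, and the
  chain condition for \<open>V\<close> makes it stabilise uniformly.\<close>

lemma graded_acc_adjoin:
  assumes acc: "graded_acc A V"
    and A: "A \<subseteq> carrier R" and AV: "\<And>a k x. a \<in> A \<Longrightarrow> x \<in> V k \<Longrightarrow> a \<otimes> x \<in> V (Suc k)"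
  shows "graded_acc (insert b A) (\<lambda>k. poly_family b V (Suc k) k)"
  unfolding graded_acc_def
proof (intro allI impI)
  fix C :: "nat \<Rightarrow> nat \<Rightarrow> 'a set"
  assume "\<forall>n. graded_subfamily (insert b A) (\<lambda>k. poly_family b V (Suc k) k) (C n)"
    and "\<forall>n k. C n k \<subseteq> C (Suc n) k"
  then have C: "graded_subfamily (insert b A) (\<lambda>k. poly_family b V (Suc k) k) (C n)"
    and C_Suc: "C n k \<subseteq> C (Suc n) k" for n k by blast+
  have C_mono: "C m k \<subseteq> C n k" if "m \<le> n" for m n k
    using lift_Suc_mono_le[of "\<lambda>n. C n k", OF C_Suc that] .
  define L where "L n D = lead_coeffs (C n) D" for n D
  have L_sub: "graded_subfamily A V (L n D)" for n D
    unfolding L_def by (rule graded_subfamily_lead_coeffs(1)[OF C A AV])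
  have L_D: "L n D e \<subseteq> L n E e" if "D \<le> E" for n D E e
    using lift_Suc_mono_le[of "\<lambda>D. L n D e", OF _ that]
      graded_subfamily_lead_coeffs(2)[OF C A AV] by (simp add: L_def)
  have L_n: "L m D e \<subseteq> L n D e" if "m \<le> n" for m n D e
    using C_mono[OF that] unfolding L_def lead_coeffs_def by blast
  have "\<exists>n0. \<forall>n\<ge>n0. \<forall>e. L n D e = L n0 D e" for D
    using acc[unfolded graded_acc_def, rule_format, of "\<lambda>n. L n D"] L_sub L_n[OF le_SucI[OF le_refl]]
    by blast
  then obtain g where g: "\<And>D n e. n \<ge> g D \<Longrightarrow> L n D e = L (g D) D e" by metis
  have "L n n e \<subseteq> L (Suc n) (Suc n) e" for n e
    using L_n[of n "Suc n" n e] L_D[of n "Suc n" "Suc n" e] by auto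
  then obtain d where d: "\<And>n e. n \<ge> d \<Longrightarrow> L n n e = L d d e"
    using acc[unfolded graded_acc_def, rule_format, of "\<lambda>n. L n n"] L_sub by blast
  \<comment> \<open>From index \<open>N\<close> on, all leading coefficients are stable: those of degree below \<open>d\<close> by the
    choice of \<open>g\<close>, the others because they are caught by the diagonal chain.\<close>
  define N where "N = Max (insert d (g ` {..<d}))"
  have N_d: "d \<le> N" and N_g: "\<And>D. D < d \<Longrightarrow> g D \<le> N" unfolding N_def by auto
  have L_N: "L n D e \<subseteq> L N D e" if "n \<ge> N" for n D e
  proof (cases "D < d")
    case True
    then have "g D \<le> N" by (rule N_g)
    then show ?thesis using g[of D n e] g[of D N e] that by simp
  next
    case False
    have "L n D e \<subseteq> L (max n D) (max n D) e"
      using L_n[of n "max n D" D e] L_D[of D "max n D" "max n D" e] by auto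
    also have "\<dots> = L d d e" by (rule d) (use False in simp)
    also have "\<dots> \<subseteq> L N D e" using L_n[OF N_d, of d e] L_D[of d D N e] False by auto
    finally show ?thesis .
  qed
  have "C n k \<subseteq> C N k" if "n \<ge> N" for n k
  proof -
    have id: "ideal (C m k) R" for m k using C by (simp add: graded_subfamily_def)
    have "C n k \<inter> poly_family b V (Suc k) k \<subseteq> C N k"
      using subfamily_determined_by_lead_coeffs[of "C N" "C n", OF id id C_mono[OF that]]
        L_N[OF that] unfolding L_def by blast
    then show ?thesis using C[of n] by (auto simp: graded_subfamily_def simp del: poly_family.simps)
  qed
  then show "\<exists>n0. \<forall>n\<ge>n0. \<forall>k. C n k = C n0 k" using C_mono by blast
qed

end

end

context noetherian_cring
begin

lemma graded_acc_exists:
  assumes "finite A" "A \<subseteq> carrier R"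
  shows "\<exists>V. (\<forall>k. ideal (V k) R) \<and> V 0 = carrier R \<and>
    (\<forall>a\<in>A. \<forall>k. \<forall>x\<in>V k. a \<otimes> x \<in> V (Suc k)) \<and> graded_acc A V"
  using assms
proof (induction A rule: finite_induct)
  case empty
  define V where "V k = (if k = 0 then carrier R else {\<zero>})" for k :: nat
  have "graded_acc {} V"
    unfolding graded_acc_def
  proof (intro allI impI)
    fix C :: "nat \<Rightarrow> nat \<Rightarrow> 'a set"
    assume C: "\<forall>n. graded_subfamily {} V (C n)" and C_Suc: "\<forall>n k. C n k \<subseteq> C (Suc n) k"
    have id: "ideal (C n k) R" and sub: "C n k \<subseteq> V k" for n k
      using C by (auto simp: graded_subfamily_def)
    obtain n0 where n0: "\<forall>n\<ge>n0. C n 0 = C n0 0"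
      using ideal_chain_stabilises[of "\<lambda>n. C n 0"] id C_Suc by blast
    have "C n (Suc k) = {\<zero>}" for n k
      using sub[of n "Suc k"] ideal_zero[OF id, of n "Suc k"] by (auto simp: V_def)
    then have "C n (Suc k) = C n0 (Suc k)" for n k by simp
    moreover have "C n 0 = C n0 0" if "n \<ge> n0" for n using n0 that by blast
    ultimately have "C n k = C n0 k" if "n \<ge> n0" for n k using that not0_implies_Suc by metis
    then show "\<exists>n0. \<forall>n\<ge>n0. \<forall>k. C n k = C n0 k" by blast
  qed
  moreover have "ideal (V k) R" for k by (simp add: V_def zeroideal oneideal)
  moreover have "V 0 = carrier R" by (simp add: V_def)
  ultimately show ?case by blast
next
  case (insert b A)
  then obtain V where V: "\<And>k. ideal (V k) R" "V 0 = carrier R"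
    "\<And>a k x. a \<in> A \<Longrightarrow> x \<in> V k \<Longrightarrow> a \<otimes> x \<in> V (Suc k)" "graded_acc A V"
    using insert.IH insert.prems by (metis insert_subset)
  have b: "b \<in> carrier R" and A: "A \<subseteq> carrier R" using insert by auto
  define Y where "Y k = poly_family b V (Suc k) k" for k
  have "\<forall>k. ideal (Y k) R" unfolding Y_def using ideal_poly_family[of b V, OF b V(1)] by blast
  moreover have "Y 0 = carrier R" by (auto simp: Y_def V(2) set_add_def') 
  moreover have "a \<otimes> x \<in> Y (Suc k)" if "a \<in> insert b A" "x \<in> Y k" for a k x
  proof (cases "a = b")
    case True
    then show ?thesis using that poly_family_mult_var[of b V, OF b V(1)] unfolding Y_def by blast
  next
    case False
    then have a: "a \<in> A" "a \<in> carrier R" using that A by auto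
    then show ?thesis
      using that poly_family_mult_coeff[of b V, OF b V(1) a(2) V(3)[OF a(1)]]
        poly_family_Suc_mono[of b V, OF b V(1)] unfolding Y_def by blast
  qed
  moreover have "graded_acc (insert b A) Y"
    unfolding Y_def using graded_acc_adjoin[of b V A, OF b V(1) V(4) A V(3)] by blast
  ultimately show ?case by blast
qed

text \<open>The Rees algebra of \<open>I\<close> is Noetherian, in terms of its graded ideals.\<close>

theorem graded_chain_stabilises:
  fixes C :: "nat \<Rightarrow> nat \<Rightarrow> 'a set"
  assumes I: "ideal I R" and C: "\<And>n k. ideal (C n k) R" "\<And>n k. C n k \<subseteq> ideal_power R I k"
    and stable: "\<And>n k a x. a \<in> I \<Longrightarrow> x \<in> C n k \<Longrightarrow> a \<otimes> x \<in> C n (Suc k)"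
    and le: "\<And>n k. C n k \<subseteq> C (Suc n) k"
  shows "\<exists>n0. \<forall>n\<ge>n0. \<forall>k. C n k = C n0 k"
proof -
  obtain A where A: "A \<subseteq> carrier R" "finite A" "I = Idl A" using finetely_gen[OF I] by blast
  obtain V where V: "\<And>k. ideal (V k) R" "V 0 = carrier R"
    "\<And>a k x. a \<in> A \<Longrightarrow> x \<in> V k \<Longrightarrow> a \<otimes> x \<in> V (Suc k)" "graded_acc A V"
    using graded_acc_exists[OF A(2,1)] by metis
  have AI: "A \<subseteq> I" using A genideal_self by blast
  have power: "ideal_power R I k \<subseteq> V k" for k
  proof (induction k)
    case 0
    then show ?case using V(2) by simp
  next
    case (Suc k)
    show ?case
    proof (rule ideal_power_Suc_subset[OF V(1)])
      fix z w assume z: "z \<in> ideal_power R I k" and w: "w \<in> I"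
      have zc: "z \<in> carrier R" using z ideal.Icarr[OF ideal_ideal_power[OF I]] by blast
      have "A \<subseteq> ideal_colon R (V (Suc k)) {z}" 
      proof
        fix a assume a: "a \<in> A"
        then have "a \<otimes> z \<in> V (Suc k)" using z Suc V(3) by blast
        then show "a \<in> ideal_colon R (V (Suc k)) {z}" using a A(1) by auto
      qed
      then have "I \<subseteq> ideal_colon R (V (Suc k)) {z}"
        unfolding A(3) using V(1) zc by (intro genideal_minimal ideal_colon_elem)
      then have "w \<otimes> z \<in> V (Suc k)" using w by auto
      then show "z \<otimes> w \<in> V (Suc k)" using zc ideal.Icarr[OF I w] by (simp add: m_comm)
    qed
  qed
  have "graded_subfamily A V (C n)" for n
    unfolding graded_subfamily_def using C power stable AI by blast
  then show ?thesis using V(4) le unfolding graded_acc_def by blast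
qed

end

section \<open>Finiteness of the associated primes of all powers\<close>

context cring
begin

lemma ideal_colon_mult_prime:
  assumes B: "ideal B R" and x: "x \<in> carrier R" and P: "primeideal P R" "P = ideal_colon R B {x}"
    and r: "r \<in> carrier R" "r \<notin> P"
  shows "ideal_colon R B {r \<otimes> x} = P"
proof (rule Set.set_eqI)
  fix t
  have "t \<otimes> r \<in> P \<longleftrightarrow> t \<in> P" if "t \<in> carrier R"
    using primeideal.I_prime[OF P(1) that r(1)] r that
      ideal.I_r_closed[OF primeideal.axioms(1)[OF P(1)]] by blast
  then show "t \<in> ideal_colon R B {r \<otimes> x} \<longleftrightarrow> t \<in> P"
    using P(2) x r(1) by (auto simp: m_assoc[symmetric])
qed

text \<open>The primes of \<open>R\<close> that are annihilators of homogeneous elements of \<open>\<Oplus>m. I^m / M m\<close>.\<close>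

definition graded_Ass :: "'a set \<Rightarrow> (nat \<Rightarrow> 'a set) \<Rightarrow> 'a set set"
  where "graded_Ass I M =
    {P. primeideal P R \<and> (\<exists>m. \<exists>x\<in>ideal_power R I m. P = ideal_colon R (M m) {x})}"

definition graded_submodule :: "'a set \<Rightarrow> (nat \<Rightarrow> 'a set) \<Rightarrow> bool"
  where "graded_submodule I M \<longleftrightarrow> graded_subfamily I (ideal_power R I) M"

lemma graded_submodule_iff:
  "graded_submodule I M \<longleftrightarrow> (\<forall>k. ideal (M k) R) \<and> (\<forall>k. M k \<subseteq> ideal_power R I k) \<and>
     (\<forall>k. \<forall>a\<in>I. \<forall>x\<in>M k. a \<otimes> x \<in> M (Suc k))"
  by (auto simp: graded_submodule_def graded_subfamily_def)

lemma graded_submodule_power: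
  assumes I: "ideal I R" and M: "graded_submodule I M"
    and a: "a \<in> ideal_power R I e" and x: "x \<in> M k"
  shows "a \<otimes> x \<in> M (e + k)"
proof -
  have Mid: "ideal (M k) R" for k using M by (simp add: graded_submodule_iff)
  have "\<forall>k. \<forall>x\<in>M k. ideal_power R I e \<subseteq> ideal_colon R (M (e + k)) {x}"
  proof (induction e)
    case 0
    then show ?case using ideal.I_l_closed[OF Mid] by auto
  next
    case (Suc e)
    show ?case
    proof (intro allI ballI)
      fix k x assume x: "x \<in> M k"
      have xc: "x \<in> carrier R" using ideal.Icarr[OF Mid x] .
      show "ideal_power R I (Suc e) \<subseteq> ideal_colon R (M (Suc e + k)) {x}"
      proof (rule ideal_power_Suc_subset[OF ideal_colon_elem[OF Mid xc]])
        fix c b assume c: "c \<in> ideal_power R I e" and b: "b \<in> I"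
        have carr: "c \<in> carrier R" "b \<in> carrier R"
          using c b ideal.Icarr[OF ideal_ideal_power[OF I]] ideal.Icarr[OF I] by blast+
        have "b \<otimes> x \<in> M (Suc k)" using M b x by (simp add: graded_submodule_iff)
        then have "c \<in> ideal_colon R (M (e + Suc k)) {b \<otimes> x}" using Suc c by blast
        then show "c \<otimes> b \<in> ideal_colon R (M (Suc e + k)) {x}"
          using carr xc by (simp add: m_assoc)
      qed
    qed
  qed
  then show ?thesis using a x by (metis colon_elem_iff subsetD)
qed

text \<open>The degree \<open>e\<close> part of the annihilator, in the Rees algebra, of the class of \<open>x\<close> in \<open>I^m / M m\<close>.\<close>

definition graded_annihilator :: "'a set \<Rightarrow> (nat \<Rightarrow> 'a set) \<Rightarrow> nat \<Rightarrow> 'a \<Rightarrow> nat \<Rightarrow> 'a set"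
  where "graded_annihilator I M m x e = ideal_power R I e \<inter> ideal_colon R (M (m + e)) {x}"

lemma graded_submodule_annihilator:
  assumes I: "ideal I R" and M: "graded_submodule I M" and x: "x \<in> carrier R"
  shows "graded_submodule I (graded_annihilator I M m x)"
  unfolding graded_submodule_iff
proof (intro conjI allI ballI)
  have Mid: "ideal (M k) R" for k using M by (simp add: graded_submodule_iff)
  show "ideal (graded_annihilator I M m x k) R" for k
    unfolding graded_annihilator_def
    by (intro i_intersect ideal_ideal_power ideal_colon_elem I Mid x)
  show "graded_annihilator I M m x k \<subseteq> ideal_power R I k" for k
    by (auto simp: graded_annihilator_def)
  fix k a y assume a: "a \<in> I" and y: "y \<in> graded_annihilator I M m x k"
  then have y': "y \<in> ideal_power R I k" "y \<in> carrier R" "y \<otimes> x \<in> M (m + k)"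
    by (auto simp: graded_annihilator_def)
  have ac: "a \<in> carrier R" using ideal.Icarr[OF I a] .
  have "a \<otimes> y \<in> ideal_power R I (Suc k)"
    using ideal_prod.prod[OF y'(1) a, of R] ac y'(2) by (simp add: ideal_power_Suc m_comm)
  moreover have "a \<otimes> (y \<otimes> x) \<in> M (m + Suc k)"
    using M a y'(3) by (simp add: graded_submodule_iff)
  ultimately show "a \<otimes> y \<in> graded_annihilator I M m x (Suc k)"
    using ac y' x by (simp add: graded_annihilator_def m_assoc)
qed

end

context noetherian_cring
begin

text \<open>The chain condition in the form needed both for induction on graded ideals and for the choice of
  a maximal one.\<close>

lemma wf_graded_submodules:
  assumes I: "ideal I R"
  shows "wf {(M', M). graded_submodule I M \<and> graded_submodule I M' \<and> (\<forall>k. M k \<subseteq> M' k) \<and> M \<noteq> M'}"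
  unfolding wf_iff_no_infinite_down_chain
proof
  assume "\<exists>f. \<forall>i. (f (Suc i), f i) \<in>
    {(M', M). graded_submodule I M \<and> graded_submodule I M' \<and> (\<forall>k. M k \<subseteq> M' k) \<and> M \<noteq> M'}"
  then obtain C where C: "\<And>i. graded_submodule I (C i)" "\<And>i k. C i k \<subseteq> C (Suc i) k"
    "\<And>i. C i \<noteq> C (Suc i)" by blast
  obtain n0 where "\<forall>n\<ge>n0. \<forall>k. C n k = C n0 k"
    using graded_chain_stabilises[OF I, of C] C(1,2) unfolding graded_submodule_iff by blast
  then have "C (Suc n0) = C n0" using le_SucI[OF le_refl] by blast
  then show False using C(3)[of n0] by simp
qed

text \<open>Noetherian induction on \<open>M\<close>. Let \<open>x0\<close> be a homogeneous element outside \<open>M\<close> whose annihilator in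
  the Rees algebra is maximal. Every homogeneous multiple of \<open>x0\<close> outside \<open>M\<close> then has the same
  annihilator, so that the cyclic module generated by \<open>x0\<close> contributes a single prime of \<open>R\<close> at
  most. All other primes are associated to the larger family \<open>M'\<close> which contains \<open>x0\<close>.\<close>

lemma finite_graded_Ass:
  assumes I: "ideal I R" and "graded_submodule I M"
  shows "finite (graded_Ass I M)"
  using assms(2)
proof (induction M rule: wf_induct_rule[OF wf_graded_submodules[OF I]])
  case (1 M)
  note M = 1(2)
  have Mid: "ideal (M k) R" and Mle: "M k \<subseteq> ideal_power R I k" for k
    using M by (auto simp: graded_submodule_iff)
  note Icarr = ideal.Icarr[OF ideal_ideal_power[OF I]]
  show ?case
  proof (cases "\<forall>k. ideal_power R I k \<subseteq> M k")
    case True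
    have "graded_Ass I M = {}"
    proof -
      have False if "primeideal P R" "x \<in> ideal_power R I m" "P = ideal_colon R (M m) {x}" for P m x
      proof -
        have "\<one> \<in> P" using that True Icarr by auto
        then show False
          using that(1) ideal.one_imp_carrier[OF primeideal.axioms(1)] primeideal.I_notcarr by metis
      qed
      then show ?thesis unfolding graded_Ass_def by blast
    qed
    then show ?thesis by simp
  next
    case False
    define S where "S = {graded_annihilator I M m x | m x. x \<in> ideal_power R I m \<and> x \<notin> M m}"
    have S_sub: "graded_submodule I A" if "A \<in> S" for A
      using that graded_submodule_annihilator[OF I M] Icarr unfolding S_def by blast
    have "S \<noteq> {}" using False unfolding S_def by blast
    define r where "r = {(M', M). graded_submodule I M \<and> graded_submodule I M' \<and>
      (\<forall>k. M k \<subseteq> M' k) \<and> M \<noteq> M'}"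
    have "wf r" unfolding r_def by (rule wf_graded_submodules[OF I])
    then obtain A where A: "A \<in> S" and minA: "\<And>A'. (A', A) \<in> r \<Longrightarrow> A' \<notin> S"
      using \<open>S \<noteq> {}\<close> wf_eq_minimal by (metis ex_in_conv)
    have maxA: "A' = A" if "A' \<in> S" "\<forall>k. A k \<subseteq> A' k" for A'
      using minA[of A'] that unfolding r_def using S_sub[OF A] S_sub[OF that(1)] by blast
    obtain m0 x0 where x0: "x0 \<in> ideal_power R I m0" "x0 \<notin> M m0"
      and A_def: "A = graded_annihilator I M m0 x0" using A unfolding S_def by blast
    have x0c: "x0 \<in> carrier R" using x0 Icarr by blast
    define P0 where "P0 = ideal_colon R (M m0) {x0}"
    have cyclic: "ideal_colon R (M (m0 + e)) {a \<otimes> x0} = P0"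
      if a: "a \<in> ideal_power R I e" and ax: "a \<otimes> x0 \<notin> M (m0 + e)" for a e
    proof -
      have ac: "a \<in> carrier R" using a Icarr by blast
      have axI: "a \<otimes> x0 \<in> ideal_power R I (m0 + e)"
        using ideal_power_mult_mem[OF I a x0(1)] by (simp add: add.commute)
      then have "graded_annihilator I M (m0 + e) (a \<otimes> x0) \<in> S"
        using ax unfolding S_def by blast
      moreover have "\<forall>k. A k \<subseteq> graded_annihilator I M (m0 + e) (a \<otimes> x0) k"
      proof (intro allI subsetI)
        fix k c assume "c \<in> A k"
        then have c: "c \<in> ideal_power R I k" "c \<in> carrier R" "c \<otimes> x0 \<in> M (m0 + k)"
          by (auto simp: A_def graded_annihilator_def)
        have "a \<otimes> (c \<otimes> x0) \<in> M (e + (m0 + k))"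
          by (rule graded_submodule_power[OF I M a c(3)])
        then have "c \<otimes> (a \<otimes> x0) \<in> M (m0 + e + k)"
          using ac c(2) x0c m_lcomm by (simp add: ac_simps)
        then show "c \<in> graded_annihilator I M (m0 + e) (a \<otimes> x0) k"
          using c by (simp add: graded_annihilator_def)
      qed
      ultimately have "graded_annihilator I M (m0 + e) (a \<otimes> x0) 0 = A 0" using maxA by metis
      then show ?thesis
        unfolding A_def graded_annihilator_def P0_def by (auto simp: ideal_colon_def)
    qed
    \<comment> \<open>\<open>M'\<close> is the sum of \<open>M\<close> and the graded ideal generated by \<open>x0\<close>, which starts in degree
      \<open>m0\<close>.\<close>
    define M' where "M' k = (if k < m0 then M k
      else M k <+>\<^bsub>R\<^esub> (\<lambda>a. x0 \<otimes> a) ` ideal_power R I (k - m0))" for k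
    have M'id: "ideal (M' k) R" for k
      unfolding M'_def using Mid x0c
      by (simp add: add_ideals mult_image_ideal ideal_ideal_power[OF I])
    have M'E: "\<exists>w\<in>M k. \<exists>a\<in>ideal_power R I (k - m0). z = w \<oplus> x0 \<otimes> a"
      if "z \<in> M' k" "\<not> k < m0" for z k
      using that by (auto simp: M'_def set_add_def')
    have M'I: "w \<oplus> x0 \<otimes> a \<in> M' k"
      if "w \<in> M k" "a \<in> ideal_power R I (k - m0)" "\<not> k < m0" for w a k
      using that by (auto simp: M'_def set_add_def')
    have le: "M k \<subseteq> M' k" for k
    proof
      fix z assume z: "z \<in> M k"
      show "z \<in> M' k"
      proof (cases "k < m0")
        case False
        have "z \<oplus> x0 \<otimes> \<zero> \<in> M' k" using M'I[OF z ideal_zero[OF ideal_ideal_power[OF I]] False] .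
        then show ?thesis using ideal.Icarr[OF Mid z] x0c by simp
      qed (use z in \<open>simp add: M'_def\<close>)
    qed
    have M': "graded_submodule I M'"
      unfolding graded_submodule_iff
    proof (intro conjI allI ballI M'id)
      fix k
      show "M' k \<subseteq> ideal_power R I k"
      proof
        fix z assume z: "z \<in> M' k"
        show "z \<in> ideal_power R I k"
        proof (cases "k < m0")
          case True
          then show ?thesis using z Mle by (auto simp: M'_def)
        next
          case False
          then obtain w a where wa: "w \<in> M k" "a \<in> ideal_power R I (k - m0)" "z = w \<oplus> x0 \<otimes> a"
            using M'E z by blast
          have "x0 \<otimes> a \<in> ideal_power R I k" using ideal_power_mult_mem[OF I x0(1) wa(2)] False by simp
          then show ?thesis using wa Mle ideal_add[OF ideal_ideal_power[OF I]] by blast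
        qed
      qed
      fix b z assume b: "b \<in> I" and z: "z \<in> M' k"
      have bc: "b \<in> carrier R" using ideal.Icarr[OF I b] .
      have bM: "b \<otimes> w \<in> M (Suc k)" if "w \<in> M k" for w
        using M that b by (simp add: graded_submodule_iff)
      show "b \<otimes> z \<in> M' (Suc k)"
      proof (cases "k < m0")
        case True
        then have "z \<in> M k" using z by (simp add: M'_def)
        then show ?thesis using bM le by blast
      next
        case False
        then obtain w a where wa: "w \<in> M k" "a \<in> ideal_power R I (k - m0)" "z = w \<oplus> x0 \<otimes> a"
          using M'E z by blast
        have c: "w \<in> carrier R" "a \<in> carrier R" using wa ideal.Icarr[OF Mid] Icarr by auto
        have "a \<otimes> b \<in> ideal_power R I (Suc k - m0)"
          using ideal_prod.prod[OF wa(2) b, of R] False by (simp add: ideal_power_Suc Suc_diff_le)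
        then have "b \<otimes> w \<oplus> x0 \<otimes> (a \<otimes> b) \<in> M' (Suc k)" using M'I bM[OF wa(1)] False by simp
        moreover have "b \<otimes> z = b \<otimes> w \<oplus> x0 \<otimes> (a \<otimes> b)"
          unfolding wa(3) using bc c x0c by algebra
        ultimately show ?thesis by simp
      qed
    qed
    have "x0 \<in> M' m0" using M'I[OF ideal_zero[OF Mid], of \<one> m0] x0c by simp
    then have "M \<noteq> M'" using x0 by blast
    then have fin: "finite (graded_Ass I M')" using 1(1)[of M'] M M' le by blast
    have "graded_Ass I M \<subseteq> insert P0 (graded_Ass I M')"
    proof
      fix P assume "P \<in> graded_Ass I M"
      then obtain m x where P: "primeideal P R" and x: "x \<in> ideal_power R I m"
        and Px: "P = ideal_colon R (M m) {x}" unfolding graded_Ass_def by blast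
      have xc: "x \<in> carrier R" using x Icarr by blast
      show "P \<in> insert P0 (graded_Ass I M')"
      proof (cases "ideal_colon R (M' m) {x} \<subseteq> P")
        case True
        then have "P = ideal_colon R (M' m) {x}"
          using Px le[of m] by (auto simp: ideal_colon_def)
        then show ?thesis using P x unfolding graded_Ass_def by blast
      next
        case False
        then obtain r where "r \<in> ideal_colon R (M' m) {x}" "r \<notin> P" by blast
        then have r: "r \<in> carrier R" "r \<otimes> x \<in> M' m" "r \<notin> P" by auto
        have rx: "r \<otimes> x \<notin> M m" using r Px by simp
        then have m: "\<not> m < m0" using r by (auto simp: M'_def)
        obtain w a where wa: "w \<in> M m" "a \<in> ideal_power R I (m - m0)" "r \<otimes> x = w \<oplus> x0 \<otimes> a"
          using M'E[OF r(2) m] by blast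
        have c: "w \<in> carrier R" "a \<in> carrier R" using wa ideal.Icarr[OF Mid] Icarr by auto
        have eq: "t \<otimes> (r \<otimes> x) \<in> M m \<longleftrightarrow> t \<otimes> (a \<otimes> x0) \<in> M m" if t: "t \<in> carrier R" for t
        proof -
          have tw: "t \<otimes> w \<in> M m" using ideal.I_l_closed[OF Mid wa(1) t] .
          have e: "t \<otimes> (r \<otimes> x) = t \<otimes> (a \<otimes> x0) \<oplus> t \<otimes> w"
            unfolding wa(3) using t c x0c by algebra
          show ?thesis
            unfolding e using ideal_add[OF Mid _ tw] ideal_add_cancel[OF Mid _ tw] t c x0c by blast
        qed
        have "a \<otimes> x0 \<notin> M m" using eq[of \<one>] rx r xc c x0c by simp
        then have "ideal_colon R (M m) {a \<otimes> x0} = P0" using cyclic[OF wa(2)] m by simp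
        moreover have "ideal_colon R (M m) {r \<otimes> x} = ideal_colon R (M m) {a \<otimes> x0}"
          using eq by (auto simp: ideal_colon_def)
        ultimately show ?thesis using ideal_colon_mult_prime[OF Mid xc P Px r(1,3)] by simp
      qed
    qed
    then show ?thesis using fin finite_subset by blast
  qed
qed

text \<open>Every associated prime of \<open>I^n\<close> is an associated prime of some \<open>I^m / I^(m+1)\<close>: among the
  nonzero multiples of an element of \<open>R / I^n\<close> with annihilator \<open>P\<close>, one that lies as deep as
  possible in the filtration has annihilator \<open>P\<close> in the corresponding graded piece.\<close>

theorem finite_Ass_powers:
  assumes I: "ideal I R"
  shows "finite (\<Union>n. Ass R (ideal_power R I n))"
proof (rule finite_subset)
  define M where "M m = ideal_power R I (Suc m)" for m
  note pid = ideal_ideal_power[OF I]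
  have "a \<otimes> x \<in> M (Suc k)" if "a \<in> I" "x \<in> M k" for a x k
    using ideal_prod.prod[OF that(2,1), of R] ideal.Icarr[OF I that(1)] ideal.Icarr[OF pid] that(2)
    unfolding M_def ideal_power_Suc[of _ "Suc k"] by (simp add: m_comm del: nat_pow_Suc)
  then have "graded_submodule I M"
    unfolding graded_submodule_iff using ideal_power_antimono[OF I le_SucI[OF le_refl]] pid
    unfolding M_def by blast
  then show "finite (graded_Ass I M)" by (rule finite_graded_Ass[OF I])
  show "(\<Union>n. Ass R (ideal_power R I n)) \<subseteq> graded_Ass I M"
  proof
    fix P assume "P \<in> (\<Union>n. Ass R (ideal_power R I n))"
    then obtain n x where P: "primeideal P R" and x: "x \<in> carrier R"
      and Px: "P = ideal_colon R (ideal_power R I n) {x}" using Ass_iff[OF pid] by blast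
    have one: "\<one> \<notin> P"
      using ideal.one_imp_carrier[OF primeideal.axioms(1)[OF P]] primeideal.I_notcarr[OF P] by blast
    define S where "S = {m. \<exists>r\<in>carrier R. r \<otimes> x \<in> ideal_power R I m \<and> r \<notin> P}"
    have S0: "0 \<in> S" unfolding S_def using x one by auto
    have Sn: "m < n" if "m \<in> S" for m
    proof (rule ccontr)
      assume "\<not> m < n"
      then show False using that ideal_power_antimono[OF I, of n m] unfolding S_def Px by auto
    qed
    then have "finite S" using finite_nat_set_iff_bounded by blast
    define m where "m = Max S"
    have mS: "m \<in> S" unfolding m_def using S0 \<open>finite S\<close> by (intro Max_in) auto
    have "Suc m \<notin> S" unfolding m_def using Max_ge[OF \<open>finite S\<close>] by (metis Suc_n_not_le_n)
    obtain r where r: "r \<in> carrier R" "r \<otimes> x \<in> ideal_power R I m" "r \<notin> P"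
      using mS unfolding S_def by blast
    have rP: "ideal_colon R (ideal_power R I n) {r \<otimes> x} = P"
      by (rule ideal_colon_mult_prime[OF pid x P Px r(1,3)])
    have "ideal_colon R (M m) {r \<otimes> x} = P"
    proof
      show "P \<subseteq> ideal_colon R (M m) {r \<otimes> x}"
        using rP ideal_power_antimono[OF I, of "Suc m" n] Sn[OF mS] by (auto simp: M_def)
      show "ideal_colon R (M m) {r \<otimes> x} \<subseteq> P"
      proof
        fix t assume "t \<in> ideal_colon R (M m) {r \<otimes> x}"
        then have t: "t \<in> carrier R" "(t \<otimes> r) \<otimes> x \<in> ideal_power R I (Suc m)"
          using r x by (auto simp: M_def m_assoc)
        then have "t \<otimes> r \<in> P" using \<open>Suc m \<notin> S\<close> r(1) unfolding S_def by blast
        then show "t \<in> P" using primeideal.I_prime[OF P t(1) r(1)] r(3) by blast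
      qed
    qed
    then show "P \<in> graded_Ass I M" unfolding graded_Ass_def using P r(2) by blast
  qed
qed

end

section \<open>Integrality as a growth condition\<close>

context cring
begin

text \<open>The powers of \<open>B\<close> lie as deep in the powers of \<open>I\<close> as those of \<open>I^(p/q)\<close>, up to a constant. For
  a principal ideal \<open>B\<close> this characterises the elements of the rational power; for general \<open>B\<close>
  it makes sums manageable.\<close>

definition power_growth :: "'a set \<Rightarrow> nat \<Rightarrow> nat \<Rightarrow> 'a set \<Rightarrow> bool"
  where "power_growth I p q B \<longleftrightarrow>
    (\<exists>N. \<forall>k m. q * m + N \<le> p * k \<longrightarrow> ideal_power R B k \<subseteq> ideal_power R I m)"

lemma power_growth_sum:
  assumes I: "ideal I R" and A: "ideal A R" "power_growth I p q A"
    and B: "ideal B R" "power_growth I p q B" and q: "q > 0"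
  shows "power_growth I p q (A <+>\<^bsub>R\<^esub> B)"
proof -
  obtain M where M: "\<And>k m. q * m + M \<le> p * k \<Longrightarrow> ideal_power R A k \<subseteq> ideal_power R I m"
    using A(2) unfolding power_growth_def by blast
  obtain N where N: "\<And>k m. q * m + N \<le> p * k \<Longrightarrow> ideal_power R B k \<subseteq> ideal_power R I m"
    using B(2) unfolding power_growth_def by blast
  have exponent: "q * ((p * k - L) div q) + L \<le> p * k \<or> (p * k - L) div q = 0" for L k :: nat
  proof (cases "L \<le> p * k")
    case True
    have "q * ((p * k - L) div q) \<le> p * k - L" by (rule times_div_less_eq_dividend)
    then show ?thesis using True by linarith
  qed simp
  have large: "p * k \<le> q * ((p * k - L) div q) + q + L" for k L
  proof -
    have "p * k - L \<le> q * ((p * k - L) div q) + q"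
      using mult_div_mod_eq[of q "p * k - L"] mod_less_divisor[OF q, of "p * k - L"] by linarith
    then show ?thesis by linarith
  qed
  have "ideal_power R (A <+>\<^bsub>R\<^esub> B) k \<subseteq> ideal_power R I m"
    if km: "q * m + (M + N + 2 * q) \<le> p * k" for k m
  proof (rule ideal_power_sum_subset[OF A(1) B(1) ideal_ideal_power[OF I]])
    fix i j a c assume ij: "i + j = k" and a: "a \<in> ideal_power R A i" and c: "c \<in> ideal_power R B j"
    \<comment> \<open>Rounding down costs less than \<open>q\<close> in each of the two exponents; this is the summand
      \<open>2 * q\<close> in the constant.\<close>
    define m1 where "m1 = (p * i - M) div q"
    define m2 where "m2 = (p * j - N) div q"
    have carr: "a \<in> carrier R" "c \<in> carrier R"
      using a c ideal.Icarr[OF ideal_ideal_power[OF A(1)]] ideal.Icarr[OF ideal_ideal_power[OF B(1)]]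
      by blast+
    have "a \<in> ideal_power R I m1" using exponent[of i M] M[of m1 i] a carr m1_def by auto
    moreover have "c \<in> ideal_power R I m2" using exponent[of j N] N[of m2 j] c carr m2_def by auto
    ultimately have ac: "a \<otimes> c \<in> ideal_power R I (m1 + m2)" using ideal_power_mult_mem[OF I] by blast
    have "p * k = p * i + p * j" unfolding ij[symmetric] by (rule distrib_left)
    then have "q * m \<le> q * m1 + q * m2"
      using large[of i M] large[of j N] km unfolding m1_def[symmetric] m2_def[symmetric] by linarith
    then have "q * m \<le> q * (m1 + m2)" by (simp only: distrib_left)
    then have "m \<le> m1 + m2" using q by simp
    then show "a \<otimes> c \<in> ideal_power R I m" using ac ideal_power_antimono[OF I] by blast
  qed
  then show ?thesis unfolding power_growth_def by blast
qed

lemma power_growth_subset: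
  assumes "ideal A R" "ideal B R" "A \<subseteq> B" "power_growth I p q B"
  shows "power_growth I p q A"
proof -
  obtain N where "\<forall>k m. q * m + N \<le> p * k \<longrightarrow> ideal_power R B k \<subseteq> ideal_power R I m"
    using assms(4) unfolding power_growth_def by blast
  then have "\<forall>k m. q * m + N \<le> p * k \<longrightarrow> ideal_power R A k \<subseteq> ideal_power R I m"
    using ideal_power_mono[OF assms(1-3)] subset_trans by metis
  then show ?thesis unfolding power_growth_def by blast
qed

lemma power_growth_principal:
  assumes I: "ideal I R" and f: "f \<in> carrier R"
  shows "power_growth I p q (PIdl f) \<longleftrightarrow>
    (\<exists>N. \<forall>k m. q * m + N \<le> p * k \<longrightarrow> f [^] k \<in> ideal_power R I m)"
proof -
  have "PIdl (f [^] k) \<subseteq> ideal_power R I m \<longleftrightarrow> f [^] k \<in> ideal_power R I m" for k m :: nat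
    using cgenideal_self[of "f [^] k"] cgenideal_minimal[OF ideal_ideal_power[OF I]] f by blast
  then show ?thesis using f by (simp add: power_growth_def ideal_power_principal)
qed

text \<open>An equation of degree \<open>n\<close> reduces \<open>y^k\<close> to products of lower powers of \<open>y\<close> with coefficients in
  powers of \<open>B\<close>; only the last \<open>n\<close> factors are lost.\<close>

lemma integral_imp_growth:
  assumes B: "ideal B R" and y: "y \<in> integral_closure R B"
  shows "\<exists>n. \<forall>k. y [^] k \<in> ideal_power R B (k - n)"
proof -
  obtain n a where n: "n \<ge> 1" and a: "\<And>i. i \<in> {1..n} \<Longrightarrow> a i \<in> ideal_power R B i"
    and eq: "y [^] n \<oplus> (\<Oplus>i\<in>{1..n}. a i \<otimes> y [^] (n - i)) = \<zero>" and yc: "y \<in> carrier R"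
    using y unfolding integral_closure_def by blast
  note Bcarr = ideal.Icarr[OF ideal_ideal_power[OF B]]
  define S where "S = (\<Oplus>i\<in>{1..n}. a i \<otimes> y [^] (n - i))"
  have Sc: "S \<in> carrier R"
    unfolding S_def using a Bcarr yc by (intro finsum_closed) blast
  have yn: "y [^] n = \<ominus> S"
    using sum_zero_eq_neg[OF nat_pow_closed[OF yc] Sc] eq unfolding S_def by blast
  have "y [^] k \<in> ideal_power R B (k - n)" for k
  proof (induction k rule: less_induct)
    case (less k)
    show ?case
    proof (cases "k < n")
      case True
      then show ?thesis using yc by simp
    next
      case False
      define c where "c = y [^] (k - n)"
      have c: "c \<in> carrier R" unfolding c_def using yc by simp
      have id: "ideal (ideal_colon R (ideal_power R B (k - n)) {c}) R"
        by (intro ideal_colon_elem ideal_ideal_power B c)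
      have "S \<in> ideal_colon R (ideal_power R B (k - n)) {c}"
        unfolding S_def
      proof (rule ideal_finsum[OF id])
        fix i assume i: "i \<in> {1..n}"
        have ai: "a i \<in> carrier R" using a[OF i] Bcarr by blast
        have "y [^] (k - i) \<in> ideal_power R B (k - i - n)" using less[of "k - i"] i False by simp
        then have "a i \<otimes> y [^] (k - i) \<in> ideal_power R B (i + (k - i - n))"
          using ideal_power_mult_mem[OF B a[OF i]] by blast
        moreover have "k - n \<le> i + (k - i - n)" by linarith
        ultimately have mem: "a i \<otimes> y [^] (k - i) \<in> ideal_power R B (k - n)"
          using ideal_power_antimono[OF B \<open>k - n \<le> i + (k - i - n)\<close>] by blast
        have "y [^] (n - i) \<otimes> c = y [^] (k - i)"
          unfolding c_def using nat_pow_mult[OF yc, of "n - i" "k - n"] i False by simp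
        then have "(a i \<otimes> y [^] (n - i)) \<otimes> c = a i \<otimes> y [^] (k - i)"
          using ai yc c by (simp add: m_assoc)
        then show "a i \<otimes> y [^] (n - i) \<in> ideal_colon R (ideal_power R B (k - n)) {c}"
          using mem ai yc by simp
      qed simp
      then have "\<ominus> S \<otimes> c \<in> ideal_power R B (k - n)"
        using ideal_neg[OF id] by simp
      moreover have "\<ominus> S \<otimes> c = y [^] k"
        unfolding yn[symmetric] c_def using nat_pow_mult[OF yc, of n "k - n"] False by simp
      ultimately show ?thesis by simp
    qed
  qed
  then show ?thesis by blast
qed

lemma integral_closureI:
  assumes B: "ideal B R" and z: "z \<in> carrier R" and c: "\<And>j. j \<le> m \<Longrightarrow> c j \<in> ideal_power R B (Suc m - j)"
    and eq: "z [^] Suc m = (\<Oplus>j\<in>{..m}. z [^] j \<otimes> c j)"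
  shows "z \<in> integral_closure R B"
proof -
  note Bcarr = ideal.Icarr[OF ideal_ideal_power[OF B]]
  define n where "n = Suc m"
  define a where "a i = \<ominus> c (n - i)" for i
  have a: "a i \<in> ideal_power R B i" if "i \<in> {1..n}" for i
    using c[of "n - i"] that ideal_neg[OF ideal_ideal_power[OF B]] by (auto simp: a_def n_def)
  have cc: "c j \<in> carrier R" if "j \<le> m" for j using c[OF that] Bcarr by blast
  have zj: "z [^] j \<otimes> c j \<in> carrier R" if "j \<in> {..m}" for j using cc that z by simp
  have inj: "inj_on (\<lambda>j. n - j) {..m}" by (auto simp: inj_on_def n_def)
  have im: "(\<lambda>j. n - j) ` {..m} = {1..n}"
  proof
    show "{1..n} \<subseteq> (\<lambda>j. n - j) ` {..m}"
    proof
      fix i assume "i \<in> {1..n}"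
      then have "i = n - (n - i)" "n - i \<in> {..m}" by (auto simp: n_def)
      then show "i \<in> (\<lambda>j. n - j) ` {..m}" by blast
    qed
  qed (auto simp: n_def)
  have "a i \<in> carrier R" if "i \<in> {1..n}" for i using a[OF that] Bcarr by blast
  then have closed: "(\<lambda>i. a i \<otimes> z [^] (n - i)) \<in> (\<lambda>j. n - j) ` {..m} \<rightarrow> carrier R"
    unfolding im using z by auto
  have "(\<Oplus>i\<in>{1..n}. a i \<otimes> z [^] (n - i)) = (\<Oplus>j\<in>{..m}. a (n - j) \<otimes> z [^] (n - (n - j)))"
    using finsum_reindex[OF closed inj] unfolding im .
  also have "\<dots> = (\<Oplus>j\<in>{..m}. \<ominus> \<one> \<otimes> (z [^] j \<otimes> c j))"
  proof (rule finsum_cong')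
    fix j assume j: "j \<in> {..m}"
    then have "c j \<in> carrier R" "z [^] j \<in> carrier R" using cc z by auto
    then have "\<ominus> c j \<otimes> z [^] j = \<ominus> \<one> \<otimes> (z [^] j \<otimes> c j)"
      by (simp add: l_minus m_comm[of "c j"])
    moreover have "n - (n - j) = j" using j by (simp add: n_def)
    ultimately show "a (n - j) \<otimes> z [^] (n - (n - j)) = \<ominus> \<one> \<otimes> (z [^] j \<otimes> c j)"
      by (simp add: a_def)
  qed (use zj in auto)
  also have "\<dots> = \<ominus> \<one> \<otimes> (\<Oplus>j\<in>{..m}. z [^] j \<otimes> c j)"
    using zj by (intro finsum_rdistr[symmetric]) auto
  also have "\<dots> = \<ominus> (z [^] n)" 
    unfolding eq[symmetric] n_def using z by (simp add: l_minus del: nat_pow_Suc)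
  finally have "z [^] n \<oplus> (\<Oplus>i\<in>{1..n}. a i \<otimes> z [^] (n - i)) = \<zero>" using z by (simp add: r_neg)
  moreover have "n \<ge> 1" by (simp add: n_def)
  ultimately show ?thesis unfolding integral_closure_def using z a by blast
qed

text \<open>If \<open>y\<close> has weight \<open>p\<close>, these are the elements of weight \<open>k\<close> in the module generated by
  \<open>1, \<dots>, y^m\<close> over the Rees algebra of \<open>I\<close> extended by \<open>R\<close> in negative degrees. The
  truncated subtraction of natural numbers accounts for \<open>I^n = R\<close> in degrees \<open>n \<le> 0\<close>.\<close>

definition weighted_span :: "'a set \<Rightarrow> nat \<Rightarrow> 'a \<Rightarrow> nat \<Rightarrow> nat \<Rightarrow> 'a set"
  where "weighted_span I p y m k =
    {(\<Oplus>j\<in>{..m}. y [^] j \<otimes> a j) | a. \<forall>j\<le>m. a j \<in> ideal_power R I (k - p * j)}"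

lemma weighted_spanI:
  assumes "z = (\<Oplus>j\<in>{..m}. y [^] j \<otimes> a j)" "\<And>j. j \<le> m \<Longrightarrow> a j \<in> ideal_power R I (k - p * j)"
  shows "z \<in> weighted_span I p y m k"
  using assms unfolding weighted_span_def by blast

context
  fixes I and p :: nat and y
  assumes I: "ideal I R" and y: "y \<in> carrier R"
begin

lemma weighted_span_closed:
  assumes "\<forall>j\<le>(m::nat). a j \<in> ideal_power R I (k j)"
  shows "(\<lambda>j. y [^] j \<otimes> a j) \<in> {..m} \<rightarrow> carrier R"
proof (rule Pi_I)
  fix j assume "j \<in> {..m}"
  then have "a j \<in> carrier R" using assms ideal.Icarr[OF ideal_ideal_power[OF I]] by blast
  then show "y [^] j \<otimes> a j \<in> carrier R" using y by simp
qed

lemma weighted_span_mult: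
  assumes x: "x \<in> carrier R" and z: "z \<in> weighted_span I p y m k"
    and step: "\<And>j w. w \<in> ideal_power R I (k - p * j) \<Longrightarrow> x \<otimes> w \<in> ideal_power R I (k' - p * j)"
  shows "x \<otimes> z \<in> weighted_span I p y m k'"
proof -
  obtain a where a: "\<forall>j\<le>m. a j \<in> ideal_power R I (k - p * j)" and z: "z = (\<Oplus>j\<in>{..m}. y [^] j \<otimes> a j)"
    using z unfolding weighted_span_def by blast
  have ac: "a j \<in> carrier R" if "j \<le> m" for j
    using a that ideal.Icarr[OF ideal_ideal_power[OF I]] by blast
  have "x \<otimes> z = (\<Oplus>j\<in>{..m}. x \<otimes> (y [^] j \<otimes> a j))"
    unfolding z using x weighted_span_closed[OF a] by (intro finsum_rdistr) auto
  also have "\<dots> = (\<Oplus>j\<in>{..m}. y [^] j \<otimes> (x \<otimes> a j))"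
    using x y ac by (intro finsum_cong') (auto simp: m_lcomm)
  finally show ?thesis by (rule weighted_spanI) (use a step in blast)
qed

lemma ideal_weighted_span: "ideal (weighted_span I p y m k) R"
proof (rule idealI_elem)
  show "weighted_span I p y m k \<subseteq> carrier R"
  proof
    fix z assume "z \<in> weighted_span I p y m k"
    then obtain a where "\<forall>j\<le>m. a j \<in> ideal_power R I (k - p * j)"
      and z: "z = (\<Oplus>j\<in>{..m}. y [^] j \<otimes> a j)" unfolding weighted_span_def by blast
    then show "z \<in> carrier R" unfolding z by (intro finsum_closed weighted_span_closed)
  qed
  have "(\<Oplus>j\<in>{..m}. y [^] j \<otimes> \<zero>) = \<zero>" using y by (simp)
  then show "\<zero> \<in> weighted_span I p y m k"
    unfolding weighted_span_def using ideal_zero[OF ideal_ideal_power[OF I]]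
    by (auto intro!: exI[of _ "\<lambda>_. \<zero>"])
  fix z assume z: "z \<in> weighted_span I p y m k"
  then obtain a where a: "\<forall>j\<le>m. a j \<in> ideal_power R I (k - p * j)" and za: "z = (\<Oplus>j\<in>{..m}. y [^] j \<otimes> a j)"
    unfolding weighted_span_def by blast
  { fix w assume "w \<in> weighted_span I p y m k"
    then obtain b where b: "\<forall>j\<le>m. b j \<in> ideal_power R I (k - p * j)" and wb: "w = (\<Oplus>j\<in>{..m}. y [^] j \<otimes> b j)"
      unfolding weighted_span_def by blast
    have abc: "a j \<in> carrier R" "b j \<in> carrier R" if "j \<le> m" for j
      using a b that ideal.Icarr[OF ideal_ideal_power[OF I]] by blast+
    have "z \<oplus> w = (\<Oplus>j\<in>{..m}. y [^] j \<otimes> a j \<oplus> y [^] j \<otimes> b j)"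
      unfolding za wb using finsum_addf[OF weighted_span_closed[OF a] weighted_span_closed[OF b]] by simp
    also have "\<dots> = (\<Oplus>j\<in>{..m}. y [^] j \<otimes> (a j \<oplus> b j))"
      using abc y by (intro finsum_cong') (auto simp: r_distr)
    finally show "z \<oplus> w \<in> weighted_span I p y m k"
      by (rule weighted_spanI) (use a b ideal_add[OF ideal_ideal_power[OF I]] in blast) }
  show "x \<otimes> z \<in> weighted_span I p y m k" if "x \<in> carrier R" for x
    by (rule weighted_span_mult[OF that z ideal.I_l_closed[OF ideal_ideal_power[OF I] _ that]])
qed

lemma weighted_span_Suc_mono: "weighted_span I p y m k \<subseteq> weighted_span I p y (Suc m) k"
proof
  fix z assume "z \<in> weighted_span I p y m k"
  then obtain a where a: "\<forall>j\<le>m. a j \<in> ideal_power R I (k - p * j)" and z: "z = (\<Oplus>j\<in>{..m}. y [^] j \<otimes> a j)"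
    unfolding weighted_span_def by blast
  define b where "b = a(Suc m := \<zero>)"
  have b: "\<forall>j\<le>Suc m. b j \<in> ideal_power R I (k - p * j)"
    using a ideal_zero[OF ideal_ideal_power[OF I]] by (auto simp: b_def le_Suc_eq)
  have "(\<Oplus>j\<in>{..m}. y [^] j \<otimes> b j) = z"
    unfolding z using weighted_span_closed[OF a] by (intro finsum_cong') (auto simp: b_def)
  moreover have "z \<in> carrier R" unfolding z using weighted_span_closed[OF a] by (rule finsum_closed)
  ultimately have "(\<Oplus>j\<in>{..Suc m}. y [^] j \<otimes> b j) = z"
    using finsum_Suc[OF weighted_span_closed[OF b]] y by (simp add: b_def del: nat_pow_Suc)
  then show "z \<in> weighted_span I p y (Suc m) k" using b unfolding weighted_span_def by blast
qed

lemma weighted_span_top: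
  assumes s: "s \<in> carrier R"
  shows "y [^] m \<otimes> s \<in> weighted_span I p y m (p * m)"
proof -
  define a where "a j = (if j = m then s else \<zero>)" for j
  have a: "\<forall>j\<le>m. a j \<in> ideal_power R I (p * m - p * j)"
    using s ideal_zero[OF ideal_ideal_power[OF I]] by (auto simp: a_def)
  have "(\<Oplus>j\<in>{..m}. y [^] j \<otimes> a j) = (\<Oplus>j\<in>{..m}. if m = j then y [^] j \<otimes> s else \<zero>)"
    using s y by (intro finsum_cong') (auto simp: a_def)
  also have "\<dots> = y [^] m \<otimes> s"
    using s y by (intro add.finprod_singleton) auto
  finally show ?thesis using a unfolding weighted_span_def by force
qed

end

end

context noetherian_cring
begin

text \<open>Let \<open>y = f^q\<close>, of weight \<open>p\<close>. The growth condition confines the modules generated by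
  \<open>1, \<dots>, y^m\<close>, up to denominators in \<open>T\<close>, to a copy of the Rees algebra shifted by \<open>N\<close>.
  There they form an ascending chain of graded ideals, which stabilises; so some \<open>t y^(m+1)\<close>
  with \<open>t \<in> T\<close> is a combination of lower powers of \<open>y\<close> with coefficients of the right
  weight. Multiplied by a power of \<open>t\<close>, this is an equation of integral dependence for
  \<open>(t f)^q\<close>.\<close>

lemma local_growth_imp_integral:
  assumes I: "ideal I R" and f: "f \<in> carrier R" and p: "p > 0" and q: "q > 0"
    and T: "T \<subseteq> carrier R" "T \<noteq> {}" "\<And>s t. s \<in> T \<Longrightarrow> t \<in> T \<Longrightarrow> s \<otimes> t \<in> T"
    and growth: "\<And>k m. q * m + N \<le> p * k \<Longrightarrow> \<exists>s\<in>T. s \<otimes> f [^] k \<in> ideal_power R I m"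
  shows "\<exists>s\<in>T. (s \<otimes> f) [^] q \<in> integral_closure R (ideal_power R I p)"
proof -
  define y where "y = f [^] q"
  have y: "y \<in> carrier R" unfolding y_def using f by simp
  note pid = ideal_ideal_power[OF I]
  note wid = ideal_weighted_span[OF I y]
  \<comment> \<open>The index is shifted by \<open>N\<close>, so that \<open>C m\<close> lies inside the powers of \<open>I\<close>.\<close>
  define C where "C m e = {r \<in> ideal_power R I e. \<exists>s\<in>T. s \<otimes> r \<in> weighted_span I p y m (e + N)}" for m e
  have C_id: "ideal (C m e) R" for m e
  proof (rule idealI_elem)
    show "C m e \<subseteq> carrier R" using ideal.Icarr[OF pid] unfolding C_def by blast
    obtain s where "s \<in> T" using T(2) by blast
    then show "\<zero> \<in> C m e"
      using T(1) ideal_zero[OF pid] ideal_zero[OF wid] unfolding C_def by force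
    fix r assume "r \<in> C m e"
    then obtain s where r: "r \<in> ideal_power R I e" and s: "s \<in> T" "s \<otimes> r \<in> weighted_span I p y m (e + N)"
      unfolding C_def by blast
    have c: "r \<in> carrier R" "s \<in> carrier R" using r s T(1) ideal.Icarr[OF pid] by blast+
    { fix r' assume "r' \<in> C m e"
      then obtain s' where r': "r' \<in> ideal_power R I e" and s': "s' \<in> T" "s' \<otimes> r' \<in> weighted_span I p y m (e + N)"
        unfolding C_def by blast
      have c': "r' \<in> carrier R" "s' \<in> carrier R" using r' s' T(1) ideal.Icarr[OF pid] by blast+
      have "s' \<otimes> (s \<otimes> r) \<oplus> s \<otimes> (s' \<otimes> r') \<in> weighted_span I p y m (e + N)"
        by (rule ideal_add[OF wid ideal.I_l_closed[OF wid s(2) c'(2)]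
              ideal.I_l_closed[OF wid s'(2) c(2)]])
      moreover have "s' \<otimes> (s \<otimes> r) \<oplus> s \<otimes> (s' \<otimes> r') = (s \<otimes> s') \<otimes> (r \<oplus> r')"
        using c c' by algebra
      ultimately show "r \<oplus> r' \<in> C m e"
        unfolding C_def using ideal_add[OF pid r r'] T(3)[OF s(1) s'(1)] by auto }
    fix x assume x: "x \<in> carrier R"
    have "s \<otimes> (x \<otimes> r) \<in> weighted_span I p y m (e + N)"
      using ideal.I_l_closed[OF wid s(2) x] c x by (simp add: m_lcomm)
    then show "x \<otimes> r \<in> C m e"
      unfolding C_def using ideal.I_l_closed[OF pid r x] s(1) by blast
  qed
  have C_stable: "a \<otimes> r \<in> C m (Suc e)" if a: "a \<in> I" and r0: "r \<in> C m e" for a r m e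
  proof -
    obtain s where r: "r \<in> ideal_power R I e" and s: "s \<in> T" "s \<otimes> r \<in> weighted_span I p y m (e + N)"
      using r0 unfolding C_def by blast
    have c: "r \<in> carrier R" "s \<in> carrier R" "a \<in> carrier R"
      using r s a T(1) ideal.Icarr[OF pid] ideal.Icarr[OF I] by blast+
    have aw: "a \<otimes> w \<in> ideal_power R I (Suc k)" if w: "w \<in> ideal_power R I k" for w k
      using ideal_prod.prod[OF w a, of R] c(3) ideal.Icarr[OF pid w] by (simp add: ideal_power_Suc m_comm)
    have "a \<otimes> (s \<otimes> r) \<in> weighted_span I p y m (Suc e + N)"
    proof (rule weighted_span_mult[OF I y c(3) s(2)])
      fix j w assume "w \<in> ideal_power R I (e + N - p * j)"
      then have "a \<otimes> w \<in> ideal_power R I (Suc (e + N - p * j))" by (rule aw)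
      moreover have "Suc e + N - p * j \<le> Suc (e + N - p * j)" by linarith
      ultimately show "a \<otimes> w \<in> ideal_power R I (Suc e + N - p * j)"
        using ideal_power_antimono[OF I \<open>Suc e + N - p * j \<le> Suc (e + N - p * j)\<close>] by blast
    qed
    then have "s \<otimes> (a \<otimes> r) \<in> weighted_span I p y m (Suc e + N)" using c by (simp add: m_lcomm)
    then show ?thesis unfolding C_def using aw[OF r] s(1) by blast
  qed
  have "\<exists>n0. \<forall>n\<ge>n0. \<forall>k. C n k = C n0 k"
  proof (rule graded_chain_stabilises[OF I C_id])
    show "C n k \<subseteq> ideal_power R I k" for n k unfolding C_def by blast
    show "C n k \<subseteq> C (Suc n) k" for n k
      unfolding C_def using weighted_span_Suc_mono[OF I y] by blast
  qed (rule C_stable)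
  then obtain n0 where n0: "\<And>n k. n \<ge> n0 \<Longrightarrow> C n k = C n0 k" by blast
  \<comment> \<open>The bound \<open>N\<close> makes \<open>e\<close> below an untruncated difference.\<close>
  define m where "m = max n0 N"
  define e where "e = p * Suc m - N"
  have "N \<le> p * Suc m"
  proof -
    have "N \<le> 1 * Suc m" unfolding m_def by simp
    also have "\<dots> \<le> p * Suc m" using p by (intro mult_le_mono1) simp
    finally show ?thesis .
  qed
  then have e: "e + N = p * Suc m" unfolding e_def by simp
  have "q * e + N \<le> p * (q * Suc m)"
  proof -
    have "q * e + N \<le> q * e + q * N" using q by simp
    also have "\<dots> = q * (e + N)" by (simp add: distrib_left)
    finally show ?thesis unfolding e by (simp only: mult.left_commute[of q p])
  qed
  from growth[OF this] obtain s where s: "s \<in> T" "s \<otimes> f [^] (q * Suc m) \<in> ideal_power R I e" by blast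
  have sc: "s \<in> carrier R" using s(1) T(1) by blast
  have fy: "f [^] (q * Suc m) = y [^] Suc m" unfolding y_def by (rule nat_pow_pow[OF f, symmetric])
  have "s \<otimes> (s \<otimes> y [^] Suc m) \<in> weighted_span I p y (Suc m) (e + N)"
  proof -
    have "y [^] Suc m \<otimes> s \<in> weighted_span I p y (Suc m) (p * Suc m)"
      by (rule weighted_span_top[OF I y sc])
    then have "s \<otimes> y [^] Suc m \<in> weighted_span I p y (Suc m) (e + N)"
      unfolding e using m_comm[OF sc nat_pow_closed[OF y]] by (simp only:)
    then show ?thesis by (rule ideal.I_l_closed[OF wid _ sc])
  qed
  then have "s \<otimes> y [^] Suc m \<in> C (Suc m) e"
    unfolding C_def using s fy by auto
  also have "C (Suc m) e = C m e" using n0[of m e] n0[of "Suc m" e] by (simp add: m_def)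
  finally obtain s' where s': "s' \<in> T" "s' \<otimes> (s \<otimes> y [^] Suc m) \<in> weighted_span I p y m (p * Suc m)"
    unfolding C_def e by blast
  define t where "t = s' \<otimes> s"
  have t: "t \<in> T" "t \<in> carrier R" using s(1) s'(1) T by (auto simp: t_def)
  have "t \<otimes> y [^] Suc m \<in> weighted_span I p y m (p * Suc m)"
    using s'(2) sc s'(1) T(1) y unfolding t_def by (auto simp: m_assoc simp del: nat_pow_Suc)
  then obtain a where a: "\<forall>j\<le>m. a j \<in> ideal_power R I (p * Suc m - p * j)"
    and ta: "t \<otimes> y [^] Suc m = (\<Oplus>j\<in>{..m}. y [^] j \<otimes> a j)"
    unfolding weighted_span_def by blast
  have ac: "a j \<in> carrier R" if "j \<le> m" for j using a that ideal.Icarr[OF pid] by blast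
  define z where "z = (t \<otimes> f) [^] q"
  have tq: "t [^] q \<in> carrier R" and z: "z = t [^] q \<otimes> y" and zc: "z \<in> carrier R"
    using t f unfolding z_def y_def by (auto simp: nat_pow_distrib)
  \<comment> \<open>The equation is multiplied by \<open>t^(q * Suc m - 1)\<close>. Since \<open>z^j\<close> uses up the power
    \<open>t^(q * j)\<close>, with \<open>j \<le> m\<close>, the rest goes into the coefficients.\<close>
  define c where "c j = t [^] (q * Suc m - 1 - q * j) \<otimes> a j" for j
  have zj: "z [^] j \<otimes> c j = t [^] (q * Suc m - 1) \<otimes> (y [^] j \<otimes> a j)" if j: "j \<le> m" for j
  proof -
    have "q * j + 1 \<le> q * Suc m"
    proof -
      have "q * j + 1 \<le> q * m + q" using j q by (intro add_mono mult_le_mono2) auto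
      then show ?thesis by simp
    qed
    then have ex: "q * j + (q * Suc m - 1 - q * j) = q * Suc m - 1" by linarith
    have "z [^] j = t [^] (q * j) \<otimes> y [^] j"
      by (simp only: z nat_pow_distrib[OF tq y] nat_pow_pow[OF t(2)])
    then have "z [^] j \<otimes> c j = (t [^] (q * j) \<otimes> t [^] (q * Suc m - 1 - q * j)) \<otimes> (y [^] j \<otimes> a j)"
      unfolding c_def using t(2) y ac[OF j] by (simp add: m_ac)
    then show ?thesis using nat_pow_mult[OF t(2)] ex by simp
  qed
  have "z [^] Suc m = t [^] (q * Suc m) \<otimes> y [^] Suc m"
    by (simp only: z nat_pow_distrib[OF tq y] nat_pow_pow[OF t(2)])
  also have "\<dots> = t [^] (q * Suc m - 1) \<otimes> (t \<otimes> y [^] Suc m)"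
  proof -
    have "t [^] (q * Suc m) = t [^] (q * Suc m - 1) \<otimes> t"
    proof -
      have "q * Suc m = Suc (q * Suc m - 1)" using q by simp
      then show ?thesis using nat_pow_Suc[of t "q * Suc m - 1"] by metis
    qed
    then show ?thesis using t(2) y by (simp add: m_assoc del: nat_pow_Suc)
  qed
  also have "\<dots> = (\<Oplus>j\<in>{..m}. t [^] (q * Suc m - 1) \<otimes> (y [^] j \<otimes> a j))"
    unfolding ta using t(2) ac y by (intro finsum_rdistr) auto
  also have "\<dots> = (\<Oplus>j\<in>{..m}. z [^] j \<otimes> c j)"
    using zj zc t(2) y ac by (intro finsum_cong') auto
  finally have eq: "z [^] Suc m = (\<Oplus>j\<in>{..m}. z [^] j \<otimes> c j)" .
  have "z \<in> integral_closure R (ideal_power R I p)"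
  proof (rule integral_closureI[OF pid zc _ eq])
    fix j assume j: "j \<le> m"
    have "c j \<in> ideal_power R I (p * Suc m - p * j)"
      unfolding c_def using a j t(2) ideal.I_l_closed[OF pid] by blast
    then show "c j \<in> ideal_power R (ideal_power R I p) (Suc m - j)"
      using ideal_power_power[OF I, of p "Suc m - j"] by (simp only: diff_mult_distrib2)
  qed
  then show ?thesis using t(1) unfolding z_def by blast
qed

end

section \<open>Prime avoidance and grade\<close>

context cring
begin

lemma prime_avoids_intersection:
  assumes "finite F" and F: "\<And>A. A \<in> F \<Longrightarrow> ideal A R" "\<And>A. A \<in> F \<Longrightarrow> \<not> A \<subseteq> P"
    and P: "primeideal P R"
  shows "\<exists>s\<in>ideal_Inter R F. s \<notin> P"
  using assms(1) F
proof (induction F rule: finite_induct)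
  case empty
  have "\<one> \<notin> P"
    using ideal.one_imp_carrier[OF primeideal.axioms(1)[OF P]] primeideal.I_notcarr[OF P] by blast
  then show ?case by (auto simp: ideal_Inter_def)
next
  case (insert A F)
  then obtain s where s: "s \<in> ideal_Inter R F" "s \<notin> P" by blast
  obtain a where a: "a \<in> A" "a \<notin> P" using insert.prems by blast
  have A: "ideal A R" using insert.prems by blast
  have c: "s \<in> carrier R" "a \<in> carrier R" using s a ideal.Icarr[OF A] by (auto simp: ideal_Inter_def)
  have "s \<otimes> a \<in> B" if "B \<in> insert A F" for B
    using that s a c ideal.I_l_closed[OF A a(1) c(1)] insert.prems(1) ideal.I_r_closed[of B R s a]
    by (auto simp: ideal_Inter_def)
  then have "s \<otimes> a \<in> ideal_Inter R (insert A F)" using c by (simp add: ideal_Inter_def)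
  moreover have "s \<otimes> a \<notin> P" using primeideal.I_prime[OF P c] s(2) a(2) by blast
  ultimately show ?case by blast
qed

text \<open>If the primes are pairwise incomparable and \<open>x\<close> avoids all of them but \<open>Q\<close>, then the
  intersection of \<open>A\<close> with the primes other than \<open>Q\<close> contains an element \<open>y\<close> outside \<open>Q\<close>, and
  \<open>x + y\<close> avoids all of them.\<close>

lemma prime_avoidance:
  assumes A: "ideal A R" and "finite F" and "\<And>Q. Q \<in> F \<Longrightarrow> primeideal Q R"
    and "\<And>Q. Q \<in> F \<Longrightarrow> \<not> A \<subseteq> Q"
  shows "\<exists>x\<in>A. \<forall>Q\<in>F. x \<notin> Q"
  using assms(2-)
proof (induction F rule: finite_psubset_induct)
  case (psubset F)
  show ?case
  proof (cases "\<exists>Q\<in>F. \<exists>Q'\<in>F. Q' \<subset> Q")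
    case True
    then obtain Q Q' where Q: "Q \<in> F" "Q' \<in> F" "Q' \<subset> Q" by blast
    have "F - {Q'} \<subset> F" using Q by blast
    then obtain x where x: "x \<in> A" "\<forall>Q\<in>F - {Q'}. x \<notin> Q"
      using psubset.IH[of "F - {Q'}"] psubset.prems by blast
    have "x \<notin> Q'" using x(2) Q by blast
    then show ?thesis using x by blast
  next
    case antichain: False
    show ?thesis
    proof (cases "F = {}")
      case True
      then show ?thesis using ideal_zero[OF A] by blast
    next
      case False
      then obtain Q where Q: "Q \<in> F" by blast
      have "F - {Q} \<subset> F" using Q by blast
      then obtain x where x: "x \<in> A" "\<forall>Q'\<in>F - {Q}. x \<notin> Q'"
        using psubset.IH[of "F - {Q}"] psubset.prems by blast
      show ?thesis
      proof (cases "x \<in> Q")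
        case False
        then show ?thesis using x by blast
      next
        case True
        have prime: "primeideal B R" "ideal B R" if "B \<in> F" for B
          using psubset.prems(1)[OF that] primeideal.axioms(1) by blast+
        have "\<exists>y\<in>ideal_Inter R (insert A (F - {Q})). y \<notin> Q"
        proof (rule prime_avoids_intersection)
          show "finite (insert A (F - {Q}))" using psubset.hyps by simp
          show "ideal B R" if "B \<in> insert A (F - {Q})" for B using that A prime(2) by blast
          show "\<not> B \<subseteq> Q" if "B \<in> insert A (F - {Q})" for B
            using that antichain Q psubset.prems(2) by blast
        qed (use Q prime in blast)
        then obtain y where y: "y \<in> A" "\<forall>Q'\<in>F - {Q}. y \<in> Q'" "y \<notin> Q"
          by (auto simp: ideal_Inter_def)
        have c: "x \<in> carrier R" "y \<in> carrier R" using x y ideal.Icarr[OF A] by blast+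
        have "x \<oplus> y \<notin> B" if B: "B \<in> F" for B
        proof (cases "B = Q")
          case True
          show ?thesis
          proof
            assume "x \<oplus> y \<in> B"
            then have "y \<oplus> x \<in> Q" using True c a_comm by simp
            then show False using ideal_add_cancel[OF prime(2)[OF Q] _ \<open>x \<in> Q\<close> c(2)] y(3) by blast
          qed
        next
          case False
          then have "y \<in> B" "x \<notin> B" using x y B by blast+
          then show ?thesis using ideal_add_cancel[OF prime(2)[OF B] _ _ c(1)] by blast
        qed
        then show ?thesis using ideal_add[OF A x(1) y(1)] by blast
      qed
    qed
  qed
qed

lemma set_add_Idl_empty: assumes "ideal J R" shows "J <+>\<^bsub>R\<^esub> Idl {} = J"
proof -
  have "Idl {} = {\<zero>}"
    using genideal_minimal[OF zeroideal, of "{}"] ideal_zero[OF genideal_ideal[of "{}"]] by auto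
  then show ?thesis using ideal.Icarr[OF assms] by (force simp: set_add_def')
qed

lemma grade_quot_ge_1_iff:
  assumes I: "ideal I R" and P: "ideal P R" "P \<noteq> carrier R" and IP: "I \<subseteq> P"
  shows "grade_quot R P I \<ge> 1 \<longleftrightarrow> (\<exists>x\<in>P. regular_on_quot R I x)"
proof
  assume ge: "grade_quot R P I \<ge> 1"
  have "\<exists>xs. set xs \<subseteq> P \<and> regular_sequence_on_quot R I xs \<and> xs \<noteq> []"
  proof (rule ccontr)
    assume "\<not> ?thesis"
    then have "grade_quot R P I \<le> 0" unfolding grade_quot_def by (intro SUP_least) (auto simp: zero_enat_def)
    then show False using ge by simp
  qed
  then obtain x xs where "x \<in> P" "regular_sequence_on_quot R I (x # xs)" by (metis list.set_intros(1) neq_Nil_conv subsetD)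
  then show "\<exists>x\<in>P. regular_on_quot R I x"
    unfolding regular_sequence_on_quot_def by (auto simp: set_add_Idl_empty[OF I] dest: spec[of _ 0])
next
  assume "\<exists>x\<in>P. regular_on_quot R I x"
  then obtain x where x: "x \<in> P" "regular_on_quot R I x" by blast
  have xc: "x \<in> carrier R" using x ideal.Icarr[OF P(1)] by blast
  have "I <+>\<^bsub>R\<^esub> Idl {x} \<subseteq> P"
    using IP genideal_minimal[OF P(1), of "{x}"] x(1) ideal_add[OF P(1)] by (auto simp: set_add_def')
  then have "regular_sequence_on_quot R I [x]"
    unfolding regular_sequence_on_quot_def
    using x xc P ideal_subset[OF P(1)] by (auto simp: set_add_Idl_empty[OF I])
  then have "enat (length [x]) \<le> grade_quot R P I"
    unfolding grade_quot_def using x by (intro SUP_upper) auto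
  then show "grade_quot R P I \<ge> 1" by (simp add: one_enat_def)
qed

end

context noetherian_cring
begin

lemma finite_Ass:
  assumes "ideal I R"
  shows "finite (Ass R I)"
proof (rule finite_subset[OF _ finite_Ass_powers[OF assms]])
  show "Ass R I \<subseteq> (\<Union>n. Ass R (ideal_power R I n))" using ideal_power_1[OF assms] by (metis UNIV_I UN_upper)
qed

text \<open>The zero-divisors on \<open>R/I\<close> are the elements of the associated primes of \<open>I\<close>. These are finite in
  number, so by prime avoidance an ideal of zero-divisors is contained in one of them.\<close>

lemma contains_regular_iff:
  assumes I: "ideal I R" and P: "ideal P R"
  shows "(\<exists>x\<in>P. regular_on_quot R I x) \<longleftrightarrow> \<not> (\<exists>Q\<in>Ass R I. P \<subseteq> Q)"
proof
  assume "\<exists>x\<in>P. regular_on_quot R I x"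
  then obtain x where x: "x \<in> P" "regular_on_quot R I x" by blast
  show "\<not> (\<exists>Q\<in>Ass R I. P \<subseteq> Q)"
  proof
    assume "\<exists>Q\<in>Ass R I. P \<subseteq> Q"
    then obtain Q z where Q: "primeideal Q R" "P \<subseteq> Q" and z: "z \<in> carrier R" "Q = ideal_colon R I {z}"
      using Ass_iff[OF I] by blast
    have "x \<otimes> z \<in> I" using x Q z by auto
    then have "z \<in> I" using x(2) z(1) regular_on_quot_iff[OF I] by blast
    then have "Q = carrier R" using z ideal.I_l_closed[OF I] by (auto simp: ideal_colon_def)
    then show False using primeideal.I_notcarr[OF Q(1)] by simp
  qed
next
  assume nsub: "\<not> (\<exists>Q\<in>Ass R I. P \<subseteq> Q)"
  have "\<exists>x\<in>P. \<forall>Q\<in>Ass R I. x \<notin> Q"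
    by (rule prime_avoidance[OF P finite_Ass[OF I] Ass_prime]) (use nsub in blast)+
  then obtain x where x: "x \<in> P" "\<forall>Q\<in>Ass R I. x \<notin> Q" by blast
  have xc: "x \<in> carrier R" using x ideal.Icarr[OF P] by blast
  have "z \<in> I" if z: "z \<in> carrier R" "x \<otimes> z \<in> I" for z
  proof (rule ccontr)
    assume "z \<notin> I"
    then obtain Q where "Q \<in> Ass R I" "ideal_colon R I {z} \<subseteq> Q"
      using associated_prime_avoiding[OF I z(1), of "{\<one>}"] z(1) by auto
    then show False using x(2) xc z by auto
  qed
  then show "\<exists>x\<in>P. regular_on_quot R I x" using x xc regular_on_quot_iff[OF I] by blast
qed

end

section \<open>Contraction from the localization at a prime\<close>

locale prime_localization = cring R + P: primeideal P R for R (structure) and P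
begin

abbreviation S where "S \<equiv> carrier R - P"

lemma S_mult: "s \<in> S \<Longrightarrow> t \<in> S \<Longrightarrow> s \<otimes> t \<in> S"
  using P.I_prime by auto

lemma S_one: "\<one> \<in> S"
  using P.one_imp_carrier P.I_notcarr by blast

abbreviation frac where "frac \<equiv> loc_frac R P"

lemma loc_rel_iff:
  "((a, s), (b, t)) \<in> loc_rel R P \<longleftrightarrow> a \<in> carrier R \<and> s \<in> S \<and> b \<in> carrier R \<and> t \<in> S \<and>
     (\<exists>w\<in>S. w \<otimes> (t \<otimes> a) = w \<otimes> (s \<otimes> b))"
  by (simp add: loc_rel_def)

lemma equiv_loc_rel: "equiv (carrier R \<times> S) (loc_rel R P)"
proof (rule equivI)
  show "loc_rel R P \<subseteq> (carrier R \<times> S) \<times> carrier R \<times> S" by (auto simp: loc_rel_def)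
  show "refl_on (carrier R \<times> S) (loc_rel R P)"
    by (intro refl_onI) (use S_one in \<open>auto simp: loc_rel_def\<close>)
  show "sym (loc_rel R P)"
    by (intro symI) (auto simp: loc_rel_def intro: sym)
  show "trans (loc_rel R P)"
  proof (rule transI)
    fix x y z assume xy: "(x, y) \<in> loc_rel R P" and yz: "(y, z) \<in> loc_rel R P"
    obtain a s b t c u where e: "x = (a, s)" "y = (b, t)" "z = (c, u)" by (metis surj_pair)
    obtain v where v: "v \<in> S" "v \<otimes> (t \<otimes> a) = v \<otimes> (s \<otimes> b)" and 1: "a \<in> carrier R" "s \<in> S" "b \<in> carrier R" "t \<in> S"
      using xy unfolding e loc_rel_iff by blast
    obtain w where w: "w \<in> S" "w \<otimes> (u \<otimes> b) = w \<otimes> (t \<otimes> c)" and 2: "c \<in> carrier R" "u \<in> S"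
      using yz unfolding e loc_rel_iff by blast
    have c: "a \<in> carrier R" "s \<in> carrier R" "b \<in> carrier R" "t \<in> carrier R" "c \<in> carrier R"
      "u \<in> carrier R" "v \<in> carrier R" "w \<in> carrier R" using 1 2 v w by blast+
    have "(v \<otimes> w \<otimes> t) \<otimes> (u \<otimes> a) = (w \<otimes> u) \<otimes> (v \<otimes> (t \<otimes> a))" using c by algebra
    also have "\<dots> = (v \<otimes> s) \<otimes> (w \<otimes> (u \<otimes> b))" unfolding v(2) using c by algebra
    also have "\<dots> = (v \<otimes> w \<otimes> t) \<otimes> (s \<otimes> c)" unfolding w(2) using c by algebra
    finally have "(v \<otimes> w \<otimes> t) \<otimes> (u \<otimes> a) = (v \<otimes> w \<otimes> t) \<otimes> (s \<otimes> c)" .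
    then show "(x, z) \<in> loc_rel R P"
      unfolding e loc_rel_iff using S_mult[OF S_mult[OF v(1) w(1)] 1(4)] 1 2 by blast
  qed
qed

lemma frac_eq_iff:
  assumes "a \<in> carrier R" "s \<in> S" "b \<in> carrier R" "t \<in> S"
  shows "frac a s = frac b t \<longleftrightarrow> (\<exists>w\<in>S. w \<otimes> (t \<otimes> a) = w \<otimes> (s \<otimes> b))"
  unfolding loc_frac_def
  using eq_equiv_class_iff[OF equiv_loc_rel, of "(a, s)" "(b, t)"] assms loc_rel_iff[of a s b t] by auto

lemma frac_eqI:
  assumes "a \<in> carrier R" "s \<in> S" "b \<in> carrier R" "t \<in> S" "t \<otimes> a = s \<otimes> b"
  shows "frac a s = frac b t"
  using frac_eq_iff[OF assms(1-4)] assms(5) S_one by auto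

lemma frac_carrier: "a \<in> carrier R \<Longrightarrow> s \<in> S \<Longrightarrow> frac a s \<in> carrier (localization R P)"
  by (auto simp: localization_def loc_frac_def intro!: quotientI)

lemma localization_cases:
  assumes "A \<in> carrier (localization R P)"
  obtains a s where "a \<in> carrier R" "s \<in> S" "A = frac a s"
  using assms by (auto simp: localization_def loc_frac_def elim!: quotientE)

lemma frac_mult:
  assumes "a \<in> carrier R" "s \<in> S" "b \<in> carrier R" "t \<in> S"
  shows "frac a s \<otimes>\<^bsub>localization R P\<^esub> frac b t = frac (a \<otimes> b) (s \<otimes> t)"
proof -
  let ?f = "\<lambda>x y. case x of (a, s) \<Rightarrow> case y of (b, t) \<Rightarrow> frac (a \<otimes> b) (s \<otimes> t)"
  have "congruent2 (loc_rel R P) (loc_rel R P) ?f"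
  proof (rule congruent2I')
    fix x x' y y' assume "(x, x') \<in> loc_rel R P" and "(y, y') \<in> loc_rel R P"
    moreover obtain a s a' s' b t b' t' where e: "x = (a, s)" "x' = (a', s')" "y = (b, t)" "y' = (b', t')"
      by (metis surj_pair)
    ultimately obtain v w where v: "v \<in> S" "v \<otimes> (s' \<otimes> a) = v \<otimes> (s \<otimes> a')"
      and w: "w \<in> S" "w \<otimes> (t' \<otimes> b) = w \<otimes> (t \<otimes> b')"
      and m: "a \<in> carrier R" "s \<in> S" "a' \<in> carrier R" "s' \<in> S" "b \<in> carrier R" "t \<in> S" "b' \<in> carrier R" "t' \<in> S"
      unfolding e loc_rel_iff by blast
    have c: "s \<in> carrier R" "s' \<in> carrier R" "t \<in> carrier R" "t' \<in> carrier R" "v \<in> carrier R" "w \<in> carrier R"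
      using m v w by blast+
    have "(v \<otimes> w) \<otimes> ((s' \<otimes> t') \<otimes> (a \<otimes> b)) = (v \<otimes> (s' \<otimes> a)) \<otimes> (w \<otimes> (t' \<otimes> b))"
      using m(1,3,5,7) c by algebra
    also have "\<dots> = (v \<otimes> w) \<otimes> ((s \<otimes> t) \<otimes> (a' \<otimes> b'))"
      unfolding v(2) w(2) using m(1,3,5,7) c by algebra
    finally have "frac (a \<otimes> b) (s \<otimes> t) = frac (a' \<otimes> b') (s' \<otimes> t')"
      using frac_eq_iff[of "a \<otimes> b" "s \<otimes> t" "a' \<otimes> b'" "s' \<otimes> t'"] m S_mult v(1) w(1) by blast
    then show "?f x y = ?f x' y'" unfolding e by simp
  qed
  from UN_equiv_class2[OF equiv_loc_rel equiv_loc_rel this, of "(a, s)" "(b, t)"]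
  show ?thesis using assms by (simp add: localization_def loc_frac_def case_prod_unfold)
qed

lemma frac_add:
  assumes "a \<in> carrier R" "s \<in> S" "b \<in> carrier R" "t \<in> S"
  shows "frac a s \<oplus>\<^bsub>localization R P\<^esub> frac b t = frac (t \<otimes> a \<oplus> s \<otimes> b) (s \<otimes> t)"
proof -
  let ?f = "\<lambda>x y. case x of (a, s) \<Rightarrow> case y of (b, t) \<Rightarrow> frac (t \<otimes> a \<oplus> s \<otimes> b) (s \<otimes> t)"
  have "congruent2 (loc_rel R P) (loc_rel R P) ?f"
  proof (rule congruent2I')
    fix x x' y y' assume "(x, x') \<in> loc_rel R P" and "(y, y') \<in> loc_rel R P"
    moreover obtain a s a' s' b t b' t' where e: "x = (a, s)" "x' = (a', s')" "y = (b, t)" "y' = (b', t')"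
      by (metis surj_pair)
    ultimately obtain v w where v: "v \<in> S" "v \<otimes> (s' \<otimes> a) = v \<otimes> (s \<otimes> a')"
      and w: "w \<in> S" "w \<otimes> (t' \<otimes> b) = w \<otimes> (t \<otimes> b')"
      and m: "a \<in> carrier R" "s \<in> S" "a' \<in> carrier R" "s' \<in> S" "b \<in> carrier R" "t \<in> S" "b' \<in> carrier R" "t' \<in> S"
      unfolding e loc_rel_iff by blast
    have c: "s \<in> carrier R" "s' \<in> carrier R" "t \<in> carrier R" "t' \<in> carrier R" "v \<in> carrier R" "w \<in> carrier R"
      using m v w by blast+
    have "(v \<otimes> w) \<otimes> ((s' \<otimes> t') \<otimes> (t \<otimes> a \<oplus> s \<otimes> b)) =
        (w \<otimes> t \<otimes> t') \<otimes> (v \<otimes> (s' \<otimes> a)) \<oplus> (v \<otimes> s \<otimes> s') \<otimes> (w \<otimes> (t' \<otimes> b))"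
      using m(1,3,5,7) c by algebra
    also have "\<dots> = (v \<otimes> w) \<otimes> ((s \<otimes> t) \<otimes> (t' \<otimes> a' \<oplus> s' \<otimes> b'))"
      unfolding v(2) w(2) using m(1,3,5,7) c by algebra
    finally have "(v \<otimes> w) \<otimes> ((s' \<otimes> t') \<otimes> (t \<otimes> a \<oplus> s \<otimes> b)) = (v \<otimes> w) \<otimes> ((s \<otimes> t) \<otimes> (t' \<otimes> a' \<oplus> s' \<otimes> b'))" .
    then have "frac (t \<otimes> a \<oplus> s \<otimes> b) (s \<otimes> t) = frac (t' \<otimes> a' \<oplus> s' \<otimes> b') (s' \<otimes> t')"
      using frac_eq_iff[of "t \<otimes> a \<oplus> s \<otimes> b" "s \<otimes> t" "t' \<otimes> a' \<oplus> s' \<otimes> b'" "s' \<otimes> t'"]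
        m c S_mult[OF v(1) w(1)] S_mult[OF m(2,6)] S_mult[OF m(4,8)] by blast
    then show "?f x y = ?f x' y'" unfolding e by simp
  qed
  from UN_equiv_class2[OF equiv_loc_rel equiv_loc_rel this, of "(a, s)" "(b, t)"]
  show ?thesis using assms by (simp add: localization_def loc_frac_def case_prod_unfold)
qed

lemma one_localization: "\<one>\<^bsub>localization R P\<^esub> = frac \<one> \<one>"
  and zero_localization: "\<zero>\<^bsub>localization R P\<^esub> = frac \<zero> \<one>"
  by (simp_all add: localization_def)

text \<open>This is what makes the extension of an ideal meaningful: a generated ideal is an intersection
  over all ideals, and a set is an ideal only of a structure that is a ring.\<close>

lemma ring_localization: "ring (localization R P)"
proof (rule ringI)
  show "abelian_group (localization R P)"
  proof (rule abelian_groupI)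
    fix x assume "x \<in> carrier (localization R P)"
    then obtain a s where a: "a \<in> carrier R" and s: "s \<in> S" and x: "x = frac a s"
      by (rule localization_cases)
    have sc: "s \<in> carrier R" using s by blast
    show "\<zero>\<^bsub>localization R P\<^esub> \<oplus>\<^bsub>localization R P\<^esub> x = x"
      unfolding x zero_localization using a s sc S_one by (simp add: frac_add)
    have "frac (\<ominus> a) s \<oplus>\<^bsub>localization R P\<^esub> x = frac (s \<otimes> \<ominus> a \<oplus> s \<otimes> a) (s \<otimes> s)"
      unfolding x using a s by (intro frac_add) auto
    also have "\<dots> = frac \<zero> \<one>"
    proof (rule frac_eqI)
      show "\<one> \<otimes> (s \<otimes> \<ominus> a \<oplus> s \<otimes> a) = (s \<otimes> s) \<otimes> \<zero>" using a sc by algebra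
    qed (use a s sc S_mult S_one in auto)
    finally show "\<exists>y\<in>carrier (localization R P). y \<oplus>\<^bsub>localization R P\<^esub> x = \<zero>\<^bsub>localization R P\<^esub>"
      unfolding zero_localization using frac_carrier[of "\<ominus> a" s] a s by blast
    fix y assume "y \<in> carrier (localization R P)"
    then obtain b t where b: "b \<in> carrier R" and t: "t \<in> S" and y: "y = frac b t"
      by (rule localization_cases)
    have tc: "t \<in> carrier R" using t by blast
    show "x \<oplus>\<^bsub>localization R P\<^esub> y \<in> carrier (localization R P)"
      unfolding x y frac_add[OF a s b t] using a b sc tc S_mult[OF s t] by (intro frac_carrier) auto
    have "t \<otimes> a \<oplus> s \<otimes> b = s \<otimes> b \<oplus> t \<otimes> a" "s \<otimes> t = t \<otimes> s" using a b sc tc by algebra+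
    then show "x \<oplus>\<^bsub>localization R P\<^esub> y = y \<oplus>\<^bsub>localization R P\<^esub> x"
      unfolding x y frac_add[OF a s b t] frac_add[OF b t a s] by simp
    fix z assume "z \<in> carrier (localization R P)"
    then obtain c u where c: "c \<in> carrier R" and u: "u \<in> S" and z: "z = frac c u"
      by (rule localization_cases)
    have uc: "u \<in> carrier R" using u by blast
    have m: "t \<otimes> a \<oplus> s \<otimes> b \<in> carrier R" "u \<otimes> b \<oplus> t \<otimes> c \<in> carrier R" using a b c sc tc uc by auto
    have "u \<otimes> (t \<otimes> a \<oplus> s \<otimes> b) \<oplus> (s \<otimes> t) \<otimes> c = (t \<otimes> u) \<otimes> a \<oplus> s \<otimes> (u \<otimes> b \<oplus> t \<otimes> c)"
      "(s \<otimes> t) \<otimes> u = s \<otimes> (t \<otimes> u)" using a b c sc tc uc by algebra+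
    then show "x \<oplus>\<^bsub>localization R P\<^esub> y \<oplus>\<^bsub>localization R P\<^esub> z = x \<oplus>\<^bsub>localization R P\<^esub> (y \<oplus>\<^bsub>localization R P\<^esub> z)"
      unfolding x y z frac_add[OF a s b t] frac_add[OF b t c u]
        frac_add[OF m(1) S_mult[OF s t] c u] frac_add[OF a s m(2) S_mult[OF t u]] by simp
  qed (use S_one in \<open>simp add: zero_localization frac_carrier\<close>)
  show "monoid (localization R P)"
  proof (rule monoidI)
    fix x assume "x \<in> carrier (localization R P)"
    then obtain a s where a: "a \<in> carrier R" and s: "s \<in> S" and x: "x = frac a s"
      by (rule localization_cases)
    have sc: "s \<in> carrier R" using s by blast
    show "\<one>\<^bsub>localization R P\<^esub> \<otimes>\<^bsub>localization R P\<^esub> x = x" "x \<otimes>\<^bsub>localization R P\<^esub> \<one>\<^bsub>localization R P\<^esub> = x"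
      unfolding x one_localization using a s sc S_one by (simp_all add: frac_mult)
    fix y assume "y \<in> carrier (localization R P)"
    then obtain b t where b: "b \<in> carrier R" and t: "t \<in> S" and y: "y = frac b t"
      by (rule localization_cases)
    have ab: "a \<otimes> b \<in> carrier R" using a b by simp
    show "x \<otimes>\<^bsub>localization R P\<^esub> y \<in> carrier (localization R P)"
      unfolding x y frac_mult[OF a s b t] by (rule frac_carrier[OF ab S_mult[OF s t]])
    fix z assume "z \<in> carrier (localization R P)"
    then obtain c u where c: "c \<in> carrier R" and u: "u \<in> S" and z: "z = frac c u"
      by (rule localization_cases)
    have bc: "b \<otimes> c \<in> carrier R" using b c by simp
    show "x \<otimes>\<^bsub>localization R P\<^esub> y \<otimes>\<^bsub>localization R P\<^esub> z = x \<otimes>\<^bsub>localization R P\<^esub> (y \<otimes>\<^bsub>localization R P\<^esub> z)"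
      unfolding x y z frac_mult[OF a s b t] frac_mult[OF b t c u]
        frac_mult[OF ab S_mult[OF s t] c u] frac_mult[OF a s bc S_mult[OF t u]]
      using a b c s t u by (simp add: m_assoc)
  qed (use S_one in \<open>simp add: one_localization frac_carrier\<close>)
  fix x y z assume "x \<in> carrier (localization R P)" "y \<in> carrier (localization R P)" "z \<in> carrier (localization R P)"
  then obtain a s b t c u where a: "a \<in> carrier R" and s: "s \<in> S" and x: "x = frac a s"
    and b: "b \<in> carrier R" and t: "t \<in> S" and y: "y = frac b t"
    and c: "c \<in> carrier R" and u: "u \<in> S" and z: "z = frac c u"
    by (metis localization_cases)
  have cr: "s \<in> carrier R" "t \<in> carrier R" "u \<in> carrier R" using s t u by blast+
  have m: "t \<otimes> a \<oplus> s \<otimes> b \<in> carrier R" "a \<otimes> c \<in> carrier R" "b \<otimes> c \<in> carrier R"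
    "c \<otimes> a \<in> carrier R" "c \<otimes> b \<in> carrier R" using a b c cr by auto
  show "(x \<oplus>\<^bsub>localization R P\<^esub> y) \<otimes>\<^bsub>localization R P\<^esub> z =
      x \<otimes>\<^bsub>localization R P\<^esub> z \<oplus>\<^bsub>localization R P\<^esub> y \<otimes>\<^bsub>localization R P\<^esub> z"
    unfolding x y z frac_add[OF a s b t] frac_mult[OF m(1) S_mult[OF s t] c u] frac_mult[OF a s c u]
      frac_mult[OF b t c u] frac_add[OF m(2) S_mult[OF s u] m(3) S_mult[OF t u]]
  proof (rule frac_eqI)
    show "(s \<otimes> u \<otimes> (t \<otimes> u)) \<otimes> ((t \<otimes> a \<oplus> s \<otimes> b) \<otimes> c) =
        (s \<otimes> t \<otimes> u) \<otimes> (t \<otimes> u \<otimes> (a \<otimes> c) \<oplus> s \<otimes> u \<otimes> (b \<otimes> c))" using a b c cr by algebra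
  qed (use a b c cr s t u S_mult in auto)
  show "z \<otimes>\<^bsub>localization R P\<^esub> (x \<oplus>\<^bsub>localization R P\<^esub> y) =
      z \<otimes>\<^bsub>localization R P\<^esub> x \<oplus>\<^bsub>localization R P\<^esub> z \<otimes>\<^bsub>localization R P\<^esub> y"
    unfolding x y z frac_add[OF a s b t] frac_mult[OF c u m(1) S_mult[OF s t]] frac_mult[OF c u a s]
      frac_mult[OF c u b t] frac_add[OF m(4) S_mult[OF u s] m(5) S_mult[OF u t]]
  proof (rule frac_eqI)
    show "(u \<otimes> s \<otimes> (u \<otimes> t)) \<otimes> (c \<otimes> (t \<otimes> a \<oplus> s \<otimes> b)) =
        (u \<otimes> (s \<otimes> t)) \<otimes> (u \<otimes> t \<otimes> (c \<otimes> a) \<oplus> u \<otimes> s \<otimes> (c \<otimes> b))" using a b c cr by algebra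
  qed (use a b c cr s t u S_mult in auto)
qed

text \<open>The fractions with numerator in \<open>J\<close> form an ideal that contains the image of \<open>J\<close>, so the
  extension of \<open>J\<close> consists of such fractions.\<close>

lemma loc_contraction_iff:
  assumes J: "ideal J R"
  shows "r \<in> loc_contraction R P J \<longleftrightarrow> r \<in> carrier R \<and> (\<exists>s\<in>S. s \<otimes> r \<in> J)"
proof (cases "r \<in> carrier R")
  case r: True
  interpret L: ring "localization R P" by (rule ring_localization)
  define E where "E = {frac a s | a s. a \<in> J \<and> s \<in> S}"
  note Jc = ideal.Icarr[OF J]
  have sub: "loc_map R P ` J \<subseteq> carrier (localization R P)"
    using Jc S_one by (auto simp: loc_map_def intro!: frac_carrier)
  have E: "ideal E (localization R P)"
  proof (rule idealI[OF ring_localization])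
    show "subgroup E (add_monoid (localization R P))"
    proof (rule L.add.subgroupI)
      show "E \<subseteq> carrier (localization R P)" unfolding E_def using frac_carrier Jc by blast
      show "E \<noteq> {}" unfolding E_def using ideal_zero[OF J] S_one by blast
      fix x assume "x \<in> E"
      then obtain a s where x: "x = frac a s" "a \<in> J" "s \<in> S" unfolding E_def by blast
      have c: "a \<in> carrier R" "s \<in> carrier R" using x Jc by blast+
      have "frac (\<ominus> a) s \<oplus>\<^bsub>localization R P\<^esub> x = frac (s \<otimes> \<ominus> a \<oplus> s \<otimes> a) (s \<otimes> s)"
        unfolding x using c x by (intro frac_add) auto
      also have "\<dots> = frac \<zero> \<one>"
      proof (rule frac_eqI)
        show "\<one> \<otimes> (s \<otimes> \<ominus> a \<oplus> s \<otimes> a) = (s \<otimes> s) \<otimes> \<zero>" using c by algebra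
      qed (use c x S_mult S_one in auto)
      finally have "\<ominus>\<^bsub>localization R P\<^esub> x = frac (\<ominus> a) s"
        using L.minus_equality[of "frac (\<ominus> a) s" x] c x frac_carrier by (simp add: zero_localization)
      then show "\<ominus>\<^bsub>localization R P\<^esub> x \<in> E" unfolding E_def using ideal_neg[OF J x(2)] x(3) by blast
      fix y assume "y \<in> E"
      then obtain b t where y: "y = frac b t" "b \<in> J" "t \<in> S" unfolding E_def by blast
      have d: "b \<in> carrier R" "t \<in> carrier R" using y Jc by blast+
      have "t \<otimes> a \<oplus> s \<otimes> b \<in> J"
        using ideal_add[OF J] ideal.I_l_closed[OF J] x(2) y(2) c(2) d(2) by blast
      then show "x \<oplus>\<^bsub>localization R P\<^esub> y \<in> E"
        unfolding x(1) y(1) frac_add[OF c(1) x(3) d(1) y(3)] E_def using S_mult[OF x(3) y(3)] by blast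
    qed
    fix x z assume "x \<in> E" and "z \<in> carrier (localization R P)"
    then obtain a s c u where x: "x = frac a s" "a \<in> J" "s \<in> S" and z: "c \<in> carrier R" "u \<in> S" "z = frac c u"
      unfolding E_def by (auto elim!: localization_cases)
    show "z \<otimes>\<^bsub>localization R P\<^esub> x \<in> E"
      unfolding x(1) z(3) frac_mult[OF z(1,2) Jc[OF x(2)] x(3)] E_def
      using ideal.I_l_closed[OF J x(2) z(1)] S_mult[OF z(2) x(3)] by blast
    show "x \<otimes>\<^bsub>localization R P\<^esub> z \<in> E"
      unfolding x(1) z(3) frac_mult[OF Jc[OF x(2)] x(3) z(1,2)] E_def
      using ideal.I_r_closed[OF J x(2) z(1)] S_mult[OF x(3) z(2)] by blast
  qed
  have "loc_map R P ` J \<subseteq> E" using S_one unfolding E_def loc_map_def by blast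
  then have le: "Idl\<^bsub>localization R P\<^esub> (loc_map R P ` J) \<subseteq> E" by (rule L.genideal_minimal[OF E])
  show ?thesis
  proof
    assume "r \<in> loc_contraction R P J"
    then have "frac r \<one> \<in> E" using le by (auto simp: loc_contraction_def loc_map_def)
    then obtain a s where a: "a \<in> J" and s: "s \<in> S" and "frac r \<one> = frac a s" unfolding E_def by blast
    then obtain w where w: "w \<in> S" "w \<otimes> (s \<otimes> r) = w \<otimes> (\<one> \<otimes> a)"
      using frac_eq_iff[OF r S_one Jc[OF a] s] by blast
    have c: "w \<in> carrier R" "s \<in> carrier R" using w s by blast+
    have "(w \<otimes> s) \<otimes> r = w \<otimes> a" using w(2) c r Jc[OF a] by (simp add: m_assoc)
    then have "(w \<otimes> s) \<otimes> r \<in> J" using ideal.I_l_closed[OF J a c(1)] by simp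
    then show "r \<in> carrier R \<and> (\<exists>s\<in>S. s \<otimes> r \<in> J)" using r S_mult[OF w(1) s] by blast
  next
    assume "r \<in> carrier R \<and> (\<exists>s\<in>S. s \<otimes> r \<in> J)"
    then obtain s where s: "s \<in> S" "s \<otimes> r \<in> J" by blast
    have sc: "s \<in> carrier R" using s by blast
    have "loc_map R P (s \<otimes> r) \<in> Idl\<^bsub>localization R P\<^esub> (loc_map R P ` J)"
      using L.genideal_self[OF sub] s(2) by blast
    then have "frac \<one> s \<otimes>\<^bsub>localization R P\<^esub> frac (s \<otimes> r) \<one> \<in> Idl\<^bsub>localization R P\<^esub> (loc_map R P ` J)"
      using ideal.I_l_closed[OF L.genideal_ideal[OF sub]] frac_carrier[OF one_closed s(1)]
      by (simp add: loc_map_def)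
    also have "frac \<one> s \<otimes>\<^bsub>localization R P\<^esub> frac (s \<otimes> r) \<one> = frac (\<one> \<otimes> (s \<otimes> r)) (s \<otimes> \<one>)"
      using s sc r S_one by (intro frac_mult) auto
    also have "\<dots> = frac r \<one>"
      using s sc r S_one by (intro frac_eqI) auto
    finally show "r \<in> loc_contraction R P J" using r by (simp add: loc_contraction_def loc_map_def)
  qed
qed (simp add: loc_contraction_def)

end

section \<open>Rational powers and their symbolic and saturated versions\<close>

context noetherian_cring
begin

lemma quotient_of_pos:
  assumes "u > 0" "quotient_of u = (a, b)"
  shows "nat a > 0" "nat b > 0"
proof -
  have b: "b > 0" using assms(2) by (rule quotient_of_denom_pos)
  have "u = of_int a / of_int b" using assms(2) by (rule quotient_of_div)
  then have "a > 0" using assms(1) b by (simp add: zero_less_divide_iff)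
  then show "nat a > 0" "nat b > 0" using b by simp_all
qed

text \<open>From left to right, \<open>k\<close> is rounded down to a multiple of \<open>q\<close>. From right to left, this is
  \<open>local_growth_imp_integral\<close> for the trivial set of denominators \<open>T = {1}\<close>.\<close>

lemma integral_power_iff_growth:
  assumes I: "ideal I R" and f: "f \<in> carrier R" and p: "p > 0" and q: "q > 0"
  shows "f [^] q \<in> integral_closure R (ideal_power R I p) \<longleftrightarrow> power_growth I p q (PIdl f)"
proof
  note pid = ideal_ideal_power[OF I]
  assume "f [^] q \<in> integral_closure R (ideal_power R I p)"
  then obtain n where n: "\<And>k. (f [^] q) [^] k \<in> ideal_power R (ideal_power R I p) (k - n)"
    using integral_imp_growth[OF pid] by blast
  \<comment> \<open>The lag \<open>n\<close> costs \<open>p * n\<close> in the exponent of \<open>I\<close>, the rounding of \<open>k\<close> to a multiple of \<open>q\<close>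
    costs at most \<open>p\<close>.\<close>
  have "f [^] k \<in> ideal_power R I m" if km: "q * m + q * (p * n + p) \<le> p * k" for k m
  proof -
    define k' where "k' = k div q"
    have k: "k = q * k' + k mod q" by (simp add: k'_def)
    have "p * k \<le> p * (q * k' + q)" using k mod_less_divisor[OF q, of k] by (intro mult_le_mono2) linarith
    also have "\<dots> = q * (p * k' + p)" by (simp only: distrib_left mult.left_commute[of p q] mult.commute[of p q])
    finally have "q * (m + (p * n + p)) \<le> q * (p * k' + p)" using km by (simp only: distrib_left)
    then have "m + (p * n + p) \<le> p * k' + p" using q by simp
    then have m: "m \<le> p * (k' - n)" by (simp add: diff_mult_distrib2)
    have "(f [^] q) [^] k' \<in> ideal_power R I (p * (k' - n))"
      using n[of k'] ideal_power_power[OF I] by simp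
    then have "f [^] (q * k') \<in> ideal_power R I m"
      using ideal_power_antimono[OF I m] nat_pow_pow[OF f] by auto
    then have "f [^] (q * k') \<otimes> f [^] (k mod q) \<in> ideal_power R I m"
      using f by (intro ideal.I_r_closed[OF pid]) auto
    then show ?thesis using nat_pow_mult[OF f, of "q * k'" "k mod q"] k by metis
  qed
  then show "power_growth I p q (PIdl f)" unfolding power_growth_principal[OF I f] by blast
next
  assume "power_growth I p q (PIdl f)"
  then obtain N where N: "\<And>k m. q * m + N \<le> p * k \<Longrightarrow> f [^] k \<in> ideal_power R I m"
    unfolding power_growth_principal[OF I f] by blast
  have "\<exists>s\<in>{\<one>}. (s \<otimes> f) [^] q \<in> integral_closure R (ideal_power R I p)"
  proof (rule local_growth_imp_integral[OF I f p q])
    fix k m assume "q * m + N \<le> p * k"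
    then have "f [^] k \<in> ideal_power R I m" by (rule N)
    then show "\<exists>s\<in>{\<one>}. s \<otimes> f [^] k \<in> ideal_power R I m" using f by simp
  qed auto
  then show "f [^] q \<in> integral_closure R (ideal_power R I p)" using f by simp
qed

lemma rational_power_eq_growth:
  assumes I: "ideal I R" and u: "u > 0"
  obtains p q :: nat where "p > 0" "q > 0"
    "rational_power R I u = {f \<in> carrier R. power_growth I p q (PIdl f)}"
    "rational_power R I u = {f \<in> carrier R. f [^] q \<in> integral_closure R (ideal_power R I p)}"
proof -
  obtain a b where ab: "quotient_of u = (a, b)" by (metis surj_pair)
  note pos = quotient_of_pos[OF u ab]
  have "rational_power R I u = {f \<in> carrier R. f [^] nat b \<in> integral_closure R (ideal_power R I (nat a))}"
    by (simp add: rational_power_def ab)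
  moreover have "\<dots> = {f \<in> carrier R. power_growth I (nat a) (nat b) (PIdl f)}"
    using integral_power_iff_growth[OF I _ pos] by blast
  ultimately show ?thesis using that[OF pos] by simp
qed

lemma power_growth_zero:
  assumes I: "ideal I R" and q: "q > 0"
  shows "power_growth I p q (PIdl \<zero>)"
proof -
  have "\<zero> [^] k \<in> ideal_power R I m" if "q * m + 0 \<le> p * k" for k m
  proof (cases "k = 0")
    case True
    then have "m = 0" using that q by simp
    then show ?thesis by simp
  next
    case False
    then show ?thesis using ideal_zero[OF ideal_ideal_power[OF I]] by (simp add: nat_pow_zero)
  qed
  then show ?thesis unfolding power_growth_principal[OF I zero_closed] by blast
qed

lemma ideal_rational_power:
  assumes I: "ideal I R" and u: "u > 0"
  shows "ideal (rational_power R I u) R"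
proof -
  obtain p q :: nat where q: "q > 0"
    and J: "rational_power R I u = {f \<in> carrier R. power_growth I p q (PIdl f)}"
    using rational_power_eq_growth[OF I u] by metis
  show ?thesis
    unfolding J
  proof (rule idealI_elem)
    show "\<zero> \<in> {f \<in> carrier R. power_growth I p q (PIdl f)}" using power_growth_zero[OF I q] by simp
    fix f assume f: "f \<in> {f \<in> carrier R. power_growth I p q (PIdl f)}"
    then have fi: "ideal (PIdl f) R" and fc: "f \<in> carrier R" by (auto intro: cgenideal_ideal)
    { fix g assume g: "g \<in> {f \<in> carrier R. power_growth I p q (PIdl f)}"
      then have gi: "ideal (PIdl g) R" and gc: "g \<in> carrier R" by (auto intro: cgenideal_ideal)
      have sum: "power_growth I p q (PIdl f <+>\<^bsub>R\<^esub> PIdl g)"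
        using power_growth_sum[OF I fi _ gi _ q] f g by blast
      have "f \<oplus> g \<in> PIdl f <+>\<^bsub>R\<^esub> PIdl g"
        using cgenideal_self[OF fc] cgenideal_self[OF gc] by (auto simp: set_add_def')
      then have "PIdl (f \<oplus> g) \<subseteq> PIdl f <+>\<^bsub>R\<^esub> PIdl g"
        by (rule cgenideal_minimal[OF add_ideals[OF fi gi]])
      then have "power_growth I p q (PIdl (f \<oplus> g))"
        using power_growth_subset[OF cgenideal_ideal[OF a_closed[OF fc gc]] add_ideals[OF fi gi] _ sum] by blast
      then show "f \<oplus> g \<in> {f \<in> carrier R. power_growth I p q (PIdl f)}" using fc gc by simp }
    fix x assume x: "x \<in> carrier R"
    have "PIdl (x \<otimes> f) \<subseteq> PIdl f"
      by (rule cgenideal_minimal[OF fi ideal.I_l_closed[OF fi cgenideal_self[OF fc] x]])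
    then have "power_growth I p q (PIdl (x \<otimes> f))"
      using power_growth_subset[OF cgenideal_ideal[OF m_closed[OF x fc]] fi] f by blast
    then show "x \<otimes> f \<in> {f \<in> carrier R. power_growth I p q (PIdl f)}" using x fc by simp
  qed auto
qed

lemma rational_power_contains_power:
  assumes I: "ideal I R" and u: "u > 0"
  shows "\<exists>n. ideal_power R I n \<subseteq> rational_power R I u"
proof -
  obtain p q :: nat where p: "p > 0" and q: "q > 0"
    and J: "rational_power R I u = {f \<in> carrier R. power_growth I p q (PIdl f)}"
    using rational_power_eq_growth[OF I u] by metis
  have "f \<in> rational_power R I u" if f: "f \<in> ideal_power R I p" for f
  proof -
    have fc: "f \<in> carrier R" using f ideal.Icarr[OF ideal_ideal_power[OF I]] by blast
    have "f [^] k \<in> ideal_power R I m" if "q * m + 0 \<le> p * k" for k m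
    proof -
      have "m \<le> q * m" using q by simp
      then have "m \<le> p * k" using that by linarith
      then show ?thesis using ideal_power_pow_mem[OF I f, of k] ideal_power_antimono[OF I] by blast
    qed
    then show ?thesis unfolding J using fc power_growth_principal[OF I fc] by blast
  qed
  then show ?thesis by blast
qed

lemma ideal_power_mult_elem:
  assumes A: "ideal A R" and f: "f \<in> carrier R" and x: "x \<in> ideal_power R A k"
  shows "x \<otimes> f [^] k \<in> ideal_power R ((\<lambda>a. f \<otimes> a) ` A) k"
proof -
  have B: "ideal ((\<lambda>a. f \<otimes> a) ` A) R" by (rule mult_image_ideal[OF f A])
  have "ideal_power R A k \<subseteq> ideal_colon R (ideal_power R ((\<lambda>a. f \<otimes> a) ` A) k) {f [^] k}"
  proof (induction k)
    case 0
    then show ?case by auto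
  next
    case (Suc k)
    show ?case
    proof (rule ideal_power_Suc_subset)
      show "ideal (ideal_colon R (ideal_power R ((\<lambda>a. f \<otimes> a) ` A) (Suc k)) {f [^] Suc k}) R"
        using f by (intro ideal_colon_elem ideal_ideal_power B nat_pow_closed)
      fix a b assume a: "a \<in> ideal_power R A k" and b: "b \<in> A"
      have c: "a \<in> carrier R" "b \<in> carrier R" "f [^] k \<in> carrier R"
        using a b f ideal.Icarr[OF ideal_ideal_power[OF A]] ideal.Icarr[OF A] by auto
      have "a \<otimes> f [^] k \<in> ideal_power R ((\<lambda>a. f \<otimes> a) ` A) k" using Suc a by auto
      then have "(a \<otimes> f [^] k) \<otimes> (f \<otimes> b) \<in> ideal_power R ((\<lambda>a. f \<otimes> a) ` A) (Suc k)"
        unfolding ideal_power_Suc using b by (intro ideal_prod.prod) auto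
      moreover have "(a \<otimes> f [^] k) \<otimes> (f \<otimes> b) = (a \<otimes> b) \<otimes> f [^] Suc k"
        unfolding nat_pow_Suc using c f by algebra
      ultimately show "a \<otimes> b \<in> ideal_colon R (ideal_power R ((\<lambda>a. f \<otimes> a) ` A) (Suc k)) {f [^] Suc k}"
        using c by simp
    qed
  qed
  then show ?thesis using x by auto
qed

text \<open>Let \<open>P = (J : f)\<close>. Since \<open>f P\<close> is finitely generated and contained in \<open>J\<close>, there is one constant
  for the growth of all its powers \<open>f^k P^k\<close>. If \<open>P\<close> is not associated to \<open>I^m\<close>, the inclusion
  \<open>P^k \<subseteq> (I^m : f^k)\<close> forces \<open>(I^m : f^k)\<close> to contain an element outside \<open>P\<close>:
  otherwise it would lie in an associated prime of \<open>I^m\<close> contained in \<open>P\<close>, which contains \<open>P^k\<close>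
  and hence is \<open>P\<close>. So \<open>f\<close> itself satisfies the growth condition up to denominators outside \<open>P\<close>,
  and \<open>s f \<in> J\<close> for some \<open>s\<close> outside \<open>P\<close>, a contradiction.\<close>

theorem Ass_rational_power_subset:
  assumes I: "ideal I R" and u: "u > 0"
  shows "Ass R (rational_power R I u) \<subseteq> (\<Union>n. Ass R (ideal_power R I n))"
proof
  note pid = ideal_ideal_power[OF I]
  define J where "J = rational_power R I u"
  have Jid: "ideal J R" unfolding J_def by (rule ideal_rational_power[OF I u])
  obtain p q :: nat where p: "p > 0" and q: "q > 0"
    and J0: "rational_power R I u = {f \<in> carrier R. power_growth I p q (PIdl f)}"
    and J0': "rational_power R I u = {f \<in> carrier R. f [^] q \<in> integral_closure R (ideal_power R I p)}"
    by (rule rational_power_eq_growth[OF I u])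
  note J = J0[folded J_def] and J' = J0'[folded J_def]
  fix P assume "P \<in> Ass R (rational_power R I u)"
  then obtain f where prime: "primeideal P R" and f: "f \<in> carrier R" and P: "P = ideal_colon R J {f}"
    using Ass_iff[OF Jid] unfolding J_def by blast
  have Pid: "ideal P R" using prime primeideal.axioms(1) by blast
  have one: "\<one> \<notin> P" using ideal.one_imp_carrier[OF Pid] primeideal.I_notcarr[OF prime] by blast
  show "P \<in> (\<Union>n. Ass R (ideal_power R I n))"
  proof (rule ccontr)
    assume notin: "P \<notin> (\<Union>n. Ass R (ideal_power R I n))"
    define B where "B = (\<lambda>a. f \<otimes> a) ` P"
    have B: "ideal B R" unfolding B_def by (rule mult_image_ideal[OF f Pid])
    have BJ: "B \<subseteq> J" unfolding B_def using P f by (auto simp: m_comm)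
    have "power_growth I p q B" using B
    proof (induction rule: ideal_sum_induct)
      case (principal x)
      then show ?case using BJ J by blast
    next
      case (sum A C)
      then show ?case using power_growth_sum[OF I _ _ _ _ q] by blast
    qed
    then obtain N where N: "\<And>k m. q * m + N \<le> p * k \<Longrightarrow> ideal_power R B k \<subseteq> ideal_power R I m"
      unfolding power_growth_def by blast
    have "\<exists>s\<in>carrier R - P. s \<otimes> f [^] k \<in> ideal_power R I m" if km: "q * m + N \<le> p * k" for k m
    proof (rule ccontr)
      assume none: "\<not> ?thesis"
      have fk: "f [^] k \<in> carrier R" using f by simp
      have "\<exists>Q\<in>Ass R (ideal_power R I m). ideal_colon R (ideal_power R I m) {f [^] k} \<subseteq> Q \<and>
          Q \<inter> (carrier R - P) = {}"
      proof (rule associated_prime_avoiding[OF pid fk])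
        show "\<one> \<in> carrier R - P" using one by simp
        show "s \<otimes> t \<in> carrier R - P" if "s \<in> carrier R - P" "t \<in> carrier R - P" for s t
          using primeideal.I_prime[OF prime, of s t] that by auto
        show "t \<otimes> f [^] k \<notin> ideal_power R I m" if "t \<in> carrier R - P" for t using none that by blast
      qed auto
      then obtain Q where Q: "Q \<in> Ass R (ideal_power R I m)"
        "ideal_colon R (ideal_power R I m) {f [^] k} \<subseteq> Q" "Q \<inter> (carrier R - P) = {}" by blast
      have QP: "Q \<subseteq> P" using Q(3) ideal_subset[OF Ass_ideal[OF Q(1)]] by blast
      have "ideal_power R P k \<subseteq> ideal_colon R (ideal_power R I m) {f [^] k}"
      proof
        fix x assume x: "x \<in> ideal_power R P k"
        have "x \<otimes> f [^] k \<in> ideal_power R B k" unfolding B_def by (rule ideal_power_mult_elem[OF Pid f x])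
        then show "x \<in> ideal_colon R (ideal_power R I m) {f [^] k}"
          using N[OF km] ideal.Icarr[OF ideal_ideal_power[OF Pid] x] by auto
      qed
      then have "ideal_power R P k \<subseteq> Q" using Q(2) by blast
      then have "P \<subseteq> Q" by (rule prime_ideal_power_subset[OF Ass_prime[OF Q(1)] Pid])
      then have "P = Q" using QP by blast
      then show False using Q(1) notin by blast
    qed
    moreover have "s \<otimes> t \<in> carrier R - P" if "s \<in> carrier R - P" "t \<in> carrier R - P" for s t
      using primeideal.I_prime[OF prime, of s t] that by auto
    moreover have "carrier R - P \<noteq> {}" using one by blast
    ultimately have "\<exists>s\<in>carrier R - P. (s \<otimes> f) [^] q \<in> integral_closure R (ideal_power R I p)"
      using local_growth_imp_integral[OF I f p q, of "carrier R - P" N] by blast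
    then obtain s where s: "s \<in> carrier R" "s \<notin> P" "(s \<otimes> f) [^] q \<in> integral_closure R (ideal_power R I p)"
      by blast
    then have "s \<otimes> f \<in> J" unfolding J' using f by simp
    then show False using s P by simp
  qed
qed

corollary finite_Ass_star:
  assumes "ideal I R"
  shows "finite (Ass_star R I)"
proof (rule finite_subset[OF _ finite_Ass_powers[OF assms]])
  show "Ass_star R I \<subseteq> (\<Union>n. Ass R (ideal_power R I n))"
    unfolding Ass_star_def using Ass_rational_power_subset[OF assms] by auto
qed

lemma Ass_rational_power_contains:
  assumes I: "ideal I R" and u: "u > 0" and P: "P \<in> Ass R (rational_power R I u)"
  shows "I \<subseteq> P"
proof -
  obtain n where n: "ideal_power R I n \<subseteq> rational_power R I u" using rational_power_contains_power[OF I u] by blast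
  have Jid: "ideal (rational_power R I u) R" by (rule ideal_rational_power[OF I u])
  obtain z where "z \<in> carrier R" "P = ideal_colon R (rational_power R I u) {z}"
    using P Ass_iff[OF Jid] by blast
  then have "rational_power R I u \<subseteq> P" using subset_colon_elem[OF Jid] by blast
  then show ?thesis using prime_ideal_power_subset[OF Ass_prime[OF P] I] n by blast
qed

text \<open>Positive grade is the existence of a regular element in \<open>P\<close>; that a regular element of \<open>P\<close> is a
  regular sequence, as \<open>I + (x)\<close> is a proper ideal, uses \<open>I \<subseteq> P\<close>.\<close>

lemma grade_ge_1_iff_not_below_Ass:
  assumes I: "ideal I R" and u: "u > 0" and P: "P \<in> Ass R (rational_power R I u)"
  shows "grade_quot R P I \<ge> 1 \<longleftrightarrow> \<not> (\<exists>Q\<in>Ass R I. P \<subseteq> Q)"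
proof -
  have "P \<noteq> carrier R" using primeideal.I_notcarr[OF Ass_prime[OF P]] by blast
  then show ?thesis
    using grade_quot_ge_1_iff[OF I Ass_ideal[OF P] _ Ass_rational_power_contains[OF I u P]]
      contains_regular_iff[OF I Ass_ideal[OF P]] by blast
qed

lemma rational_symbolic_power_iff:
  assumes I: "ideal I R" and u: "u > 0"
  shows "r \<in> rational_symbolic_power R I u \<longleftrightarrow>
    r \<in> carrier R \<and> (\<forall>P\<in>Ass R I. \<exists>s\<in>carrier R - P. s \<otimes> r \<in> rational_power R I u)"
proof -
  have "r \<in> loc_contraction R P (rational_power R I u) \<longleftrightarrow>
      r \<in> carrier R \<and> (\<exists>s\<in>carrier R - P. s \<otimes> r \<in> rational_power R I u)" if "P \<in> Ass R I" for P
  proof -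
    interpret prime_localization R P
      using Ass_prime[OF that] is_cring by (simp add: prime_localization_def)
    show ?thesis by (rule loc_contraction_iff[OF ideal_rational_power[OF I u]])
  qed
  then show ?thesis by (auto simp: rational_symbolic_power_def ideal_Inter_def)
qed

lemma saturated_power_iff:
  assumes L: "ideal L R" and J: "ideal (rational_power R I u) R"
  shows "r \<in> saturated_power R I L u \<longleftrightarrow>
    r \<in> carrier R \<and> (\<exists>m. ideal_power R L m \<subseteq> ideal_colon R (rational_power R I u) {r})"
proof -
  have "(\<forall>l\<in>ideal_power R L m. r \<otimes> l \<in> rational_power R I u) \<longleftrightarrow>
      ideal_power R L m \<subseteq> ideal_colon R (rational_power R I u) {r}" if "r \<in> carrier R" for m
    using that ideal.Icarr[OF ideal_ideal_power[OF L]] by (auto simp: m_comm[of r])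
  then have mem: "r \<in> saturated_power R I L u \<longleftrightarrow>
      r \<in> carrier R \<and> (\<exists>m\<ge>1. ideal_power R L m \<subseteq> ideal_colon R (rational_power R I u) {r})"
    unfolding saturated_power_def saturation_def ideal_colon_def[of R _ "ideal_power R L _"]
    by (auto simp del: colon_elem_iff)
  have "ideal_power R L (Suc m) \<subseteq> ideal_power R L m" for m
    by (rule ideal_power_antimono[OF L le_SucI[OF le_refl]])
  then have "\<exists>m\<ge>1. ideal_power R L m \<subseteq> ideal_colon R (rational_power R I u) {r}"
    if "ideal_power R L m \<subseteq> ideal_colon R (rational_power R I u) {r}" for m
    using that subset_trans by (intro exI[of _ "Suc m"] conjI) (simp, blast)
  then show ?thesis unfolding mem by metis
qed

text \<open>Let \<open>r\<close> be in the symbolic power and \<open>J\<close> the rational power. If no power of some \<open>l \<in> L\<close>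
  multiplied \<open>r\<close> into \<open>J\<close>, there would be an associated prime \<open>Q\<close> of \<open>J\<close> that contains \<open>(J : r)\<close>
  but not \<open>l\<close>. As \<open>L\<close> is not contained in \<open>Q\<close>, this prime would lie below some \<open>P \<in> Ass(I)\<close>,
  although \<open>(J : r)\<close> has an element outside \<open>P\<close>. As \<open>L\<close> is finitely generated, a single power of
  \<open>L\<close> then works for all \<open>l\<close>. The converse holds because no power of \<open>L\<close> is contained in a
  member of \<open>Ass(I)\<close>.\<close>

theorem saturation_eq_symbolic_power:
  assumes I: "ideal I R" and u: "u > 0" and L: "ideal L R"
    and below: "\<And>P. P \<in> Ass R (rational_power R I u) \<Longrightarrow> \<not> (\<exists>Q\<in>Ass R I. P \<subseteq> Q) \<Longrightarrow> L \<subseteq> P"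
    and above: "\<And>Q. Q \<in> Ass R I \<Longrightarrow> \<not> L \<subseteq> Q"
  shows "rational_symbolic_power R I u = saturated_power R I L u"
proof -
  define J where "J = rational_power R I u"
  have J: "ideal J R" unfolding J_def by (rule ideal_rational_power[OF I u])
  show ?thesis
  proof (rule Set.set_eqI)
    fix r
    show "r \<in> rational_symbolic_power R I u \<longleftrightarrow> r \<in> saturated_power R I L u"
      unfolding rational_symbolic_power_iff[OF I u] saturated_power_iff[OF L J[unfolded J_def]] J_def[symmetric]
    proof (intro conj_cong refl iffI)
      assume r: "r \<in> carrier R" and loc: "\<forall>P\<in>Ass R I. \<exists>s\<in>carrier R - P. s \<otimes> r \<in> J"
      have "\<exists>n. l [^] (n::nat) \<in> ideal_colon R J {r}" if l: "l \<in> L" for l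
      proof (rule ccontr)
        assume none: "\<not> ?thesis"
        have lc: "l \<in> carrier R" using ideal.Icarr[OF L l] .
        have "\<exists>Q\<in>Ass R J. ideal_colon R J {r} \<subseteq> Q \<and> Q \<inter> range (\<lambda>n::nat. l [^] n) = {}"
        proof (rule associated_prime_avoiding[OF J r])
          show "range (\<lambda>n::nat. l [^] n) \<subseteq> carrier R" using lc by auto
          show "\<one> \<in> range (\<lambda>n::nat. l [^] n)" by (auto intro!: image_eqI[of _ _ 0])
          show "s \<otimes> t \<in> range (\<lambda>n::nat. l [^] n)" if "s \<in> range (\<lambda>n::nat. l [^] n)" "t \<in> range (\<lambda>n::nat. l [^] n)" for s t
            using that nat_pow_mult[OF lc] by auto
          show "t \<otimes> r \<notin> J" if "t \<in> range (\<lambda>n::nat. l [^] n)" for t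
            using that none lc by auto
        qed
        then obtain Q where Q: "Q \<in> Ass R J" "ideal_colon R J {r} \<subseteq> Q" "Q \<inter> range (\<lambda>n::nat. l [^] n) = {}" by blast
        have "l [^] (1::nat) \<notin> Q" using Q(3) by blast
        then have "\<not> L \<subseteq> Q" using l lc by auto
        then obtain P where P: "P \<in> Ass R I" "Q \<subseteq> P" using below Q(1) unfolding J_def by blast
        then obtain s where s: "s \<in> carrier R - P" "s \<otimes> r \<in> J" using loc by blast
        then have "s \<in> ideal_colon R J {r}" by simp
        then show False using s P(2) Q(2) by blast
      qed
      then show "\<exists>m. ideal_power R L m \<subseteq> ideal_colon R J {r}"
        by (rule ideal_power_subset_of_radical[OF L ideal_colon_elem[OF J r]])
    next
      assume r: "r \<in> carrier R" and "\<exists>m. ideal_power R L m \<subseteq> ideal_colon R J {r}"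
      then obtain m where m: "ideal_power R L m \<subseteq> ideal_colon R J {r}" by blast
      show "\<forall>P\<in>Ass R I. \<exists>s\<in>carrier R - P. s \<otimes> r \<in> J"
      proof
        fix P assume P: "P \<in> Ass R I"
        have "\<not> ideal_power R L m \<subseteq> P"
          using prime_ideal_power_subset[OF Ass_prime[OF P] L] above[OF P] by blast
        then obtain s where s: "s \<in> ideal_power R L m" "s \<notin> P" by blast
        then have "s \<in> ideal_colon R J {r}" using m by blast
        then show "\<exists>s\<in>carrier R - P. s \<otimes> r \<in> J" using s(2) by auto
      qed
    qed
  qed
qed

lemma saturation_at_intersection:
  assumes I: "ideal I R" and u: "u > 0" and F: "finite F"
    and F_primes: "\<And>P. P \<in> F \<Longrightarrow> ideal P R" "\<And>P Q. P \<in> F \<Longrightarrow> Q \<in> Ass R I \<Longrightarrow> \<not> P \<subseteq> Q"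
    and F_all: "\<And>P. P \<in> Ass R (rational_power R I u) \<Longrightarrow> \<not> (\<exists>Q\<in>Ass R I. P \<subseteq> Q) \<Longrightarrow> P \<in> F"
  shows "rational_symbolic_power R I u = saturated_power R I (ideal_Inter R F) u"
proof (rule saturation_eq_symbolic_power[OF I u])
  show "ideal (ideal_Inter R F) R"
  proof (cases "F = {}")
    case True
    then show ?thesis by (simp add: ideal_Inter_def oneideal)
  next
    case False
    have "ideal (\<Inter>F) R" using F_primes(1) False by (intro i_Intersect)
    then show ?thesis unfolding ideal_Inter_def by (intro i_intersect oneideal)
  qed
  show "ideal_Inter R F \<subseteq> P"
    if "P \<in> Ass R (rational_power R I u)" "\<not> (\<exists>Q\<in>Ass R I. P \<subseteq> Q)" for P
    using F_all[OF that] by (auto simp: ideal_Inter_def)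
  show "\<not> ideal_Inter R F \<subseteq> Q" if Q: "Q \<in> Ass R I" for Q
    using prime_avoids_intersection[OF F F_primes(1) F_primes(2)[OF _ Q] Ass_prime[OF Q]] by blast
qed

lemma primary_mult_radical:
  assumes "primary_ideal R q" "r \<in> carrier R" "s \<in> carrier R" "s \<notin> radical R q" "s \<otimes> r \<in> q"
  shows "r \<in> q"
  using assms m_comm[of s r] unfolding primary_ideal_def radical_def by auto

text \<open>A component whose radical is not contained in \<open>P\<close> is not contained in \<open>P\<close> either. So an element
  of the remaining components is multiplied into all components by some \<open>s\<close> outside \<open>P\<close>.
  Conversely, \<open>s\<close> outside \<open>P\<close> is not in the radical of a component below \<open>P\<close> and can be
  cancelled there. Irredundancy is inherited, because a component that contains the intersection
  of the other selected components contains the intersection of all others.\<close>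

theorem symbolic_power_primary_decomposition:
  assumes I: "ideal I R" and u: "u > 0"
    and Q: "irredundant_primary_decomposition R Q (rational_power R I u)"
  shows "irredundant_primary_decomposition R {q \<in> Q. \<exists>P\<in>Ass R I. radical R q \<subseteq> P}
    (rational_symbolic_power R I u)"
proof -
  define Q' where "Q' = {q \<in> Q. \<exists>P\<in>Ass R I. radical R q \<subseteq> P}"
  have fin: "finite Q" and prim: "\<And>q. q \<in> Q \<Longrightarrow> primary_ideal R q"
    and J: "ideal_Inter R Q = rational_power R I u"
    and irr: "\<And>q. q \<in> Q \<Longrightarrow> ideal_Inter R (Q - {q}) \<noteq> rational_power R I u"
    and inj: "inj_on (radical R) Q"
    using Q unfolding irredundant_primary_decomposition_def by blast+
  have Q'Q: "Q' \<subseteq> Q" unfolding Q'_def by blast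
  have sym: "ideal_Inter R Q' = rational_symbolic_power R I u"
  proof (rule Set.set_eqI)
    fix r
    show "r \<in> ideal_Inter R Q' \<longleftrightarrow> r \<in> rational_symbolic_power R I u"
      unfolding rational_symbolic_power_iff[OF I u] J[symmetric]
    proof
      assume r: "r \<in> ideal_Inter R Q'"
      have rc: "r \<in> carrier R" using r by (simp add: ideal_Inter_def)
      have "\<exists>s\<in>carrier R - P. s \<otimes> r \<in> ideal_Inter R Q" if P: "P \<in> Ass R I" for P
      proof -
        have "\<exists>s\<in>ideal_Inter R {q \<in> Q. \<not> radical R q \<subseteq> P}. s \<notin> P"
        proof (rule prime_avoids_intersection[OF _ _ _ Ass_prime[OF P]])
          show "finite {q \<in> Q. \<not> radical R q \<subseteq> P}" using fin by simp
          show "ideal q R" if "q \<in> {q \<in> Q. \<not> radical R q \<subseteq> P}" for q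
            using that prim unfolding primary_ideal_def by blast
          show "\<not> q \<subseteq> P" if q: "q \<in> {q \<in> Q. \<not> radical R q \<subseteq> P}" for q
          proof -
            obtain x where x: "x \<in> radical R q" "x \<notin> P" using q by blast
            then obtain n :: nat where "x \<in> carrier R" "x [^] n \<in> q" unfolding radical_def by blast
            then show ?thesis using x(2) prime_pow_mem[OF Ass_prime[OF P], of x n] by blast
          qed
        qed
        then obtain s where s: "s \<in> carrier R" "s \<notin> P" "\<And>q. q \<in> Q \<Longrightarrow> \<not> radical R q \<subseteq> P \<Longrightarrow> s \<in> q"
          by (auto simp: ideal_Inter_def)
        have "s \<otimes> r \<in> q" if q: "q \<in> Q" for q
        proof -
          have qi: "ideal q R" using prim[OF q] unfolding primary_ideal_def by blast
          show ?thesis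
          proof (cases "radical R q \<subseteq> P")
            case True
            then have "r \<in> q" using r q P unfolding Q'_def ideal_Inter_def by blast
            then show ?thesis using ideal.I_l_closed[OF qi _ s(1)] by blast
          next
            case False
            then show ?thesis using s(3)[OF q] ideal.I_r_closed[OF qi _ rc] by blast
          qed
        qed
        then have "s \<otimes> r \<in> ideal_Inter R Q" using s(1) rc by (simp add: ideal_Inter_def)
        then show ?thesis using s by blast
      qed
      then show "r \<in> carrier R \<and> (\<forall>P\<in>Ass R I. \<exists>s\<in>carrier R - P. s \<otimes> r \<in> ideal_Inter R Q)"
        using rc by blast
    next
      assume r: "r \<in> carrier R \<and> (\<forall>P\<in>Ass R I. \<exists>s\<in>carrier R - P. s \<otimes> r \<in> ideal_Inter R Q)"
      have "r \<in> q" if q: "q \<in> Q'" for q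
      proof -
        obtain P where P: "P \<in> Ass R I" "radical R q \<subseteq> P" and qQ: "q \<in> Q" using q unfolding Q'_def by blast
        obtain s where s: "s \<in> carrier R" "s \<notin> P" "s \<otimes> r \<in> ideal_Inter R Q" using r P by blast
        have "s \<otimes> r \<in> q" using s(3) qQ by (simp add: ideal_Inter_def)
        then show ?thesis using primary_mult_radical[OF prim[OF qQ] _ s(1)] r s(2) P(2) by blast
      qed
      then show "r \<in> ideal_Inter R Q'" using r by (simp add: ideal_Inter_def)
    qed
  qed
  have "ideal_Inter R (Q' - {q}) \<noteq> ideal_Inter R Q'" if q: "q \<in> Q'" for q
  proof
    assume eq: "ideal_Inter R (Q' - {q}) = ideal_Inter R Q'"
    have "ideal_Inter R (Q - {q}) \<subseteq> ideal_Inter R (Q' - {q})" using Q'Q by (auto simp: ideal_Inter_def)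
    also have "\<dots> \<subseteq> q" unfolding eq using q by (auto simp: ideal_Inter_def)
    finally have "ideal_Inter R (Q - {q}) = ideal_Inter R Q" using q Q'Q by (auto simp: ideal_Inter_def)
    then show False using irr J q Q'Q by blast
  qed
  then have "irredundant_primary_decomposition R Q' (rational_symbolic_power R I u)"
    unfolding irredundant_primary_decomposition_def sym[symmetric]
    using finite_subset[OF Q'Q fin] prim Q'Q inj_on_subset[OF inj Q'Q] by blast
  then show ?thesis unfolding Q'_def .
qed

end

theorem theorem3p4:
  fixes R :: "('a, 'b) ring_scheme" (structure)
    and I K K_u :: "'a set" and u :: rat
  assumes "cring R" and "noetherian_ring R" and "ideal I R" and "u > 0"
    and K: "K = ideal_Inter R {p \<in> Ass_star R I. grade_quot R p I \<ge> 1}"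
    and K_u: "K_u = ideal_Inter R {p \<in> Ass R (rational_power R I u). grade_quot R p I \<ge> 1}"
  shows "rational_symbolic_power R I u = saturated_power R I K u \<and>
         rational_symbolic_power R I u = saturated_power R I K_u u \<and>
         (\<forall>x. (if {p \<in> Ass_star R I. grade_quot R p I \<ge> 1} \<noteq> {}
               then x \<in> K \<and> regular_on_quot R I x else x = \<one>) \<longrightarrow>
            rational_symbolic_power R I u = saturated_power R I (PIdl x) u) \<and>
         (\<forall>Q. irredundant_primary_decomposition R Q (rational_power R I u) \<longrightarrow>
            irredundant_primary_decomposition R {q \<in> Q. \<exists>P\<in>Ass R I. radical R q \<subseteq> P}
              (rational_symbolic_power R I u))"
proof -
  interpret noetherian_cring R
    using assms(1,2) by (simp add: noetherian_cring_def)
  note I = \<open>ideal I R\<close> and u = \<open>u > 0\<close>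
  define F where "F = {p \<in> Ass_star R I. grade_quot R p I \<ge> 1}"
  define F_u where "F_u = {p \<in> Ass R (rational_power R I u). grade_quot R p I \<ge> 1}"
  have F_u_F: "F_u \<subseteq> F" unfolding F_u_def F_def Ass_star_def using u by auto
  have F_fin: "finite F" "finite F_u"
    using finite_Ass_star[OF I] finite_subset[OF F_u_F] unfolding F_def by auto
  have F_id: "ideal P R" and F_nb: "\<not> (\<exists>Q\<in>Ass R I. P \<subseteq> Q)" if P: "P \<in> F" for P
  proof -
    obtain v where v: "v > 0" "P \<in> Ass R (rational_power R I v)" "grade_quot R P I \<ge> 1"
      using P unfolding F_def Ass_star_def by auto
    show "ideal P R" using Ass_ideal[OF v(2)] .
    show "\<not> (\<exists>Q\<in>Ass R I. P \<subseteq> Q)" using grade_ge_1_iff_not_below_Ass[OF I v(1,2)] v(3) by blast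
  qed
  have F_all: "P \<in> F_u" if "P \<in> Ass R (rational_power R I u)" "\<not> (\<exists>Q\<in>Ass R I. P \<subseteq> Q)" for P
    unfolding F_u_def using that grade_ge_1_iff_not_below_Ass[OF I u that(1)] by blast
  have "rational_symbolic_power R I u = saturated_power R I K u"
    unfolding K F_def[symmetric]
    using F_id F_nb F_all F_u_F by (intro saturation_at_intersection[OF I u F_fin(1)]) blast+
  moreover have "rational_symbolic_power R I u = saturated_power R I K_u u"
    unfolding K_u F_u_def[symmetric]
    using F_id F_nb F_all F_u_F by (intro saturation_at_intersection[OF I u F_fin(2)]) blast+
  moreover have "rational_symbolic_power R I u = saturated_power R I (PIdl x) u"
    if x: "if F \<noteq> {} then x \<in> K \<and> regular_on_quot R I x else x = \<one>" for x
  proof (rule saturation_eq_symbolic_power[OF I u])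
    have xc: "x \<in> carrier R" using x by (auto simp: K ideal_Inter_def split: if_splits)
    have x_F: "x \<in> P" if "P \<in> F" for P using x that by (auto simp: K F_def ideal_Inter_def split: if_splits)
    \<comment> \<open>The element \<open>x = 1\<close> is regular too, so both cases can be treated alike.\<close>
    have reg: "regular_on_quot R I x"
      using x by (auto simp: regular_on_quot_iff[OF I] split: if_splits)
    show "ideal (PIdl x) R" using xc by (rule cgenideal_ideal)
    show "PIdl x \<subseteq> P" if "P \<in> Ass R (rational_power R I u)" "\<not> (\<exists>Q\<in>Ass R I. P \<subseteq> Q)" for P
      using cgenideal_minimal[OF Ass_ideal[OF that(1)]] x_F F_all[OF that] F_u_F by blast
    show "\<not> PIdl x \<subseteq> Q" if Q: "Q \<in> Ass R I" for Q
    proof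
      assume "PIdl x \<subseteq> Q"
      then have "x \<in> Q" using cgenideal_self[OF xc] by blast
      then show False using contains_regular_iff[OF I Ass_ideal[OF Q]] reg Q by blast
    qed
  qed
  ultimately show ?thesis
    using symbolic_power_primary_decomposition[OF I u] unfolding F_def by blast
qed

end
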